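(* Let $W_n$ be an $n\times n$ GUE matrix (Hermitian, centered jointly complex Gaussian entries with $E[W_{ij}W_{kl}]=\frac1n\delta_{il}\delta_{jk}$) and let $A_n$ be an $n\times n$ real symmetric patterned random matrix, independent of $W_n$, whose link function satisfies Property B, whose input variables are independent real random variables with mean $0$, variance $1$ and, for every $m$, uniformly bounded $m$-th absolute moments, and such that $\frac{1}{\sqrt n}A_n$ has a limiting spectral distribution. Then $W_n$ and $\frac1{\sqrt n}A_n$ are asymptotically free: they converge jointly in distribution with respect to $\varphi_2$ to a pair $(s,a)$ in some non-commutative probability space such that the unital subalgebras generated by $s$ and by $a$ are free.
   Context: A patterned matrix with (symmetric) link function $L:\{1,\dots,n\}^2\to\mathbb Z^d$ ($d=1$ or $2$; dependence on $n$ suppressed) and input sequence $\{x(t)\}$ of real random variables is the $n\times n$ real symmetric matrix with $(i,j)$ entry $x(L(i,j))$. Property B: $\sup_n\sup_t\sup_{1\le k\le n}\#\{l:1\le l\le n,\ L(k,l)=t\}<\infty$. The limiting spectral distribution (LSD) of a sequence of real symmetric random matrices is the (non-random) probability measure to which the spectral measures $L_n=\frac1n\sum_{i=1}^n\delta_{\lambda_i}$ ($\lambda_i$ the eigenvalues) converge weakly almost surely, if it exists. A non-commutative probability space is a pair $(\mathcal A,\varphi)$ with $\mathcal A$ a unital algebra over $\mathbb C$ and $\varphi:\mathcal A\to\mathbb C$ linear with $\varphi(1)=1$. $\varphi_2(M)=\frac1nE[\mathrm{Tr}(M)]$ for $n\times n$ random matrices. Joint convergence in distribution means convergence of all joint moments.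 Unital subalgebras $\{\mathcal A_i\}_{i\in I}$ are free if $\varphi(a_1\cdots a_n)=0$ whenever $\varphi(a_j)=0$, $a_j\in\mathcal A_{i_j}$ and $i_j\ne i_{j+1}$ for all $j$. *)

theory Defs
  imports
    "HOL-Probability.Probability"
    "HOL-Algebra.Subrings"
    "HOL-Algebra.Module"
    "Jordan_Normal_Form.Char_Poly"
    "Jordan_Normal_Form.VS_Connect"
begin

section \<open>Non-commutative probability spaces and freeness\<close>

text \<open>The locale \<open>algebra\<close> of HOL-Algebra is restricted to commutative algebras.\<close>

locale complex_algebra =
  V?: module "class_ring :: complex ring" A + A?: ring A for A (structure) +
  assumes smult_mult_left:
      "\<lbrakk>a \<in> carrier A; b \<in> carrier A\<rbrakk> \<Longrightarrow> (c \<odot> a) \<otimes> b = c \<odot> (a \<otimes> b)"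
    and smult_mult_right:
      "\<lbrakk>a \<in> carrier A; b \<in> carrier A\<rbrakk> \<Longrightarrow> a \<otimes> (c \<odot> b) = c \<odot> (a \<otimes> b)"

locale nc_prob_space = complex_algebra A for A (structure) +
  fixes \<phi> :: "'a \<Rightarrow> complex"
  assumes phi_add: "\<lbrakk>a \<in> carrier A; b \<in> carrier A\<rbrakk> \<Longrightarrow> \<phi> (a \<oplus> b) = \<phi> a + \<phi> b"
    and phi_smult: "a \<in> carrier A \<Longrightarrow> \<phi> (c \<odot> a) = c * \<phi> a"
    and phi_one: "\<phi> \<one> = 1"

definition unital_subalgebra :: "(complex, 'a) module \<Rightarrow> 'a set \<Rightarrow> bool" where
  "unital_subalgebra A B \<longleftrightarrow>
     subring B A \<and> Module.submodule B (class_ring :: complex ring) A"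

definition generated_subalgebra :: "(complex, 'a) module \<Rightarrow> 'a set \<Rightarrow> 'a set" where
  "generated_subalgebra A S = \<Inter>{B. unital_subalgebra A B \<and> S \<subseteq> B}"

definition alg_prod :: "(complex, 'a) module \<Rightarrow> 'a list \<Rightarrow> 'a" where
  "alg_prod A as = foldr (\<lambda>a p. a \<otimes>\<^bsub>A\<^esub> p) as \<one>\<^bsub>A\<^esub>"

text \<open>Only nonempty products are considered, since the empty product has \<open>\<phi> \<one> = 1\<close>.\<close>

definition free_subalgebras ::
    "(complex, 'a) module \<Rightarrow> ('a \<Rightarrow> complex) \<Rightarrow> 'i set \<Rightarrow> ('i \<Rightarrow> 'a set) \<Rightarrow> bool" where
  "free_subalgebras A \<phi> I B \<longleftrightarrow>
     (\<forall>i\<in>I. unital_subalgebra A (B i)) \<and>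
     (\<forall>as is. as \<noteq> [] \<longrightarrow> length is = length as \<longrightarrow> set is \<subseteq> I \<longrightarrow>
        (\<forall>j<length as. as ! j \<in> B (is ! j) \<and> \<phi> (as ! j) = 0) \<longrightarrow>
        (\<forall>j. Suc j < length as \<longrightarrow> is ! j \<noteq> is ! Suc j) \<longrightarrow>
        \<phi> (alg_prod A as) = 0)"


section \<open>Random matrices\<close>

definition mat_trace :: "complex mat \<Rightarrow> complex" where
  "mat_trace X = (\<Sum>i<dim_row X. X $$ (i, i))"

definition phi2 :: "'w measure \<Rightarrow> nat \<Rightarrow> ('w \<Rightarrow> complex mat) \<Rightarrow> complex" where
  "phi2 M n X = (1 / of_nat n) * (LINT \<omega>|M. mat_trace (X \<omega>))"

definition matrix_word :: "nat \<Rightarrow> ('i \<Rightarrow> 'w \<Rightarrow> complex mat) \<Rightarrow> 'i list \<Rightarrow> 'w \<Rightarrow> complex mat" where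
  "matrix_word n X w \<omega> = foldr (\<lambda>i P. X i \<omega> * P) w (1\<^sub>m n)"

text \<open>
  Convergence of all joint moments. The Bochner integral of a non-integrable function is \<open>0\<close>,
  so existence of the moments is part of the definition.
\<close>

definition converges_jointly ::
    "'w measure \<Rightarrow> (nat \<Rightarrow> 'i \<Rightarrow> 'w \<Rightarrow> complex mat) \<Rightarrow>
     (complex, 'a) module \<Rightarrow> ('a \<Rightarrow> complex) \<Rightarrow> ('i \<Rightarrow> 'a) \<Rightarrow> bool" where
  "converges_jointly M X A \<phi> a \<longleftrightarrow>
     (\<forall>w. (\<forall>n. integrable M (\<lambda>\<omega>. mat_trace (matrix_word n (X n) w \<omega>))) \<and>
          (\<lambda>n. phi2 M n (matrix_word n (X n) w)) \<longlonglongrightarrow> \<phi> (alg_prod A (map a w)))"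

definition mat_entries :: "nat \<Rightarrow> ('w \<Rightarrow> complex mat) \<Rightarrow> 'w \<Rightarrow> nat \<times> nat \<Rightarrow> complex" where
  "mat_entries n X \<omega> = (\<lambda>ij\<in>{..<n} \<times> {..<n}. X \<omega> $$ ij)"

definition independent_matrices ::
    "'w measure \<Rightarrow> nat \<Rightarrow> ('w \<Rightarrow> complex mat) \<Rightarrow> ('w \<Rightarrow> complex mat) \<Rightarrow> bool" where
  "independent_matrices M n X Y \<longleftrightarrow>
     prob_space.indep_var M
       (\<Pi>\<^sub>M ij\<in>{..<n} \<times> {..<n}. borel) (mat_entries n X)
       (\<Pi>\<^sub>M ij\<in>{..<n} \<times> {..<n}. borel) (mat_entries n Y)"


section \<open>The GUE\<close>

text \<open>Degenerate Gaussians are included: the diagonal of a Hermitian matrix has zero imaginary part.\<close>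

definition centered_gaussian :: "'w measure \<Rightarrow> ('w \<Rightarrow> real) \<Rightarrow> bool" where
  "centered_gaussian M Y \<longleftrightarrow> Y \<in> borel_measurable M \<and>
     ((AE \<omega> in M. Y \<omega> = 0) \<or>
      (\<exists>\<sigma>>0. distributed M lborel Y (\<lambda>y. ennreal (normal_density 0 \<sigma> y))))"

text \<open>
  \<open>Re (\<Sum>i. c i * X i)\<close>, for complex \<open>c\<close>, ranges over all real linear combinations of
  the real and imaginary parts of the \<open>X i\<close>.
\<close>

definition jointly_centered_complex_gaussian ::
    "'w measure \<Rightarrow> 'i set \<Rightarrow> ('i \<Rightarrow> 'w \<Rightarrow> complex) \<Rightarrow> bool" where
  "jointly_centered_complex_gaussian M I X \<longleftrightarrow>
     (\<forall>i\<in>I. X i \<in> borel_measurable M) \<and>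
     (\<forall>c. centered_gaussian M (\<lambda>\<omega>. Re (\<Sum>i\<in>I. c i * X i \<omega>)))"

definition GUE :: "'w measure \<Rightarrow> nat \<Rightarrow> ('w \<Rightarrow> complex mat) \<Rightarrow> bool" where
  "GUE M n W \<longleftrightarrow>
     (\<forall>\<omega>\<in>space M. W \<omega> \<in> carrier_mat n n \<and>
        (\<forall>i<n. \<forall>j<n. W \<omega> $$ (i, j) = cnj (W \<omega> $$ (j, i)))) \<and>
     jointly_centered_complex_gaussian M ({..<n} \<times> {..<n}) (\<lambda>ij \<omega>. W \<omega> $$ ij) \<and>
     (\<forall>i<n. \<forall>j<n. \<forall>k<n. \<forall>l<n.
        (LINT \<omega>|M. W \<omega> $$ (i, j) * W \<omega> $$ (k, l)) =
          (1 / of_nat n) * (if i = l then 1 else 0) * (if j = k then 1 else 0))"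


section \<open>Patterned matrices and limiting spectral distributions\<close>

text \<open>
  \<open>L n\<close> is the link function for size \<open>n\<close>; only its values on \<open>{1..n} \<times> {1..n}\<close> matter.
  Matrix positions are counted from \<open>0\<close>, hence the shift in \<open>patterned_matrix\<close>.
\<close>

definition symmetric_link :: "(nat \<Rightarrow> nat \<times> nat \<Rightarrow> 't) \<Rightarrow> bool" where
  "symmetric_link L \<longleftrightarrow> (\<forall>n. \<forall>i\<in>{1..n}. \<forall>j\<in>{1..n}. L n (i, j) = L n (j, i))"

definition property_B :: "(nat \<Rightarrow> nat \<times> nat \<Rightarrow> 't) \<Rightarrow> bool" where
  "property_B L \<longleftrightarrow> (\<exists>C. \<forall>n t. \<forall>k\<in>{1..n}. card {l \<in> {1..n}. L n (k, l) = t} \<le> C)"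

definition patterned_matrix ::
    "(nat \<Rightarrow> nat \<times> nat \<Rightarrow> 't) \<Rightarrow> ('t \<Rightarrow> 'w \<Rightarrow> real) \<Rightarrow> nat \<Rightarrow> 'w \<Rightarrow> real mat" where
  "patterned_matrix L x n \<omega> = mat n n (\<lambda>(i, j). x (L n (Suc i, Suc j)) \<omega>)"

text \<open>
  Eigenvalues are counted with algebraic multiplicity. A real symmetric matrix of size \<open>n \<ge> 1\<close>
  has \<open>n\<close> real eigenvalues, so each one gets mass \<open>1 / n\<close>; for size \<open>0\<close> the value is junk,
  which does not affect limits.
\<close>

definition spectral_measure :: "real mat \<Rightarrow> real measure" where
  "spectral_measure X = distr (measure_pmf (pmf_of_multiset (proots (char_poly X)))) borel (\<lambda>y. y)"

definition is_LSD :: "'w measure \<Rightarrow> (nat \<Rightarrow> 'w \<Rightarrow> real mat) \<Rightarrow> real measure \<Rightarrow> bool" where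
  "is_LSD M X \<nu> \<longleftrightarrow> real_distribution \<nu> \<and>
     (AE \<omega> in M. weak_conv_m (\<lambda>n. spectral_measure (X n \<omega>)) \<nu>)"

abbreviation scaled_patterned_matrix ::
    "(nat \<Rightarrow> nat \<times> nat \<Rightarrow> 't) \<Rightarrow> ('t \<Rightarrow> 'w \<Rightarrow> real) \<Rightarrow> nat \<Rightarrow> 'w \<Rightarrow> real mat" where
  "scaled_patterned_matrix L x n \<omega> \<equiv> (1 / sqrt (real n)) \<cdot>\<^sub>m patterned_matrix L x n \<omega>"

abbreviation complex_mat :: "real mat \<Rightarrow> complex mat" where
  "complex_mat \<equiv> map_mat complex_of_real"

end

theory Submission
  imports Defs "HOL-Library.Poly_Mapping" "Jordan_Normal_Form.Schur_Decomposition"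
begin

text \<open>
  Gaussian integration by parts gives the loop equation for words in \<open>W\<close> and \<open>A\<close>: with
  \<open>\<tau> = Tr / n\<close>, \<open>E \<tau>(W y) \<Prod> \<tau>(w\<^sub>i)\<close> is the sum of \<open>E \<tau>(u) \<tau>(v) \<Prod> \<tau>(w\<^sub>i)\<close> over all factorizations
  \<open>y = u W v\<close>, up to \<open>n\<^sup>-\<^sup>2\<close> times a fixed finite sum of similar expectations. Induction on the number
  of letters \<open>W\<close> reduces the convergence (and asymptotic factorization) of all mixed moments to words
  in \<open>A\<close> alone. For these, Property B bounds all moments of \<open>\<tau>(A\<^sup>k)\<close>, and since the limiting
  spectral distribution is non-random, \<open>\<tau>(A\<^sup>k)\<close> converges to a constant in every \<open>L\<^sup>p\<close>.
  In the limit \<open>\<phi>(s y) = (\<phi> \<otimes> \<phi>)(\<partial> y)\<close> for the free difference quotient \<open>\<partial>\<close>; together with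
  traciality this forces freeness, as one sees by expanding polynomials in \<open>s\<close> in Chebyshev
  polynomials of the second kind.
\<close>


hide_const (open) UnivPoly.coeff UnivPoly.monom Module.smult

section \<open>Random variables with finite moments\<close>

text \<open>Joint Gaussianity is given only through the laws of real linear combinations.
  Integration by parts is therefore not done with a density on matrix space: the moment recursion of
  a single Gaussian variable, compared at the coefficient of \<open>t\<close> along
  \<open>X + t Y\<close>, becomes Wick's formula. The loop equation splits one trace into two, so
  only products of traces form a closed system, and the traces of pure powers of A must converge in
  a sense stable under products. Weak convergence of spectra controls bounded continuous test
  functions only, and eigenvalues come without any measurability. The damped powers
  \<open>y^k exp(-y^2/(r+1))\<close> meet both obstacles: they are bounded and continuous, and they
  are entire, so their spectral averages are series in traces of powers. Chebyshev polynomials are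
  the basis in which \<open>\<partial>\<close> sends an element to a sum of tensors of basis
  elements of smaller index. The loop equation therefore leads from an alternating product to
  alternating products of smaller degree in s, up to one term that the three-term recursion
  cancels.\<close>

definition finite_moments :: "'w measure \<Rightarrow> ('w \<Rightarrow> complex) \<Rightarrow> bool" where
  "finite_moments M f \<longleftrightarrow>
     f \<in> borel_measurable M \<and> (\<forall>m. integrable M (\<lambda>\<omega>. norm (f \<omega>) ^ m))"

lemma finite_moments_measurable: "finite_moments M f \<Longrightarrow> f \<in> borel_measurable M"
  by (simp add: finite_moments_def)

lemma finite_moments_integrable_norm:
  "finite_moments M f \<Longrightarrow> integrable M (\<lambda>\<omega>. norm (f \<omega>) ^ m)"
  by (simp add: finite_moments_def)

lemma finite_moments_integrable: "finite_moments M f \<Longrightarrow> integrable M f"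
  using finite_moments_integrable_norm[of M f 1]
  by (simp add: finite_moments_measurable integrable_norm_iff)

text \<open>The AM-GM inequality in place of Hoelder's: the exponent doubles, which costs nothing
  where all moments are finite.\<close>

lemma norm_mult_power_le:
  fixes a b :: "'a :: real_normed_algebra_1"
  shows "norm (a * b) ^ m \<le> norm a ^ (2 * m) + norm b ^ (2 * m)"
proof -
  have "norm (a * b) ^ m \<le> norm a ^ m * norm b ^ m"
    by (metis norm_mult_ineq norm_ge_zero power_mono power_mult_distrib)
  also have "\<dots> \<le> (norm a ^ m)\<^sup>2 + (norm b ^ m)\<^sup>2"
  proof -
    have "0 \<le> norm a ^ m * norm b ^ m" by simp
    then show ?thesis
      using sum_squares_bound[of "norm a ^ m" "norm b ^ m"] by linarith
  qed
  finally show ?thesis by (simp add: power_mult[symmetric] mult.commute)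
qed

lemma norm_add_power_le:
  fixes a b :: "'a :: real_normed_vector"
  shows "norm (a + b) ^ m \<le> 2 ^ m * (norm a ^ m + norm b ^ m)"
proof -
  have "norm (a + b) \<le> 2 * max (norm a) (norm b)"
    using norm_triangle_ineq[of a b] by linarith
  then have "norm (a + b) ^ m \<le> 2 ^ m * max (norm a) (norm b) ^ m"
    by (metis norm_ge_zero power_mono power_mult_distrib)
  also have "max (norm a) (norm b) ^ m \<le> norm a ^ m + norm b ^ m"
    by (cases "norm a \<le> norm b") (auto simp: max_def)
  finally show ?thesis by simp
qed

lemma finite_moments_cong:
  assumes "\<And>\<omega>. \<omega> \<in> space M \<Longrightarrow> f \<omega> = g \<omega>"
  shows "finite_moments M f \<longleftrightarrow> finite_moments M g"
proof -
  have "f \<in> borel_measurable M \<longleftrightarrow> g \<in> borel_measurable M"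
    by (rule measurable_cong) (rule assms)
  moreover have "integrable M (\<lambda>\<omega>. norm (f \<omega>) ^ m) \<longleftrightarrow> integrable M (\<lambda>\<omega>. norm (g \<omega>) ^ m)" for m
    by (rule Bochner_Integration.integrable_cong) (simp_all add: assms)
  ultimately show ?thesis by (simp add: finite_moments_def)
qed

context prob_space
begin


lemma finite_moments_const [simp]: "finite_moments M (\<lambda>_. c)"
  by (simp add: finite_moments_def)

lemma finite_moments_mult:
  assumes "finite_moments M f" "finite_moments M g"
  shows "finite_moments M (\<lambda>\<omega>. f \<omega> * g \<omega>)"
  unfolding finite_moments_def
proof (intro conjI allI)
  note [measurable] = assms[THEN finite_moments_measurable]
  show "(\<lambda>\<omega>. f \<omega> * g \<omega>) \<in> borel_measurable M" by measurable
  fix m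
  show "integrable M (\<lambda>\<omega>. norm (f \<omega> * g \<omega>) ^ m)"
    by (rule Bochner_Integration.integrable_bound
        [where f = "\<lambda>\<omega>. norm (f \<omega>) ^ (2 * m) + norm (g \<omega>) ^ (2 * m)"])
      (use assms norm_mult_power_le in \<open>auto intro: finite_moments_integrable_norm\<close>)
qed

lemma finite_moments_add:
  assumes "finite_moments M f" "finite_moments M g"
  shows "finite_moments M (\<lambda>\<omega>. f \<omega> + g \<omega>)"
  unfolding finite_moments_def
proof (intro conjI allI)
  note [measurable] = assms[THEN finite_moments_measurable]
  show "(\<lambda>\<omega>. f \<omega> + g \<omega>) \<in> borel_measurable M" by measurable
  fix m
  show "integrable M (\<lambda>\<omega>. norm (f \<omega> + g \<omega>) ^ m)"
    by (rule Bochner_Integration.integrable_bound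
        [where f = "\<lambda>\<omega>. 2 ^ m * (norm (f \<omega>) ^ m + norm (g \<omega>) ^ m)"])
      (use assms norm_add_power_le in \<open>auto intro: finite_moments_integrable_norm\<close>)
qed

lemma finite_moments_power:
  "finite_moments M f \<Longrightarrow> finite_moments M (\<lambda>\<omega>. f \<omega> ^ m)"
  by (induction m) (auto intro: finite_moments_mult)

lemma finite_moments_sum:
  "(\<And>i. i \<in> I \<Longrightarrow> finite_moments M (f i)) \<Longrightarrow> finite_moments M (\<lambda>\<omega>. \<Sum>i\<in>I. f i \<omega>)"
  by (induction I rule: infinite_finite_induct) (auto intro: finite_moments_add)

lemma finite_moments_prod_list:
  "(\<And>x. x \<in> set xs \<Longrightarrow> finite_moments M (f x)) \<Longrightarrow> finite_moments M (\<lambda>\<omega>. \<Prod>x\<leftarrow>xs. f x \<omega>)"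
  by (induction xs) (auto intro: finite_moments_mult)

lemma finite_moments_sum_list:
  "(\<And>x. x \<in> set xs \<Longrightarrow> finite_moments M (f x)) \<Longrightarrow> finite_moments M (\<lambda>\<omega>. \<Sum>x\<leftarrow>xs. f x \<omega>)"
  by (induction xs) (auto intro: finite_moments_add)

lemma finite_moments_of_real:
  assumes "f \<in> borel_measurable M" "\<And>m. integrable M (\<lambda>\<omega>. \<bar>f \<omega>\<bar> ^ m)"
  shows "finite_moments M (\<lambda>\<omega>. complex_of_real (f \<omega>))"
  using assms by (simp add: finite_moments_def)

lemmas finite_moments_intros =
  finite_moments_const finite_moments_mult finite_moments_add finite_moments_power
  finite_moments_sum

end


section \<open>Wick's formula by polarization\<close>

text \<open>One entry per position, so equal elements are picked separately: these are the possible
  partners of a distinguished factor in Wick's formula.\<close>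

fun picks :: "'a list \<Rightarrow> ('a \<times> 'a list) list" where
  "picks [] = []"
| "picks (y # ys) = (y, ys) # map (\<lambda>(z, zs). (z, y # zs)) (picks ys)"

lemma set_picksD: "(y, zs) \<in> set (picks ys) \<Longrightarrow> insert y (set zs) \<subseteq> set ys"
  by (induction ys arbitrary: y zs) fastforce+

lemma coeff_mult_one: "coeff (p * q) (Suc 0) = coeff p 0 * coeff q 1 + coeff p 1 * coeff q 0"
  by (simp add: coeff_mult)

lemma coeff_sum_list: "coeff (\<Sum>x\<leftarrow>xs. f x) n = (\<Sum>x\<leftarrow>xs. coeff (f x) n)"
  by (induction xs) auto

lemma poly_sum_list: "poly (\<Sum>x\<leftarrow>xs. f x) t = (\<Sum>x\<leftarrow>xs. poly (f x) t)"
  by (induction xs) auto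

text \<open>This is \<open>E ((X + t Y)^m G)\<close> as a polynomial in \<open>t\<close>. Having it
  by its coefficients replaces differentiation under the integral: an identity that holds for enough
  values of \<open>t\<close> may be compared at \<open>t^0\<close> and \<open>t^1\<close>.\<close>

definition pencil_poly ::
    "'w measure \<Rightarrow> ('w \<Rightarrow> complex) \<Rightarrow> ('w \<Rightarrow> complex) \<Rightarrow> nat \<Rightarrow> ('w \<Rightarrow> complex) \<Rightarrow> complex poly" where
  "pencil_poly M X Y m G =
     (\<Sum>k\<le>m. monom (of_nat (m choose k) * (LINT \<omega>|M. Y \<omega> ^ k * X \<omega> ^ (m - k) * G \<omega>)) k)"

lemma coeff_pencil_poly_0: "coeff (pencil_poly M X Y m G) 0 = (LINT \<omega>|M. X \<omega> ^ m * G \<omega>)"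
  by (simp add: pencil_poly_def coeff_sum sum.delta)

lemma coeff_pencil_poly_1:
  "coeff (pencil_poly M X Y m G) (Suc 0) =
     of_nat m * (LINT \<omega>|M. X \<omega> ^ (m - 1) * (Y \<omega> * G \<omega>))"
proof -
  have "coeff (pencil_poly M X Y m G) (Suc 0) =
     (\<Sum>k\<le>m. if k = 1 then of_nat (m choose k) *
        (LINT \<omega>|M. Y \<omega> ^ k * X \<omega> ^ (m - k) * G \<omega>) else 0)"
    unfolding pencil_poly_def coeff_sum by (intro sum.cong) auto
  then show ?thesis by (cases m) (auto simp: sum.delta' mult_ac)
qed

lemma (in prob_space) poly_pencil_poly:
  assumes "finite_moments M X" "finite_moments M Y" "finite_moments M G"
  shows "poly (pencil_poly M X Y m G) t = (LINT \<omega>|M. (X \<omega> + t * Y \<omega>) ^ m * G \<omega>)"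
proof -
  have "(LINT \<omega>|M. (X \<omega> + t * Y \<omega>) ^ m * G \<omega>) =
     (LINT \<omega>|M. (\<Sum>k\<le>m. of_nat (m choose k) * t ^ k * (Y \<omega> ^ k * X \<omega> ^ (m - k) * G \<omega>)))"
    by (simp add: add.commute[of "X _"] binomial_ring power_mult_distrib sum_distrib_right
        mult.assoc mult.left_commute)
  also have "\<dots> = (\<Sum>k\<le>m. (LINT \<omega>|M. of_nat (m choose k) * t ^ k * (Y \<omega> ^ k * X \<omega> ^ (m - k) * G \<omega>)))"
    by (intro Bochner_Integration.integral_sum finite_moments_integrable finite_moments_intros assms)
  also have "\<dots> = (\<Sum>k\<le>m. of_nat (m choose k) * t ^ k * (LINT \<omega>|M. Y \<omega> ^ k * X \<omega> ^ (m - k) * G \<omega>))"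
    by simp
  finally show ?thesis
    by (simp add: pencil_poly_def poly_sum poly_monom mult_ac)
qed

text \<open>The recursion is the moment form of a centered Gaussian law. It uses \<open>X^2\<close>
  rather than \<open>|X|^2\<close> and so makes sense for complex linear combinations as well; for
  \<open>m = 0\<close> it says that the mean vanishes, whatever \<open>m - 1\<close> is.\<close>

locale gaussian_space = prob_space +
  fixes V :: "('a \<Rightarrow> complex) set"
  assumes moments: "X \<in> V \<Longrightarrow> finite_moments M X"
    and pencil: "X \<in> V \<Longrightarrow> Y \<in> V \<Longrightarrow> (\<lambda>\<omega>. X \<omega> + t * Y \<omega>) \<in> V"
    and moment_recursion: "X \<in> V \<Longrightarrow> (LINT \<omega>|M. X \<omega> ^ Suc m) =
          of_nat m * (LINT \<omega>|M. X \<omega> ^ 2) * (LINT \<omega>|M. X \<omega> ^ (m - 1))"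
begin


text \<open>The recursion holds along \<open>X + t Z\<close> for every \<open>t\<close>; its
  coefficient of \<open>t\<close> expresses \<open>E (X^m Z)\<close> through
  \<open>E (X^(m - 2) Z)\<close>, which the induction hypothesis supplies.\<close>

lemma moment_polarized:
  assumes "X \<in> V" "Z \<in> V"
  shows "(LINT \<omega>|M. X \<omega> ^ m * Z \<omega>) =
    of_nat m * (LINT \<omega>|M. X \<omega> * Z \<omega>) * (LINT \<omega>|M. X \<omega> ^ (m - 1))"
  using assms
proof (induction m rule: less_induct)
  case (less m)
  let ?p = "\<lambda>m. pencil_poly M X Z m (\<lambda>_. 1)"
  have "poly (?p (Suc m)) t = poly (smult (of_nat m) (?p 2 * ?p (m - 1))) t" for t
    using moment_recursion[OF pencil[OF less.prems, of t], of m] less.prems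
    by (simp add: poly_pencil_poly moments del: power_Suc)
  then have "?p (Suc m) = smult (of_nat m) (?p 2 * ?p (m - 1))"
    by (intro poly_eq_poly_eq_iff[THEN iffD1] ext)
  from arg_cong[OF this, of "\<lambda>p. coeff p 1"]
  have *: "of_nat (Suc m) * (LINT \<omega>|M. X \<omega> ^ m * Z \<omega>) =
     of_nat m * ((LINT \<omega>|M. X \<omega> ^ 2) * (of_nat (m - 1) * (LINT \<omega>|M. X \<omega> ^ (m - 1 - 1) * Z \<omega>))
        + 2 * (LINT \<omega>|M. X \<omega> * Z \<omega>) * (LINT \<omega>|M. X \<omega> ^ (m - 1)))"
    by (simp add: coeff_mult_one coeff_pencil_poly_0 coeff_pencil_poly_1
        del: of_nat_Suc of_nat_diff)
  show ?case
  proof (cases "m < 2")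
    case True
    then consider "m = 0" | "m = 1" by linarith
    then show ?thesis using * by cases (auto simp: prob_space)
  next
    case False
    then obtain k where m: "m = Suc (Suc k)"
      by (metis add_2_eq_Suc le_add_diff_inverse not_less)
    \<comment> \<open>With \<open>k = m - 2\<close>, the hypothesis followed by the recursion
      backwards yields \<open>m - 1\<close> copies of \<open>E (X Z) E (X^(m - 1))\<close>; with the
      two from the other summand there are \<open>m + 1\<close>, which cancels the factor on the
      left.\<close>
    have "(LINT \<omega>|M. X \<omega> ^ 2) * (of_nat (m - 1) * (LINT \<omega>|M. X \<omega> ^ (m - 1 - 1) * Z \<omega>)) =
        (LINT \<omega>|M. X \<omega> * Z \<omega>) * of_nat k * (of_nat (Suc k) * (LINT \<omega>|M. X \<omega> ^ 2) *
          (LINT \<omega>|M. X \<omega> ^ (k - 1)))"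
      using less.IH[of k] less.prems by (simp add: m)
    also have "\<dots> = (LINT \<omega>|M. X \<omega> * Z \<omega>) * of_nat (Suc k) * (LINT \<omega>|M. X \<omega> ^ Suc k)"
      using moment_recursion[OF less.prems(1), of k] by (simp add: mult_ac)
    finally have "of_nat (Suc m) * (LINT \<omega>|M. X \<omega> ^ m * Z \<omega>) =
      of_nat (Suc m) * (of_nat m * (LINT \<omega>|M. X \<omega> * Z \<omega>) * (LINT \<omega>|M. X \<omega> ^ (m - 1)))"
      unfolding * by (simp add: m algebra_simps)
    then show ?thesis
      unfolding mult_cancel_left of_nat_eq_0_iff by simp
  qed
qed

text \<open>The power \<open>X^m\<close> is carried along for the induction: a new factor
  \<open>Y\<close> is created by applying the hypothesis to \<open>X + t Y\<close> with exponent
  \<open>m + 1\<close> and reading off the coefficient of \<open>t\<close>. For \<open>m = 0\<close>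
  the formula is Wick's.\<close>

lemma wick_power:
  assumes "Z \<in> V" "X \<in> V" "set ys \<subseteq> V"
  shows "(LINT \<omega>|M. X \<omega> ^ m * (Z \<omega> * (\<Prod>y\<leftarrow>ys. y \<omega>))) =
     of_nat m * (LINT \<omega>|M. X \<omega> * Z \<omega>) * (LINT \<omega>|M. X \<omega> ^ (m - 1) * (\<Prod>y\<leftarrow>ys. y \<omega>)) +
     (\<Sum>(y, zs)\<leftarrow>picks ys. (LINT \<omega>|M. Z \<omega> * y \<omega>) * (LINT \<omega>|M. X \<omega> ^ m * (\<Prod>z\<leftarrow>zs. z \<omega>)))"
  using assms(2,3)
proof (induction ys arbitrary: X m)
  case Nil
  then show ?case using moment_polarized[OF _ assms(1), of X m] by simp
next
  case (Cons Y ys)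
  note fm = moments finite_moments_prod_list finite_moments_intros
  let ?P = "\<lambda>ys \<omega>. \<Prod>y\<leftarrow>ys. y \<omega>"
  let ?p = "\<lambda>m. pencil_poly M X Y m"
  let ?lhs = "?p (Suc m) (\<lambda>\<omega>. Z \<omega> * ?P ys \<omega>)"
  let ?rhs = "smult (of_nat (Suc m)) (?p 1 Z * ?p m (?P ys)) +
    (\<Sum>(y, zs)\<leftarrow>picks ys. smult (LINT \<omega>|M. Z \<omega> * y \<omega>) (?p (Suc m) (?P zs)))"
  have fms: "finite_moments M (?P zs)" if "(y, zs) \<in> set (picks (Y # ys))" for y zs
    using set_picksD[OF that] Cons.prems by (intro fm) auto
  have "poly ?lhs t = poly ?rhs t" for t
  proof -
    have "poly ?lhs t = (LINT \<omega>|M. (X \<omega> + t * Y \<omega>) ^ Suc m * (Z \<omega> * ?P ys \<omega>))"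
      using Cons.prems assms(1) by (intro poly_pencil_poly fm) auto
    also have "\<dots> = of_nat (Suc m) * (LINT \<omega>|M. (X \<omega> + t * Y \<omega>) * Z \<omega>) *
        (LINT \<omega>|M. (X \<omega> + t * Y \<omega>) ^ m * ?P ys \<omega>) +
      (\<Sum>(y, zs)\<leftarrow>picks ys. (LINT \<omega>|M. Z \<omega> * y \<omega>) *
        (LINT \<omega>|M. (X \<omega> + t * Y \<omega>) ^ Suc m * ?P zs \<omega>))"
      using Cons.IH[of "\<lambda>\<omega>. X \<omega> + t * Y \<omega>" "Suc m"] Cons.prems by (simp add: pencil)
    also have "\<dots> = poly ?rhs t"
    proof -
      have a: "poly (?p 1 Z) t = (LINT \<omega>|M. (X \<omega> + t * Y \<omega>) * Z \<omega>)"
        using Cons.prems assms(1) by (subst poly_pencil_poly) (auto intro: fm)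
      have b: "poly (?p m (?P ys)) t = (LINT \<omega>|M. (X \<omega> + t * Y \<omega>) ^ m * ?P ys \<omega>)"
        using Cons.prems by (intro poly_pencil_poly fm) auto
      have c: "poly (\<Sum>(y, zs)\<leftarrow>picks ys. smult (LINT \<omega>|M. Z \<omega> * y \<omega>) (?p (Suc m) (?P zs))) t =
        (\<Sum>(y, zs)\<leftarrow>picks ys. (LINT \<omega>|M. Z \<omega> * y \<omega>) *
        (LINT \<omega>|M. (X \<omega> + t * Y \<omega>) ^ Suc m * ?P zs \<omega>))"
        unfolding poly_sum_list
      proof (rule arg_cong[where f = sum_list], rule map_cong[OF refl], clarify)
        fix y zs assume "(y, zs) \<in> set (picks ys)"
        then have "set zs \<subseteq> V" using set_picksD Cons.prems by fastforce
        then have "finite_moments M (?P zs)" by (intro fm) auto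
        then show "poly (smult (LINT \<omega>|M. Z \<omega> * y \<omega>) (?p (Suc m) (?P zs))) t =
          (LINT \<omega>|M. Z \<omega> * y \<omega>) * (LINT \<omega>|M. (X \<omega> + t * Y \<omega>) ^ Suc m * ?P zs \<omega>)"
          using Cons.prems by (simp add: poly_pencil_poly moments del: power_Suc)
      qed
      show ?thesis
        by (simp only: poly_add poly_smult poly_mult a b c mult.assoc)
    qed
    finally show ?thesis .
  qed
  then have "?lhs = ?rhs" by (intro poly_eq_poly_eq_iff[THEN iffD1] ext)
  from arg_cong[OF this, of "\<lambda>p. coeff p 1"]
  have *: "of_nat (Suc m) * (LINT \<omega>|M. X \<omega> ^ m * (Y \<omega> * (Z \<omega> * ?P ys \<omega>))) =
    of_nat (Suc m) * ((LINT \<omega>|M. X \<omega> * Z \<omega>) * (of_nat m * (LINT \<omega>|M. X \<omega> ^ (m - 1) * (Y \<omega> * ?P ys \<omega>)))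
      + (LINT \<omega>|M. Y \<omega> * Z \<omega>) * (LINT \<omega>|M. X \<omega> ^ m * ?P ys \<omega>)) +
    (\<Sum>(y, zs)\<leftarrow>picks ys. (LINT \<omega>|M. Z \<omega> * y \<omega>) *
        (of_nat (Suc m) * (LINT \<omega>|M. X \<omega> ^ m * (Y \<omega> * ?P zs \<omega>))))"
    by (simp add: coeff_mult_one coeff_pencil_poly_0 coeff_pencil_poly_1 coeff_sum_list split_def
        del: of_nat_Suc)
  also have "(\<Sum>(y, zs)\<leftarrow>picks ys. (LINT \<omega>|M. Z \<omega> * y \<omega>) *
        (of_nat (Suc m) * (LINT \<omega>|M. X \<omega> ^ m * (Y \<omega> * ?P zs \<omega>)))) =
    of_nat (Suc m) * (\<Sum>(y, zs)\<leftarrow>picks ys. (LINT \<omega>|M. Z \<omega> * y \<omega>) *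
        (LINT \<omega>|M. X \<omega> ^ m * (Y \<omega> * ?P zs \<omega>)))"
    unfolding split_def sum_list_const_mult[symmetric] by (simp only: mult.left_commute)
  finally have "(LINT \<omega>|M. X \<omega> ^ m * (Y \<omega> * (Z \<omega> * ?P ys \<omega>))) =
      ((LINT \<omega>|M. X \<omega> * Z \<omega>) * (of_nat m * (LINT \<omega>|M. X \<omega> ^ (m - 1) * (Y \<omega> * ?P ys \<omega>)))
      + (LINT \<omega>|M. Y \<omega> * Z \<omega>) * (LINT \<omega>|M. X \<omega> ^ m * ?P ys \<omega>)) +
    (\<Sum>(y, zs)\<leftarrow>picks ys. (LINT \<omega>|M. Z \<omega> * y \<omega>) *
        (LINT \<omega>|M. X \<omega> ^ m * (Y \<omega> * ?P zs \<omega>)))"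
    unfolding distrib_left[symmetric] mult_cancel_left of_nat_eq_0_iff by simp
  then show ?case
    by (simp add: split_def o_def mult.assoc mult.left_commute mult.commute[of "Y _" "Z _"])
qed

lemma wick:
  assumes "Z \<in> V" "set ys \<subseteq> V"
  shows "(LINT \<omega>|M. Z \<omega> * (\<Prod>y\<leftarrow>ys. y \<omega>)) =
     (\<Sum>(y, zs)\<leftarrow>picks ys. (LINT \<omega>|M. Z \<omega> * y \<omega>) * (LINT \<omega>|M. (\<Prod>z\<leftarrow>zs. z \<omega>)))"
  using wick_power[OF assms(1) assms(1,2), of 0] by simp

end

section \<open>Gaussian integration by parts for the GUE\<close>

context prob_space
begin

text \<open>In the normal case both sides vanish for even \<open>m\<close>; for
  \<open>m = 2 k + 1\<close> the claim is the ratio \<open>(2 k + 1) \<sigma>^2\<close> of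
  consecutive even moments.\<close>

lemma centered_gaussian_moments:
  assumes "centered_gaussian M Y"
  shows "integrable M (\<lambda>\<omega>. \<bar>Y \<omega>\<bar> ^ m)"
    and "(LINT \<omega>|M. Y \<omega> ^ Suc m) =
      of_nat m * (LINT \<omega>|M. Y \<omega> ^ 2) * (LINT \<omega>|M. Y \<omega> ^ (m - 1))"
proof -
  have [measurable]: "Y \<in> borel_measurable M"
    using assms by (simp add: centered_gaussian_def)
  consider (zero) "AE \<omega> in M. Y \<omega> = 0"
    | (normal) \<sigma> where "\<sigma> > 0" "distributed M lborel Y (\<lambda>y. ennreal (normal_density 0 \<sigma> y))"
    using assms by (auto simp: centered_gaussian_def)
  then have "integrable M (\<lambda>\<omega>. \<bar>Y \<omega>\<bar> ^ m) \<and> (LINT \<omega>|M. Y \<omega> ^ Suc m) =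
      of_nat m * (LINT \<omega>|M. Y \<omega> ^ 2) * (LINT \<omega>|M. Y \<omega> ^ (m - 1))"
  proof cases
    case zero
    have "integrable M (\<lambda>\<omega>. \<bar>Y \<omega>\<bar> ^ m) \<longleftrightarrow> integrable M (\<lambda>\<omega>. (0::real) ^ m)"
      by (rule integrable_cong_AE) (use zero in auto)
    moreover have "(LINT \<omega>|M. Y \<omega> ^ Suc k) = 0" for k
      by (subst integral_cong_AE[where g = "\<lambda>_. 0"]) (use zero in auto)
    from this[of m] this[of 1] have "(LINT \<omega>|M. Y \<omega> ^ Suc m) = 0" "(LINT \<omega>|M. Y \<omega> ^ 2) = 0"
      by (simp_all add: numeral_2_eq_2)
    ultimately show ?thesis by simp
  next
    case normal
    have int: "(LINT \<omega>|M. Y \<omega> ^ k) = (LINT y|lborel. normal_density 0 \<sigma> y * y ^ k)" for k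
      using distributed_integral[OF normal(2), of "\<lambda>y. y ^ k"] normal(1) by simp
    have even: "(LINT \<omega>|M. Y \<omega> ^ (2 * k)) = fact (2 * k) / ((2 / \<sigma>\<^sup>2) ^ k * fact k)" for k
      using integral_normal_moment_even[OF normal(1), of 0 k] by (simp add: int)
    have odd: "(LINT \<omega>|M. Y \<omega> ^ (2 * k + 1)) = 0" for k
      using integral_normal_moment_odd[OF normal(1), of 0 k] int[of "2 * k + 1"] by simp
    have "integrable M (\<lambda>\<omega>. \<bar>Y \<omega>\<bar> ^ m)"
      using distributed_integrable[OF normal(2), of "\<lambda>y. \<bar>y\<bar> ^ m"]
        integrable_normal_moment_abs[OF normal(1), of 0 m] normal(1) by simp
    moreover have "(LINT \<omega>|M. Y \<omega> ^ Suc m) =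
      of_nat m * (LINT \<omega>|M. Y \<omega> ^ 2) * (LINT \<omega>|M. Y \<omega> ^ (m - 1))"
    proof (cases "even m")
      case True
      then obtain k where k: "m = 2 * k" by blast
      show ?thesis
      proof (cases k)
        case (Suc l)
        then have "m - 1 = 2 * l + 1" by (simp add: k)
        then show ?thesis using odd[of k] odd[of l] k by simp
      qed (use odd[of 0] k in simp)
    next
      case False
      then obtain k where k: "m = 2 * k + 1" by (blast elim: oddE)
      have "(LINT \<omega>|M. Y \<omega> ^ 2) = \<sigma>\<^sup>2"
        using even[of 1] by simp
      moreover have "(LINT \<omega>|M. Y \<omega> ^ Suc m) = fact (2 * Suc k) / ((2 / \<sigma>\<^sup>2) ^ Suc k * fact (Suc k))"
        using even[of "Suc k"] by (simp add: k)
      moreover have "\<dots> = of_nat m * \<sigma>\<^sup>2 * (fact (2 * k) / ((2 / \<sigma>\<^sup>2) ^ k * fact k))"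
      proof -
        define A where "A = (2 / \<sigma>\<^sup>2) ^ k * fact k"
        have "A \<noteq> 0" "real k + 1 \<noteq> 0" using normal(1) by (simp_all add: A_def)
        moreover have "fact (2 * Suc k) = 2 * (real k + 1) * (2 * real k + 1) * fact (2 * k)"
          by (simp add: algebra_simps)
        moreover have "(2 / \<sigma>\<^sup>2) ^ Suc k * fact (Suc k) = 2 / \<sigma>\<^sup>2 * (real k + 1) * A"
          by (simp add: A_def algebra_simps)
        moreover have "2 * (r + 1) * (2 * r + 1) * f / (2 / s * (r + 1) * A) =
            (2 * r + 1) * s * (f / A)" if "A \<noteq> 0" "r + 1 \<noteq> 0" for r s f A :: real
          using that by (simp add: divide_simps)
        ultimately have "fact (2 * Suc k) / ((2 / \<sigma>\<^sup>2) ^ Suc k * fact (Suc k)) =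
            (2 * real k + 1) * \<sigma>\<^sup>2 * (fact (2 * k) / A)"
          by presburger
        then show ?thesis by (simp only: k A_def of_nat_add of_nat_mult of_nat_numeral of_nat_1)
      qed
      ultimately show ?thesis using even[of k] by (simp add: k del: power_Suc fact_Suc)
    qed
    ultimately show ?thesis by blast
  qed
  then show "integrable M (\<lambda>\<omega>. \<bar>Y \<omega>\<bar> ^ m)" "(LINT \<omega>|M. Y \<omega> ^ Suc m) =
      of_nat m * (LINT \<omega>|M. Y \<omega> ^ 2) * (LINT \<omega>|M. Y \<omega> ^ (m - 1))" by auto
qed

end

section \<open>Linear forms in the entries of a GUE matrix\<close>

definition entry_form ::
    "nat \<Rightarrow> ('w \<Rightarrow> complex mat) \<Rightarrow> (nat \<times> nat \<Rightarrow> complex) \<Rightarrow> 'w \<Rightarrow> complex" where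
  "entry_form n W c \<omega> = (\<Sum>e\<in>{..<n} \<times> {..<n}. c e * W \<omega> $$ e)"

lemma entry_form_pencil:
  "entry_form n W (\<lambda>e. c e + t * d e) \<omega> = entry_form n W c \<omega> + t * entry_form n W d \<omega>"
  by (simp add: entry_form_def algebra_simps sum.distrib sum_distrib_left)

locale gue_matrix = prob_space M for M :: "'w measure" +
  fixes n :: nat and W :: "'w \<Rightarrow> complex mat"
  assumes gue: "GUE M n W"
begin

text \<open>Conjugation transposes the index pair in both the coefficient and the entry, hence only
  permutes the summands.\<close>

lemma entry_form_real:
  assumes h: "\<And>i j. h (i, j) = cnj (h (j, i))" and "\<omega> \<in> space M"
  shows "entry_form n W h \<omega> = of_real (Re (entry_form n W h \<omega>))"
proof -
  have W: "W \<omega> $$ (i, j) = cnj (W \<omega> $$ (j, i))" if "i < n" "j < n" for i j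
    using gue assms(2) that unfolding GUE_def by blast
  have "cnj (entry_form n W h \<omega>) = (\<Sum>(i, j)\<in>{..<n} \<times> {..<n}. h (j, i) * W \<omega> $$ (j, i))"
    unfolding entry_form_def cnj_sum
    by (intro sum.cong refl) (auto simp: h[symmetric] W[symmetric])
  also have "\<dots> = entry_form n W h \<omega>"
    unfolding entry_form_def sum.cartesian_product[symmetric]
    by (subst sum.swap) (simp add: sum.cartesian_product)
  finally have "cnj (entry_form n W h \<omega>) = entry_form n W h \<omega>" .
  then have "Im (entry_form n W h \<omega>) = 0"
    by (simp add: complex_eq_iff)
  then show ?thesis by (simp add: complex_eq_iff)
qed

text \<open>For Hermitian coefficients the form is real and so equals its real part, to which the
  definition of joint Gaussianity applies.\<close>

lemma hermitian_entry_form: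
  assumes h: "\<And>i j. h (i, j) = cnj (h (j, i))"
  shows "finite_moments M (entry_form n W h)"
    and "(LINT \<omega>|M. entry_form n W h \<omega> ^ Suc m) = of_nat m *
       (LINT \<omega>|M. entry_form n W h \<omega> ^ 2) * (LINT \<omega>|M. entry_form n W h \<omega> ^ (m - 1))"
proof -
  define Y where "Y = (\<lambda>\<omega>. Re (entry_form n W h \<omega>))"
  have Y: "centered_gaussian M Y"
    using gue unfolding Y_def entry_form_def GUE_def jointly_centered_complex_gaussian_def by auto
  then have [measurable]: "Y \<in> borel_measurable M"
    by (simp add: centered_gaussian_def)
  have eq: "entry_form n W h \<omega> = of_real (Y \<omega>)" if "\<omega> \<in> space M" for \<omega>
    using entry_form_real[of h \<omega>, OF h that] by (simp add: Y_def)
  have "finite_moments M (\<lambda>\<omega>. of_real (Y \<omega>))"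
    using centered_gaussian_moments(1)[OF Y] by (intro finite_moments_of_real) auto
  then show "finite_moments M (entry_form n W h)"
    using finite_moments_cong[of M "entry_form n W h", OF eq] by simp
  have "(LINT \<omega>|M. entry_form n W h \<omega> ^ k) = of_real (LINT \<omega>|M. Y \<omega> ^ k)" for k
  proof -
    have "(LINT \<omega>|M. entry_form n W h \<omega> ^ k) = (LINT \<omega>|M. of_real (Y \<omega> ^ k))"
      by (rule Bochner_Integration.integral_cong) (simp_all add: eq)
    then show ?thesis by (simp only: integral_complex_of_real)
  qed
  then show "(LINT \<omega>|M. entry_form n W h \<omega> ^ Suc m) = of_nat m *
       (LINT \<omega>|M. entry_form n W h \<omega> ^ 2) * (LINT \<omega>|M. entry_form n W h \<omega> ^ (m - 1))"
    using centered_gaussian_moments(2)[OF Y, of m] by (simp only: of_real_mult of_real_of_nat_eq)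
qed

text \<open>
  Every coefficient family is \<open>h + \<i> k\<close> with \<open>h\<close>, \<open>k\<close> Hermitian; the moment recursion is a
  polynomial identity in \<open>t\<close> along \<open>h + t k\<close>, valid for real \<open>t\<close>, hence also at \<open>t = \<i>\<close>.
\<close>

lemma hermitian_parts:
  fixes c :: "nat \<times> nat \<Rightarrow> complex"
  obtains h k where "\<And>i j. h (i, j) = cnj (h (j, i))" "\<And>i j. k (i, j) = cnj (k (j, i))"
    "c = (\<lambda>e. h e + \<i> * k e)"
proof
  show "(\<lambda>(i, j). (c (i, j) + cnj (c (j, i))) / 2) (i, j) =
    cnj ((\<lambda>(i, j). (c (i, j) + cnj (c (j, i))) / 2) (j, i))" for i j
    by (simp add: complex_eq_iff field_simps)
  show "(\<lambda>(i, j). - (\<i> / 2) * (c (i, j) - cnj (c (j, i)))) (i, j) =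
    cnj ((\<lambda>(i, j). - (\<i> / 2) * (c (i, j) - cnj (c (j, i)))) (j, i))" for i j
    by (simp add: complex_eq_iff field_simps)
  show "c = (\<lambda>e. (\<lambda>(i, j). (c (i, j) + cnj (c (j, i))) / 2) e +
    \<i> * (\<lambda>(i, j). - (\<i> / 2) * (c (i, j) - cnj (c (j, i)))) e)"
    by (rule ext) (simp add: complex_eq_iff field_simps split: prod.split)
qed

sublocale gaussian_space M "range (entry_form n W)"
proof unfold_locales
  fix X assume "X \<in> range (entry_form n W)"
  then obtain c where X: "X = entry_form n W c" by blast
  obtain h k where h: "\<And>i j. h (i, j) = cnj (h (j, i))" and k: "\<And>i j. k (i, j) = cnj (k (j, i))"
    and c: "c = (\<lambda>e. h e + \<i> * k e)"
    by (rule hermitian_parts[of c]) blast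
  let ?H = "entry_form n W h" and ?K = "entry_form n W k"
  note fm = hermitian_entry_form(1)[of h, OF h] hermitian_entry_form(1)[of k, OF k]
  have Xeq: "X = (\<lambda>\<omega>. ?H \<omega> + \<i> * ?K \<omega>)"
    by (simp add: X c fun_eq_iff entry_form_pencil)
  show "finite_moments M X"
    unfolding Xeq by (intro finite_moments_intros fm)
  fix m
  let ?p = "\<lambda>m. pencil_poly M ?H ?K m (\<lambda>_. 1)"
  let ?q = "?p (Suc m) - smult (of_nat m) (?p 2 * ?p (m - 1))"
  have p: "poly (?p m) t = (LINT \<omega>|M. (?H \<omega> + t * ?K \<omega>) ^ m)" for m t
    using fm by (simp add: poly_pencil_poly)
  have "poly ?q (of_real t) = 0" for t
  proof -
    have "h (i, j) + of_real t * k (i, j) = cnj (h (j, i) + of_real t * k (j, i))" for i j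
      by (simp add: h[symmetric] k[symmetric])
    from hermitian_entry_form(2)[where h = "\<lambda>e. h e + of_real t * k e", OF this, of m]
    show ?thesis by (simp add: p entry_form_pencil del: power_Suc)
  qed
  then have "range complex_of_real \<subseteq> {t. poly ?q t = 0}" by auto
  moreover have "infinite (range complex_of_real)"
    by (simp add: finite_image_iff inj_of_real infinite_UNIV_char_0)
  ultimately have "infinite {t. poly ?q t = 0}"
    using finite_subset by blast
  then have "?q = 0" using poly_roots_finite by blast
  then have "poly ?q \<i> = 0" by simp
  then show "(LINT \<omega>|M. X \<omega> ^ Suc m) =
          of_nat m * (LINT \<omega>|M. X \<omega> ^ 2) * (LINT \<omega>|M. X \<omega> ^ (m - 1))"
    by (simp add: p Xeq del: power_Suc)
next
  fix X Y t assume "X \<in> range (entry_form n W)" "Y \<in> range (entry_form n W)"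
  then obtain c d where "X = entry_form n W c" "Y = entry_form n W d" by blast
  then have "(\<lambda>\<omega>. X \<omega> + t * Y \<omega>) = entry_form n W (\<lambda>e. c e + t * d e)"
    by (simp add: fun_eq_iff entry_form_pencil)
  then show "(\<lambda>\<omega>. X \<omega> + t * Y \<omega>) \<in> range (entry_form n W)" by blast
qed

lemma entry_in_space:
  assumes "e \<in> {..<n} \<times> {..<n}"
  shows "(\<lambda>\<omega>. W \<omega> $$ e) \<in> range (entry_form n W)"
proof -
  have "(\<lambda>\<omega>. W \<omega> $$ e) = entry_form n W (\<lambda>d. if d = e then 1 else 0)"
    using assms by (auto simp: entry_form_def fun_eq_iff if_distrib[of "\<lambda>x. x * _"] sum.delta cong: if_cong)
  then show ?thesis by blast
qed

lemma picks_map: "picks (map f xs) = map (\<lambda>(y, ys). (f y, map f ys)) (picks xs)"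
  by (induction xs) (auto simp: split_def)

lemma wick_entries:
  assumes "i < n" "j < n" "set ps \<subseteq> {..<n} \<times> {..<n}"
  shows "(LINT \<omega>|M. W \<omega> $$ (i, j) * (\<Prod>p\<leftarrow>ps. W \<omega> $$ p)) =
    1 / of_nat n * (\<Sum>(p, qs)\<leftarrow>picks ps. if p = (j, i) then (LINT \<omega>|M. (\<Prod>q\<leftarrow>qs. W \<omega> $$ q)) else 0)"
proof -
  have "(LINT \<omega>|M. W \<omega> $$ (i, j) * W \<omega> $$ (k, l)) =
      (1 / of_nat n) * (if i = l then 1 else 0) * (if j = k then 1 else 0)" if "k < n" "l < n" for k l
    using gue that assms(1,2) unfolding GUE_def by blast
  then have cov: "(LINT \<omega>|M. W \<omega> $$ (i, j) * W \<omega> $$ p) = (if p = (j, i) then 1 / of_nat n else 0)"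
    if "p \<in> {..<n} \<times> {..<n}" for p
    using that by (cases p) auto
  have "(LINT \<omega>|M. W \<omega> $$ (i, j) * (\<Prod>y\<leftarrow>map (\<lambda>p \<omega>. W \<omega> $$ p) ps. y \<omega>)) =
    (\<Sum>(y, zs)\<leftarrow>picks (map (\<lambda>p \<omega>. W \<omega> $$ p) ps). (LINT \<omega>|M. W \<omega> $$ (i, j) * y \<omega>) *
       (LINT \<omega>|M. (\<Prod>z\<leftarrow>zs. z \<omega>)))"
    by (rule wick) (use assms entry_in_space in auto)
  also have "\<dots> = (\<Sum>(p, qs)\<leftarrow>picks ps. 1 / of_nat n *
      (if p = (j, i) then (LINT \<omega>|M. (\<Prod>q\<leftarrow>qs. W \<omega> $$ q)) else 0))"
    unfolding picks_map map_map
  proof (rule arg_cong[where f = sum_list], rule map_cong[OF refl], clarify)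
    fix a b qs assume "((a, b), qs) \<in> set (picks ps)"
    then have "(a, b) \<in> {..<n} \<times> {..<n}" using set_picksD assms(3) by fastforce
    from cov[OF this]
    show "((\<lambda>(y, zs). (LINT \<omega>|M. W \<omega> $$ (i, j) * y \<omega>) * (LINT \<omega>|M. (\<Prod>z\<leftarrow>zs. z \<omega>))) \<circ>
          (\<lambda>(y, ys). (\<lambda>\<omega>. W \<omega> $$ y, map (\<lambda>p \<omega>. W \<omega> $$ p) ys))) ((a, b), qs) =
         1 / of_nat n * (if (a, b) = (j, i) then (LINT \<omega>|M. (\<Prod>q\<leftarrow>qs. W \<omega> $$ q)) else 0)"
      by (simp add: o_def)
  qed
  finally show ?thesis
    by (simp only: o_def split_def sum_list_const_mult map_map)
qed

end

section \<open>The loop equation\<close>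

text \<open>\<open>True\<close> encodes the letter W and \<open>False\<close> the letter A. The
  pairs are the terms of the free difference quotient: one for each occurrence of W, which is
  deleted.\<close>

fun splits :: "bool list \<Rightarrow> (bool list \<times> bool list) list" where
  "splits [] = []"
| "splits (b # w) = (if b then [([], w)] else []) @ map (\<lambda>(u, v). (b # u, v)) (splits w)"

text \<open>The outcome of contracting the W of \<open>W y\<close> with a W in another trace: there
  \<open>w = u W v\<close> is cut open cyclically into \<open>v u\<close> and spliced after
  \<open>y\<close>, so that the two traces become one.\<close>

fun reconnections :: "bool list \<Rightarrow> bool list list \<Rightarrow> bool list list list" where
  "reconnections y [] = []"
| "reconnections y (w # ws) =
     map (\<lambda>(u, v). (y @ v @ u) # ws) (splits w) @ map ((#) w) (reconnections y ws)"

lemma sum_sum_list_swap: "(\<Sum>i\<in>I. \<Sum>x\<leftarrow>xs. f i x) = (\<Sum>x\<leftarrow>xs. \<Sum>i\<in>I. f i x)"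
  by (induction xs) (auto simp: sum.distrib)

lemma (in prob_space) integral_sum_list:
  "(\<And>x. x \<in> set xs \<Longrightarrow> finite_moments M (f x)) \<Longrightarrow>
    (LINT \<omega>|M. (\<Sum>x\<leftarrow>xs. f x \<omega>)) = (\<Sum>x\<leftarrow>xs. (LINT \<omega>|M. f x \<omega>))"
proof (induction xs)
  case (Cons x xs)
  then have "integrable M (f x)" "integrable M (\<lambda>\<omega>. \<Sum>x\<leftarrow>xs. f x \<omega>)"
    by (auto intro!: finite_moments_integrable finite_moments_sum_list)
  then show ?case using Cons by (simp add: Bochner_Integration.integral_add)
qed simp

lemma (in prob_space) finite_moments_if:
  "finite_moments M F \<Longrightarrow> finite_moments M (\<lambda>\<omega>. if P then F \<omega> else 0)"
  by (cases P) auto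

lemma (in prob_space) integral_double_sum:
  assumes "\<And>i j. i < m \<Longrightarrow> j < n \<Longrightarrow> finite_moments M (f i j)"
  shows "(LINT \<omega>|M. (\<Sum>i<m. \<Sum>j<n. f i j \<omega>)) = (\<Sum>i<m. \<Sum>j<n. (LINT \<omega>|M. f i j \<omega>))"
proof -
  have "(LINT \<omega>|M. (\<Sum>i<m. \<Sum>j<n. f i j \<omega>)) = (\<Sum>i<m. (LINT \<omega>|M. (\<Sum>j<n. f i j \<omega>)))"
    by (intro Bochner_Integration.integral_sum finite_moments_integrable finite_moments_sum assms) auto
  also have "\<dots> = (\<Sum>i<m. \<Sum>j<n. (LINT \<omega>|M. f i j \<omega>))"
    by (intro sum.cong refl Bochner_Integration.integral_sum finite_moments_integrable assms) auto
  finally show ?thesis .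
qed

section \<open>Stein's identity for polynomials in the entries of W and A\<close>

locale gue_pair = gue_matrix M n W for M :: "'w measure" and n W +
  fixes A :: "'w \<Rightarrow> complex mat"
  assumes A_carrier: "\<omega> \<in> space M \<Longrightarrow> A \<omega> \<in> carrier_mat n n"
    and A_moments: "p \<in> {..<n} \<times> {..<n} \<Longrightarrow> finite_moments M (\<lambda>\<omega>. A \<omega> $$ p)"
    and factorization: "set ps \<subseteq> {..<n} \<times> {..<n} \<Longrightarrow> set qs \<subseteq> {..<n} \<times> {..<n} \<Longrightarrow>
      (LINT \<omega>|M. (\<Prod>p\<leftarrow>ps. W \<omega> $$ p) * (\<Prod>q\<leftarrow>qs. A \<omega> $$ q)) =
      (LINT \<omega>|M. (\<Prod>p\<leftarrow>ps. W \<omega> $$ p)) * (LINT \<omega>|M. (\<Prod>q\<leftarrow>qs. A \<omega> $$ q))"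
begin

lemma W_carrier: "\<omega> \<in> space M \<Longrightarrow> W \<omega> \<in> carrier_mat n n"
  using gue unfolding GUE_def by blast

lemma W_moments: "p \<in> {..<n} \<times> {..<n} \<Longrightarrow> finite_moments M (\<lambda>\<omega>. W \<omega> $$ p)"
  by (intro moments entry_in_space)

abbreviation "W_monomial ps \<omega> \<equiv> (\<Prod>p\<leftarrow>ps. W \<omega> $$ p)"
abbreviation "A_monomial qs \<omega> \<equiv> (\<Prod>q\<leftarrow>qs. A \<omega> $$ q)"

text \<open>\<open>polynomial_deriv e F F'\<close>: \<open>F\<close> is a polynomial in the entries of \<open>W\<close> and \<open>A\<close> whose
  formal partial derivative with respect to the entry \<open>e\<close> of \<open>W\<close> is \<open>F'\<close>.\<close>

inductive polynomial_deriv ::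
    "nat \<times> nat \<Rightarrow> ('w \<Rightarrow> complex) \<Rightarrow> ('w \<Rightarrow> complex) \<Rightarrow> bool" for e where
  const: "polynomial_deriv e (\<lambda>_. c) (\<lambda>_. 0)"
| mult_W: "p \<in> {..<n} \<times> {..<n} \<Longrightarrow> polynomial_deriv e F F' \<Longrightarrow>
    polynomial_deriv e (\<lambda>\<omega>. W \<omega> $$ p * F \<omega>)
      (\<lambda>\<omega>. (if p = e then F \<omega> else 0) + W \<omega> $$ p * F' \<omega>)"
| mult_A: "p \<in> {..<n} \<times> {..<n} \<Longrightarrow> polynomial_deriv e F F' \<Longrightarrow>
    polynomial_deriv e (\<lambda>\<omega>. A \<omega> $$ p * F \<omega>) (\<lambda>\<omega>. A \<omega> $$ p * F' \<omega>)"
| scale: "polynomial_deriv e F F' \<Longrightarrow> polynomial_deriv e (\<lambda>\<omega>. c * F \<omega>) (\<lambda>\<omega>. c * F' \<omega>)"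
| add: "polynomial_deriv e F F' \<Longrightarrow> polynomial_deriv e G G' \<Longrightarrow>
    polynomial_deriv e (\<lambda>\<omega>. F \<omega> + G \<omega>) (\<lambda>\<omega>. F' \<omega> + G' \<omega>)"

lemma polynomial_deriv_finite_moments:
  assumes "polynomial_deriv e F F'"
  shows "finite_moments M F" "finite_moments M F'"
  using assms by (induction) (auto intro!: finite_moments_intros finite_moments_if W_moments A_moments)

lemma polynomial_deriv_eqI:
  assumes "polynomial_deriv e F F'" "\<And>\<omega>. F \<omega> = G \<omega>" "\<And>\<omega>. F' \<omega> = G' \<omega>"
  shows "polynomial_deriv e G G'"
proof -
  have "F = G" "F' = G'" using assms(2,3) by auto
  then show ?thesis using assms(1) by simp
qed

lemma polynomial_deriv_mult:
  assumes "polynomial_deriv e F F'" "polynomial_deriv e G G'"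
  shows "polynomial_deriv e (\<lambda>\<omega>. F \<omega> * G \<omega>) (\<lambda>\<omega>. F' \<omega> * G \<omega> + F \<omega> * G' \<omega>)"
  using assms(1)
proof induction
  case (const c)
  show ?case by (rule polynomial_deriv_eqI[OF scale[OF assms(2), of c]]) auto
next
  case (mult_W p F F')
  show ?case
    by (rule polynomial_deriv_eqI[OF polynomial_deriv.mult_W[OF mult_W(1,3)]])
      (auto simp: algebra_simps)
next
  case (mult_A p F F')
  show ?case
    by (rule polynomial_deriv_eqI[OF polynomial_deriv.mult_A[OF mult_A(1,3)]])
      (auto simp: algebra_simps)
next
  case (scale F F' c)
  show ?case
    by (rule polynomial_deriv_eqI[OF polynomial_deriv.scale[OF scale(2), of c]])
      (auto simp: algebra_simps)
next
  case (add F F' H H')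
  show ?case
    by (rule polynomial_deriv_eqI[OF polynomial_deriv.add[OF add(3,4)]])
      (auto simp: algebra_simps)
qed

lemma polynomial_deriv_sum:
  assumes "\<And>i. i \<in> I \<Longrightarrow> polynomial_deriv e (F i) (F' i)"
  shows "polynomial_deriv e (\<lambda>\<omega>. \<Sum>i\<in>I. F i \<omega>) (\<lambda>\<omega>. \<Sum>i\<in>I. F' i \<omega>)"
  using assms
  by (induction I rule: infinite_finite_induct)
    (auto intro: polynomial_deriv.add polynomial_deriv.const)

text \<open>The monomial prefix makes the induction go through: a factor \<open>W \<omega> $$ p\<close> moves into it.\<close>

lemma stein_monomial:
  assumes "polynomial_deriv (j, i) F F'" "i < n" "j < n"
    and "set ps \<subseteq> {..<n} \<times> {..<n}" "set qs \<subseteq> {..<n} \<times> {..<n}"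
  shows "(LINT \<omega>|M. W \<omega> $$ (i, j) * (W_monomial ps \<omega> * (A_monomial qs \<omega> * F \<omega>))) =
    1 / of_nat n *
     ((\<Sum>(p, rs)\<leftarrow>picks ps. if p = (j, i)
         then (LINT \<omega>|M. W_monomial rs \<omega> * (A_monomial qs \<omega> * F \<omega>)) else 0) +
      (LINT \<omega>|M. W_monomial ps \<omega> * (A_monomial qs \<omega> * F' \<omega>)))"
  using assms(1,4,5)
proof (induction arbitrary: ps qs)
  \<comment> \<open>Without \<open>F\<close>, independence separates the monomial in A and Wick's
    formula handles the rest.\<close>
  case (const c)
  have fact1: "(LINT \<omega>|M. W_monomial ps \<omega> * (A_monomial qs \<omega> * c)) =
      c * ((LINT \<omega>|M. W_monomial ps \<omega>) * (LINT \<omega>|M. A_monomial qs \<omega>))"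
    if "set ps \<subseteq> {..<n} \<times> {..<n}" for ps
  proof -
    have "(LINT \<omega>|M. W_monomial ps \<omega> * (A_monomial qs \<omega> * c)) =
        (LINT \<omega>|M. c * (W_monomial ps \<omega> * A_monomial qs \<omega>))"
      by (simp only: mult_ac)
    then show ?thesis using factorization[OF that const(2)] by simp
  qed
  have "(LINT \<omega>|M. W \<omega> $$ (i, j) * (W_monomial ps \<omega> * (A_monomial qs \<omega> * c))) =
      c * ((LINT \<omega>|M. W \<omega> $$ (i, j) * W_monomial ps \<omega>) * (LINT \<omega>|M. A_monomial qs \<omega>))"
    using fact1[of "(i, j) # ps"] const assms(2,3) by (simp add: mult.assoc)
  also have "\<dots> = 1 / of_nat n * (\<Sum>(p, rs)\<leftarrow>picks ps. c * ((if p = (j, i)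
         then (LINT \<omega>|M. W_monomial rs \<omega>) else 0) * (LINT \<omega>|M. A_monomial qs \<omega>)))"
    using wick_entries[OF assms(2,3) const(1)]
    by (simp add: split_def sum_list_const_mult sum_list_mult_const)
  also have "(\<Sum>(p, rs)\<leftarrow>picks ps. c * ((if p = (j, i)
         then (LINT \<omega>|M. W_monomial rs \<omega>) else 0) * (LINT \<omega>|M. A_monomial qs \<omega>))) =
    (\<Sum>(p, rs)\<leftarrow>picks ps. if p = (j, i)
         then (LINT \<omega>|M. W_monomial rs \<omega> * (A_monomial qs \<omega> * c)) else 0)"
  proof (rule arg_cong[where f = sum_list], rule map_cong[OF refl], clarify)
    fix a b rs assume "((a, b), rs) \<in> set (picks ps)"
    then have "set rs \<subseteq> {..<n} \<times> {..<n}" using set_picksD const(1) by fastforce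
    from fact1[OF this]
    show "c * ((if (a, b) = (j, i)
         then (LINT \<omega>|M. W_monomial rs \<omega>) else 0) * (LINT \<omega>|M. A_monomial qs \<omega>)) =
       (if (a, b) = (j, i)
         then (LINT \<omega>|M. W_monomial rs \<omega> * (A_monomial qs \<omega> * c)) else 0)"
      by simp
  qed
  finally show ?case by simp
next
  case (mult_W p F F')
  note fm = finite_moments_integrable finite_moments_mult finite_moments_prod_list
    polynomial_deriv_finite_moments[OF mult_W(2)] W_moments A_moments
  have "(LINT \<omega>|M. W \<omega> $$ (i, j) * (W_monomial ps \<omega> * (A_monomial qs \<omega> * (W \<omega> $$ p * F \<omega>)))) =
    (LINT \<omega>|M. W \<omega> $$ (i, j) * (W_monomial (p # ps) \<omega> * (A_monomial qs \<omega> * F \<omega>)))"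
    by (simp add: mult_ac)
  also have "\<dots> = 1 / of_nat n *
     ((\<Sum>(p, rs)\<leftarrow>picks (p # ps). if p = (j, i)
         then (LINT \<omega>|M. W_monomial rs \<omega> * (A_monomial qs \<omega> * F \<omega>)) else 0) +
      (LINT \<omega>|M. W_monomial (p # ps) \<omega> * (A_monomial qs \<omega> * F' \<omega>)))"
    using mult_W by (intro mult_W.IH) auto
  \<comment> \<open>Picking the entry just moved into the prefix gives the term \<open>F\<close> of
    the product rule; every other pick keeps it, and it returns to its place in front of
    \<open>F\<close>.\<close>
  also have "(\<Sum>(p, rs)\<leftarrow>picks (p # ps). if p = (j, i)
         then (LINT \<omega>|M. W_monomial rs \<omega> * (A_monomial qs \<omega> * F \<omega>)) else 0) =
     (if p = (j, i) then (LINT \<omega>|M. W_monomial ps \<omega> * (A_monomial qs \<omega> * F \<omega>)) else 0) +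
     (\<Sum>(q, rs)\<leftarrow>picks ps. if q = (j, i)
         then (LINT \<omega>|M. W_monomial rs \<omega> * (A_monomial qs \<omega> * (W \<omega> $$ p * F \<omega>))) else 0)"
    by (simp add: split_def o_def mult_ac cong: if_cong)
  also have "(LINT \<omega>|M. W_monomial ps \<omega> * (A_monomial qs \<omega> *
        ((if p = (j, i) then F \<omega> else 0) + W \<omega> $$ p * F' \<omega>))) =
     (if p = (j, i) then (LINT \<omega>|M. W_monomial ps \<omega> * (A_monomial qs \<omega> * F \<omega>)) else 0) +
     (LINT \<omega>|M. W_monomial (p # ps) \<omega> * (A_monomial qs \<omega> * F' \<omega>))"
  proof -
    have "integrable M (\<lambda>\<omega>. W_monomial ps \<omega> * (A_monomial qs \<omega> * F \<omega>))"
      "integrable M (\<lambda>\<omega>. W_monomial (p # ps) \<omega> * (A_monomial qs \<omega> * F' \<omega>))"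
      using mult_W(1,4,5) by (intro fm; auto)+
    then show ?thesis
      by (cases "p = (j, i)") (simp_all add: distrib_left mult_ac)
  qed
  then have "(LINT \<omega>|M. W_monomial (p # ps) \<omega> * (A_monomial qs \<omega> * F' \<omega>)) =
     (LINT \<omega>|M. W_monomial ps \<omega> * (A_monomial qs \<omega> *
        ((if p = (j, i) then F \<omega> else 0) + W \<omega> $$ p * F' \<omega>))) -
     (if p = (j, i) then (LINT \<omega>|M. W_monomial ps \<omega> * (A_monomial qs \<omega> * F \<omega>)) else 0)"
    by simp
  finally show ?case by simp
next
  case (mult_A p F F')
  then have "set (p # qs) \<subseteq> {..<n} \<times> {..<n}" by simp
  moreover have "A_monomial (p # qs) \<omega> * G \<omega> = A_monomial qs \<omega> * (A \<omega> $$ p * G \<omega>)" for G \<omega>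
    by (simp add: mult_ac)
  ultimately show ?case
    using mult_A.IH[OF mult_A(4), of "p # qs"] by (simp only:)
next
  case (scale F F' c)
  have "(if P then c * x else 0) = c * (if P then x else 0)" for P and x :: complex
    by simp
  with scale.IH[OF scale(3,4)] show ?case
    by (simp add: mult.left_commute[of _ c] split_def sum_list_const_mult distrib_left
        cong: if_cong)
next
  case (add F F' G G')
  note fm = finite_moments_integrable finite_moments_mult finite_moments_prod_list
    polynomial_deriv_finite_moments[OF add(1)] polynomial_deriv_finite_moments[OF add(2)] W_moments A_moments
  have split: "(LINT \<omega>|M. W_monomial ps \<omega> * (A_monomial qs \<omega> * (F \<omega> + G \<omega>))) =
     (LINT \<omega>|M. W_monomial ps \<omega> * (A_monomial qs \<omega> * F \<omega>)) +
     (LINT \<omega>|M. W_monomial ps \<omega> * (A_monomial qs \<omega> * G \<omega>))"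
    "(LINT \<omega>|M. W_monomial ps \<omega> * (A_monomial qs \<omega> * (F' \<omega> + G' \<omega>))) =
     (LINT \<omega>|M. W_monomial ps \<omega> * (A_monomial qs \<omega> * F' \<omega>)) +
     (LINT \<omega>|M. W_monomial ps \<omega> * (A_monomial qs \<omega> * G' \<omega>))"
    if "set ps \<subseteq> {..<n} \<times> {..<n}" for ps
    unfolding distrib_left
    by (intro Bochner_Integration.integral_add fm; use that add(6) in auto)+
  have s1: "(LINT \<omega>|M. W \<omega> $$ (i, j) * (W_monomial ps \<omega> * (A_monomial qs \<omega> * (F \<omega> + G \<omega>)))) =
     (LINT \<omega>|M. W \<omega> $$ (i, j) * (W_monomial ps \<omega> * (A_monomial qs \<omega> * F \<omega>))) +
     (LINT \<omega>|M. W \<omega> $$ (i, j) * (W_monomial ps \<omega> * (A_monomial qs \<omega> * G \<omega>)))"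
    using split(1)[of "(i, j) # ps"] add(5) assms(2,3) by (simp add: mult.assoc)
  have "(\<Sum>(p, rs)\<leftarrow>picks ps. if p = (j, i)
         then (LINT \<omega>|M. W_monomial rs \<omega> * (A_monomial qs \<omega> * (F \<omega> + G \<omega>))) else 0) =
     (\<Sum>(p, rs)\<leftarrow>picks ps. (if p = (j, i)
         then (LINT \<omega>|M. W_monomial rs \<omega> * (A_monomial qs \<omega> * F \<omega>)) else 0) +
       (if p = (j, i)
         then (LINT \<omega>|M. W_monomial rs \<omega> * (A_monomial qs \<omega> * G \<omega>)) else 0))"
  proof (rule arg_cong[where f = sum_list], rule map_cong[OF refl], clarify)
    fix a b rs assume "((a, b), rs) \<in> set (picks ps)"
    then have "set rs \<subseteq> {..<n} \<times> {..<n}" using set_picksD add(5) by fastforce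
    from split(1)[OF this]
    show "(if (a, b) = (j, i)
         then (LINT \<omega>|M. W_monomial rs \<omega> * (A_monomial qs \<omega> * (F \<omega> + G \<omega>))) else 0) =
       (if (a, b) = (j, i)
         then (LINT \<omega>|M. W_monomial rs \<omega> * (A_monomial qs \<omega> * F \<omega>)) else 0) +
       (if (a, b) = (j, i)
         then (LINT \<omega>|M. W_monomial rs \<omega> * (A_monomial qs \<omega> * G \<omega>)) else 0)"
      by simp
  qed
  then have s2: "(\<Sum>(p, rs)\<leftarrow>picks ps. if p = (j, i)
         then (LINT \<omega>|M. W_monomial rs \<omega> * (A_monomial qs \<omega> * (F \<omega> + G \<omega>))) else 0) =
     (\<Sum>(p, rs)\<leftarrow>picks ps. if p = (j, i)
         then (LINT \<omega>|M. W_monomial rs \<omega> * (A_monomial qs \<omega> * F \<omega>)) else 0) +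
     (\<Sum>(p, rs)\<leftarrow>picks ps. if p = (j, i)
         then (LINT \<omega>|M. W_monomial rs \<omega> * (A_monomial qs \<omega> * G \<omega>)) else 0)"
    by (simp only: split_def sum_list_addf)
  show ?case
    unfolding s1 s2 split(2)[OF add(5)] add.IH(1)[OF add(5,6)] add.IH(2)[OF add(5,6)]
    by (simp only: distrib_left add_ac)
qed

text \<open>The derivative is taken in the transposed direction because \<open>W (j, i)\<close> is
  the only entry whose product with \<open>W (i, j)\<close> has nonzero mean.\<close>

lemma stein:
  assumes "polynomial_deriv (j, i) F F'" "i < n" "j < n"
  shows "(LINT \<omega>|M. W \<omega> $$ (i, j) * F \<omega>) = 1 / of_nat n * (LINT \<omega>|M. F' \<omega>)"
  using stein_monomial[OF assms, of "[]" "[]"] by simp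

text \<open>Written as a sum over paths rather than as an entry of a matrix product, so that it is a
  polynomial in the entries at every \<open>\<omega>\<close>, even outside \<open>space M\<close>,
  where the dimensions are unknown.\<close>

fun word_entry :: "bool list \<Rightarrow> nat \<Rightarrow> nat \<Rightarrow> 'w \<Rightarrow> complex" where
  "word_entry [] i j \<omega> = (if i = j then 1 else 0)"
| "word_entry (b # w) i j \<omega> = (\<Sum>k<n. (if b then W \<omega> else A \<omega>) $$ (i, k) * word_entry w k j \<omega>)"

definition trc :: "bool list \<Rightarrow> 'w \<Rightarrow> complex" where
  "trc w \<omega> = (\<Sum>i<n. word_entry w i i \<omega>)"

definition trc_prod :: "bool list list \<Rightarrow> 'w \<Rightarrow> complex" where
  "trc_prod ws \<omega> = (\<Prod>w\<leftarrow>ws. trc w \<omega>)"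

lemma trc_prod_simps [simp]:
  "trc_prod [] \<omega> = 1" "trc_prod (w # ws) \<omega> = trc w \<omega> * trc_prod ws \<omega>"
  by (simp_all add: trc_prod_def)

lemma mat_trace_matrix_word:
  assumes "\<omega> \<in> space M"
  shows "mat_trace (matrix_word n (case_bool W A) w \<omega>) = trc w \<omega>"
proof -
  have "matrix_word n (case_bool W A) w \<omega> \<in> carrier_mat n n \<and>
    (\<forall>i<n. \<forall>j<n. matrix_word n (case_bool W A) w \<omega> $$ (i, j) = word_entry w i j \<omega>)"
  proof (induction w)
    case Nil
    show ?case by (simp add: matrix_word_def)
  next
    case (Cons b w)
    have eq: "matrix_word n (case_bool W A) (b # w) \<omega> =
      (if b then W \<omega> else A \<omega>) * matrix_word n (case_bool W A) w \<omega>"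
      by (simp add: matrix_word_def)
    have "(if b then W \<omega> else A \<omega>) \<in> carrier_mat n n"
      using W_carrier A_carrier assms by auto
    then show ?case
      using Cons unfolding eq
      by (auto simp: scalar_prod_def lessThan_atLeast0 intro!: sum.cong)
  qed
  then show ?thesis
    by (auto simp: mat_trace_def trc_def carrier_matD)
qed

lemma word_entry_append:
  "i < n \<Longrightarrow> word_entry (u @ v) i j \<omega> = (\<Sum>k<n. word_entry u i k \<omega> * word_entry v k j \<omega>)"
proof (induction u arbitrary: i)
  case Nil
  then show ?case by (simp add: if_distrib[of "\<lambda>x. x * _"] cong: if_cong)
next
  case (Cons b u)
  have "word_entry ((b # u) @ v) i j \<omega> =
    (\<Sum>k<n. \<Sum>l<n. (if b then W \<omega> else A \<omega>) $$ (i, k) * (word_entry u k l \<omega> * word_entry v l j \<omega>))"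
    using Cons.IH by (simp add: sum_distrib_left)
  also have "\<dots> = (\<Sum>l<n. \<Sum>k<n. (if b then W \<omega> else A \<omega>) $$ (i, k) * (word_entry u k l \<omega> * word_entry v l j \<omega>))"
    by (rule sum.swap)
  finally show ?case by (simp add: sum_distrib_right mult.assoc)
qed

lemma trc_append: "trc (u @ v) \<omega> = (\<Sum>i<n. \<Sum>j<n. word_entry u i j \<omega> * word_entry v j i \<omega>)"
  by (simp add: trc_def word_entry_append)

lemma trc_append_commute: "trc (u @ v) \<omega> = trc (v @ u) \<omega>"
  unfolding trc_append by (subst sum.swap) (simp add: mult.commute)

text \<open>The entry \<open>(i, j)\<close> is a sum over paths from \<open>i\<close> to
  \<open>j\<close>. Deleting a step from \<open>a\<close> to \<open>b\<close> leaves a path from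
  \<open>i\<close> to \<open>a\<close> and one from \<open>b\<close> to \<open>j\<close>.\<close>

lemma word_entry_deriv:
  assumes "i < n" "a < n" "b < n"
  shows "polynomial_deriv (a, b) (word_entry w i j)
     (\<lambda>\<omega>. \<Sum>(u, v)\<leftarrow>splits w. word_entry u i a \<omega> * word_entry v b j \<omega>)"
  using assms(1)
proof (induction w arbitrary: i)
  case Nil
  show ?case
    by (rule polynomial_deriv_eqI[OF const[of _ "if i = j then 1 else 0"]]) auto
next
  case (Cons x w)
  let ?D = "\<lambda>i \<omega>. \<Sum>(u, v)\<leftarrow>splits w. word_entry u i a \<omega> * word_entry v b j \<omega>"
  have D: "(\<Sum>k<n. X k * ?D k \<omega>) =
      (\<Sum>(u, v)\<leftarrow>splits w. (\<Sum>k<n. X k * word_entry u k a \<omega>) * word_entry v b j \<omega>)" for X \<omega>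
    by (simp add: sum_list_const_mult[symmetric] sum_sum_list_swap split_def sum_distrib_right mult.assoc)
  show ?case
  proof (cases x)
    case True
    have "polynomial_deriv (a, b) (\<lambda>\<omega>. \<Sum>k<n. W \<omega> $$ (i, k) * word_entry w k j \<omega>)
       (\<lambda>\<omega>. \<Sum>k<n. (if (i, k) = (a, b) then word_entry w k j \<omega> else 0) + W \<omega> $$ (i, k) * ?D k \<omega>)"
      using Cons by (intro polynomial_deriv_sum mult_W) auto
    then show ?thesis
    proof (rule polynomial_deriv_eqI)
      fix \<omega>
      have "(\<Sum>k<n. (if (i, k) = (a, b) then word_entry w k j \<omega> else 0)) =
          (if i = a then (if b < n then word_entry w b j \<omega> else 0) else 0)"
        by (simp add: sum.delta' cong: if_cong)
      then show "(\<Sum>k<n. (if (i, k) = (a, b) then word_entry w k j \<omega> else 0) + W \<omega> $$ (i, k) * ?D k \<omega>) =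
        (\<Sum>(u, v)\<leftarrow>splits (x # w). word_entry u i a \<omega> * word_entry v b j \<omega>)"
        using True D[of "\<lambda>k. W \<omega> $$ (i, k)"] assms
        by (simp add: sum.distrib o_def split_def)
    qed (simp add: True)
  next
    case False
    have "polynomial_deriv (a, b) (\<lambda>\<omega>. \<Sum>k<n. A \<omega> $$ (i, k) * word_entry w k j \<omega>)
       (\<lambda>\<omega>. \<Sum>k<n. A \<omega> $$ (i, k) * ?D k \<omega>)"
      using Cons by (intro polynomial_deriv_sum mult_A) auto
    then show ?thesis
      by (rule polynomial_deriv_eqI) (simp_all add: False D[unfolded split_def] o_def split_def)
  qed
qed

text \<open>In a closed path the two remaining pieces join up in the cyclic order \<open>v\<close>,
  \<open>u\<close>.\<close>

lemma trc_deriv: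
  assumes "a < n" "b < n"
  shows "polynomial_deriv (a, b) (trc w) (\<lambda>\<omega>. \<Sum>(u, v)\<leftarrow>splits w. word_entry (v @ u) b a \<omega>)"
proof -
  have "polynomial_deriv (a, b) (\<lambda>\<omega>. \<Sum>k<n. word_entry w k k \<omega>)
     (\<lambda>\<omega>. \<Sum>k<n. \<Sum>(u, v)\<leftarrow>splits w. word_entry u k a \<omega> * word_entry v b k \<omega>)"
    using assms by (intro polynomial_deriv_sum word_entry_deriv) auto
  then show ?thesis
    by (rule polynomial_deriv_eqI)
      (simp_all add: trc_def word_entry_append assms sum_sum_list_swap split_def mult.commute)
qed

fun trc_prod_partial :: "nat \<Rightarrow> nat \<Rightarrow> bool list list \<Rightarrow> 'w \<Rightarrow> complex" where
  "trc_prod_partial a b [] \<omega> = 0"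
| "trc_prod_partial a b (w # ws) \<omega> =
     (\<Sum>(u, v)\<leftarrow>splits w. word_entry (v @ u) b a \<omega>) * trc_prod ws \<omega> +
     trc w \<omega> * trc_prod_partial a b ws \<omega>"

lemma trc_prod_deriv:
  assumes "a < n" "b < n"
  shows "polynomial_deriv (a, b) (trc_prod ws) (trc_prod_partial a b ws)"
proof (induction ws)
  case Nil
  show ?case by (rule polynomial_deriv_eqI[OF const[of _ 1]]) auto
next
  case (Cons w ws)
  show ?case
    by (rule polynomial_deriv_eqI[OF polynomial_deriv_mult[OF trc_deriv[OF assms] Cons]]) auto
qed

text \<open>Contracting an entry of \<open>y\<close> with the derivative of a trace joins two paths
  into a single closed one, read as \<open>y @ v @ u\<close>.\<close>

lemma sum_trc_prod_partial:
  "(\<Sum>i<n. \<Sum>j<n. word_entry y j i \<omega> * trc_prod_partial j i ws \<omega>) =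
     (\<Sum>vs\<leftarrow>reconnections y ws. trc_prod vs \<omega>)"
proof (induction ws)
  case (Cons w ws)
  have "word_entry y j i \<omega> * trc_prod_partial j i (w # ws) \<omega> =
      (\<Sum>(u, v)\<leftarrow>splits w. word_entry y j i \<omega> * word_entry (v @ u) i j \<omega> * trc_prod ws \<omega>) +
      trc w \<omega> * (word_entry y j i \<omega> * trc_prod_partial j i ws \<omega>)" for i j
    by (simp add: split_def sum_list_const_mult sum_list_mult_const distrib_left mult_ac)
  then have "(\<Sum>i<n. \<Sum>j<n. word_entry y j i \<omega> * trc_prod_partial j i (w # ws) \<omega>) =
     (\<Sum>i<n. \<Sum>j<n. (\<Sum>(u, v)\<leftarrow>splits w. word_entry y j i \<omega> * word_entry (v @ u) i j \<omega> * trc_prod ws \<omega>)) +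
     (\<Sum>i<n. \<Sum>j<n. trc w \<omega> * (word_entry y j i \<omega> * trc_prod_partial j i ws \<omega>))"
    by (simp only: sum.distrib)
  also have "(\<Sum>i<n. \<Sum>j<n. (\<Sum>(u, v)\<leftarrow>splits w. word_entry y j i \<omega> * word_entry (v @ u) i j \<omega> * trc_prod ws \<omega>)) =
     (\<Sum>(u, v)\<leftarrow>splits w. trc (y @ v @ u) \<omega> * trc_prod ws \<omega>)"
  proof -
    have "trc (y @ v @ u) \<omega> = (\<Sum>i<n. \<Sum>j<n. word_entry y j i \<omega> * word_entry (v @ u) i j \<omega>)" for u v
      unfolding trc_append[of y] by (rule sum.swap)
    then show ?thesis
      by (simp add: sum_sum_list_swap split_def sum_distrib_right)
  qed
  finally show ?case
    using Cons by (simp add: sum_distrib_left[symmetric] sum_list_const_mult[symmetric] o_def split_def)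
qed simp

lemma trc_finite_moments: "finite_moments M (trc w)"
proof -
  have "finite_moments M (word_entry w i i)" if "i < n" for i
    using polynomial_deriv_finite_moments(1)[OF word_entry_deriv[OF that that that]] .
  then show ?thesis unfolding trc_def[abs_def] by (intro finite_moments_sum) auto
qed

lemma trc_prod_finite_moments: "finite_moments M (trc_prod ws)"
  unfolding trc_prod_def[abs_def] by (intro finite_moments_prod_list trc_finite_moments)

text \<open>The first trace is the sum of \<open>W (i, j)\<close> times the entry
  \<open>(j, i)\<close> of \<open>y\<close>. A derivative falling on \<open>y\<close> breaks this
  trace in two, one falling on another trace merges the two. The number of traces changes by plus or
  minus one, which is the source of the relative factor \<open>n^-2\<close> after
  normalisation.\<close>

lemma loop_equation:
  "(LINT \<omega>|M. trc_prod ((True # y) # ws) \<omega>) =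
     1 / of_nat n * ((\<Sum>(u, v)\<leftarrow>splits y. (LINT \<omega>|M. trc_prod (u # v # ws) \<omega>)) +
       (\<Sum>vs\<leftarrow>reconnections y ws. (LINT \<omega>|M. trc_prod vs \<omega>)))"
proof -
  let ?F = "\<lambda>i j \<omega>. word_entry y j i \<omega> * trc_prod ws \<omega>"
  let ?F' = "\<lambda>i j \<omega>. (\<Sum>(u, v)\<leftarrow>splits y. word_entry u j j \<omega> * word_entry v i i \<omega>) * trc_prod ws \<omega> +
      word_entry y j i \<omega> * trc_prod_partial j i ws \<omega>"
  have F: "polynomial_deriv (j, i) (?F i j) (?F' i j)" if "i < n" "j < n" for i j
    using that by (intro polynomial_deriv_mult word_entry_deriv trc_prod_deriv)
  have WF: "finite_moments M (\<lambda>\<omega>. W \<omega> $$ (i, j) * ?F i j \<omega>)" if "i < n" "j < n" for i j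
    using that by (intro finite_moments_mult W_moments
        polynomial_deriv_finite_moments(1)[OF F]) auto
  have "(LINT \<omega>|M. trc_prod ((True # y) # ws) \<omega>) =
      (LINT \<omega>|M. (\<Sum>i<n. \<Sum>j<n. W \<omega> $$ (i, j) * ?F i j \<omega>))"
    by (simp add: trc_def sum_distrib_right mult.assoc)
  also have "\<dots> = (\<Sum>i<n. \<Sum>j<n. (LINT \<omega>|M. W \<omega> $$ (i, j) * ?F i j \<omega>))"
    by (intro integral_double_sum WF)
  also have "\<dots> = (\<Sum>i<n. \<Sum>j<n. 1 / of_nat n * (LINT \<omega>|M. ?F' i j \<omega>))"
    by (intro sum.cong refl stein F) auto
  also have "\<dots> = 1 / of_nat n * (\<Sum>i<n. \<Sum>j<n. (LINT \<omega>|M. ?F' i j \<omega>))"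
    by (simp only: sum_distrib_left)
  also have "(\<Sum>i<n. \<Sum>j<n. (LINT \<omega>|M. ?F' i j \<omega>)) = (LINT \<omega>|M. (\<Sum>i<n. \<Sum>j<n. ?F' i j \<omega>))"
    by (intro integral_double_sum[symmetric] polynomial_deriv_finite_moments(2)[OF F])
  also have "(\<lambda>\<omega>. \<Sum>i<n. \<Sum>j<n. ?F' i j \<omega>) = (\<lambda>\<omega>. (\<Sum>(u, v)\<leftarrow>splits y. trc_prod (u # v # ws) \<omega>) +
       (\<Sum>vs\<leftarrow>reconnections y ws. trc_prod vs \<omega>))"
  proof
    fix \<omega>
    have "trc u \<omega> * (trc v \<omega> * c) = (\<Sum>i<n. \<Sum>j<n. word_entry u j j \<omega> * word_entry v i i \<omega> * c)" for u v c
    proof -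
      have "(\<Sum>i<n. \<Sum>j<n. word_entry u j j \<omega> * word_entry v i i \<omega> * c) =
        (\<Sum>i<n. (trc u \<omega> * c) * word_entry v i i \<omega>)"
        by (simp add: trc_def sum_distrib_left sum_distrib_right mult_ac)
      also have "\<dots> = (trc u \<omega> * c) * trc v \<omega>"
        by (simp add: trc_def sum_distrib_left)
      finally show ?thesis by (simp add: mult_ac)
    qed
    then have "(\<Sum>i<n. \<Sum>j<n. (\<Sum>(u, v)\<leftarrow>splits y. word_entry u j j \<omega> * word_entry v i i \<omega>) * trc_prod ws \<omega>) =
      (\<Sum>(u, v)\<leftarrow>splits y. trc_prod (u # v # ws) \<omega>)"
      by (simp add: split_def sum_list_mult_const[symmetric] sum_sum_list_swap)
    then show "(\<Sum>i<n. \<Sum>j<n. ?F' i j \<omega>) = (\<Sum>(u, v)\<leftarrow>splits y. trc_prod (u # v # ws) \<omega>) +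
       (\<Sum>vs\<leftarrow>reconnections y ws. trc_prod vs \<omega>)"
      by (simp only: sum.distrib sum_trc_prod_partial)
  qed
  also have "(LINT \<omega>|M. (\<Sum>(u, v)\<leftarrow>splits y. trc_prod (u # v # ws) \<omega>) +
       (\<Sum>vs\<leftarrow>reconnections y ws. trc_prod vs \<omega>)) =
     (\<Sum>(u, v)\<leftarrow>splits y. (LINT \<omega>|M. trc_prod (u # v # ws) \<omega>)) +
       (\<Sum>vs\<leftarrow>reconnections y ws. (LINT \<omega>|M. trc_prod vs \<omega>))"
    unfolding split_def
    by (subst Bochner_Integration.integral_add)
      (simp_all only: finite_moments_integrable finite_moments_sum_list trc_prod_finite_moments
        integral_sum_list)
  finally show ?thesis .
qed

end

section \<open>Bounded moments of patterned matrices\<close>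

lemma prod_list_count:
  fixes f :: "'a \<Rightarrow> 'b :: comm_monoid_mult"
  assumes "finite S" "set xs \<subseteq> S"
  shows "(\<Prod>x\<leftarrow>xs. f x) = (\<Prod>t\<in>S. f t ^ count_list xs t)"
  using assms(2)
proof (induction xs)
  case (Cons y xs)
  have "(\<Prod>t\<in>S. f t ^ count_list (y # xs) t) = (\<Prod>t\<in>S. (if t = y then f t else 1) * f t ^ count_list xs t)"
    by (intro prod.cong) auto
  also have "\<dots> = f y * (\<Prod>t\<in>S. f t ^ count_list xs t)"
    using Cons.prems assms(1) by (simp add: prod.distrib)
  finally show ?case using Cons by simp
qed simp

text \<open>The largest factor, raised to the number of factors, bounds the product. Summing over
  all factors avoids naming it, and the 1 covers the empty list.\<close>

lemma prod_list_norm_le: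
  fixes f :: "'a \<Rightarrow> 'b :: real_normed_div_algebra"
  shows "norm (\<Prod>x\<leftarrow>xs. f x) \<le> 1 + (\<Sum>x\<leftarrow>xs. norm (f x) ^ length xs)"
proof (cases "xs = []")
  case False
  define m where "m = Max ((\<lambda>x. norm (f x)) ` set xs)"
  have le: "norm (f x) \<le> m" if "x \<in> set xs" for x
    using that by (simp add: m_def)
  have "m \<in> (\<lambda>x. norm (f x)) ` set xs"
    unfolding m_def using False by (intro Max_in) auto
  then obtain y where y: "y \<in> set xs" "m = norm (f y)" by blast
  have "set ys \<subseteq> set xs \<Longrightarrow> norm (\<Prod>x\<leftarrow>ys. f x) \<le> m ^ length ys" for ys
    by (induction ys) (auto simp: norm_mult y(2) intro!: mult_mono le[unfolded y(2)])
  then have "norm (\<Prod>x\<leftarrow>xs. f x) \<le> norm (f y) ^ length xs" using y by blast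
  also have "\<dots> \<le> (\<Sum>x\<leftarrow>xs. norm (f x) ^ length xs)"
    by (rule member_le_sum_list) (use y in auto)
  finally show ?thesis by simp
qed simp

locale patterned = prob_space M for M :: "'w measure" +
  fixes x :: "'t \<Rightarrow> 'w \<Rightarrow> real" and L :: "nat \<Rightarrow> nat \<times> nat \<Rightarrow> 't"
  assumes indep: "indep_vars (\<lambda>_. borel) x UNIV"
    and moment_bounds: "\<exists>C. \<forall>t. integrable M (\<lambda>\<omega>. \<bar>x t \<omega>\<bar> ^ m) \<and> (LINT \<omega>|M. \<bar>x t \<omega>\<bar> ^ m) \<le> C"
    and mean: "expectation (x t) = 0"
    and B: "property_B L"
begin

abbreviation "X t \<omega> \<equiv> complex_of_real (x t \<omega>)"

lemma x_measurable [measurable]: "x t \<in> borel_measurable M"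
  using indep by (simp add: indep_vars_def)

lemma X_moments: "finite_moments M (X t)"
  using moment_bounds by (intro finite_moments_of_real) auto

lemma mixed_moment_bound:
  "\<exists>C. \<forall>ts. length ts = N \<longrightarrow> norm (LINT \<omega>|M. (\<Prod>t\<leftarrow>ts. X t \<omega>)) \<le> C"
proof -
  obtain C where C: "\<And>t. integrable M (\<lambda>\<omega>. \<bar>x t \<omega>\<bar> ^ N)" "\<And>t. (LINT \<omega>|M. \<bar>x t \<omega>\<bar> ^ N) \<le> C"
    using moment_bounds by blast
  have "norm (LINT \<omega>|M. (\<Prod>t\<leftarrow>ts. X t \<omega>)) \<le> 1 + N * C" if "length ts = N" for ts
  proof -
    have int: "integrable M (\<lambda>\<omega>. \<Sum>t\<leftarrow>us. \<bar>x t \<omega>\<bar> ^ N)" for us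
      by (induction us) (auto intro: C)
    have sum: "(LINT \<omega>|M. (\<Sum>t\<leftarrow>us. \<bar>x t \<omega>\<bar> ^ N)) \<le> length us * C" for us
    proof (induction us)
      case (Cons u us)
      then show ?case using C(2)[of u] by (simp add: int C(1) algebra_simps)
    qed simp
    have "norm (LINT \<omega>|M. (\<Prod>t\<leftarrow>ts. X t \<omega>)) \<le> (LINT \<omega>|M. norm (\<Prod>t\<leftarrow>ts. X t \<omega>))"
      by (rule integral_norm_bound)
    also have "\<dots> \<le> (LINT \<omega>|M. 1 + (\<Sum>t\<leftarrow>ts. \<bar>x t \<omega>\<bar> ^ N))"
    proof (rule integral_mono)
      show "integrable M (\<lambda>\<omega>. norm (\<Prod>t\<leftarrow>ts. X t \<omega>))"
        by (intro integrable_norm finite_moments_integrable finite_moments_prod_list X_moments)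
      show "norm (\<Prod>t\<leftarrow>ts. X t \<omega>) \<le> 1 + (\<Sum>t\<leftarrow>ts. \<bar>x t \<omega>\<bar> ^ N)" for \<omega>
        using prod_list_norm_le[of "\<lambda>t. X t \<omega>" ts] that by simp
    qed (use int in simp)
    also have "\<dots> \<le> 1 + N * C"
      using sum[of ts] int that by (simp add: prob_space)
    finally show ?thesis .
  qed
  then show ?thesis by blast
qed

text \<open>With fewer than two positions per value on average, some value occurs exactly once; by
  independence its mean, which is zero, splits off.\<close>

lemma mixed_moment_zero:
  assumes "length ts < 2 * card (set ts)"
  shows "(LINT \<omega>|M. (\<Prod>t\<leftarrow>ts. X t \<omega>)) = 0"
proof -
  have "\<exists>t\<in>set ts. count_list ts t = 1"
  proof (rule ccontr)
    assume *: "\<not> ?thesis"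
    have "2 \<le> count_list ts t" if "t \<in> set ts" for t
    proof -
      have "count_list ts t \<noteq> 0" "count_list ts t \<noteq> 1"
        using * that by (auto simp: count_list_0_iff)
      then show ?thesis by linarith
    qed
    then have "(\<Sum>t\<in>set ts. 2) \<le> (\<Sum>t\<in>set ts. count_list ts t)"
      by (intro sum_mono)
    also have "\<dots> = length ts" by (intro sum_count_set) auto
    finally show False using assms by simp
  qed
  then obtain t where t: "t \<in> set ts" "count_list ts t = 1" by blast
  have "indep_vars (\<lambda>_. borel) (\<lambda>t \<omega>. x t \<omega> ^ count_list ts t) (set ts)"
    by (rule indep_vars_compose2[OF indep_vars_subset[OF indep]]) auto
  moreover have "integrable M (\<lambda>\<omega>. x t \<omega> ^ k)" for t k
  proof -
    have "integrable M (\<lambda>\<omega>. \<bar>x t \<omega>\<bar> ^ k)" using moment_bounds by blast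
    then have "integrable M (\<lambda>\<omega>. norm (x t \<omega> ^ k))" by (simp add: power_abs)
    then show ?thesis by (subst (asm) integrable_norm_iff) auto
  qed
  ultimately have "(LINT \<omega>|M. (\<Prod>t\<in>set ts. x t \<omega> ^ count_list ts t)) =
      (\<Prod>t\<in>set ts. (LINT \<omega>|M. x t \<omega> ^ count_list ts t))"
    by (intro indep_vars_lebesgue_integral) auto
  also have "\<dots> = 0"
  proof (rule prod_zero)
    show "\<exists>s\<in>set ts. (LINT \<omega>|M. x s \<omega> ^ count_list ts s) = 0"
      using t mean[of t] by (intro bexI[of _ t]) auto
  qed simp
  finally have "(LINT \<omega>|M. (\<Prod>t\<in>set ts. x t \<omega> ^ count_list ts t)) = 0" .
  then have "complex_of_real (LINT \<omega>|M. (\<Prod>t\<leftarrow>ts. x t \<omega>)) = 0"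
    by (subst prod_list_count[of "set ts"]) auto
  moreover have "(\<Prod>t\<leftarrow>ts. X t \<omega>) = complex_of_real (\<Prod>t\<leftarrow>ts. x t \<omega>)" for \<omega>
    by (induction ts) auto
  ultimately show ?thesis by (simp only: integral_complex_of_real)
qed

text \<open>The entry \<open>(k, l)\<close> of the \<open>m\<close>-th power of the unscaled matrix,
  expanded over walks that start at \<open>k\<close>.\<close>

fun power_entry :: "nat \<Rightarrow> nat \<Rightarrow> nat \<Rightarrow> nat \<Rightarrow> 'w \<Rightarrow> complex" where
  "power_entry n 0 k l \<omega> = (if k = l then 1 else 0)"
| "power_entry n (Suc m) k l \<omega> =
     (\<Sum>j<n. X (L n (Suc k, Suc j)) \<omega> * power_entry n m j l \<omega>)"

lemma power_entry_moments: "finite_moments M (power_entry n m k l)"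
proof (induction m arbitrary: k)
  case (Suc m)
  then show ?case
    unfolding power_entry.simps[abs_def] by (intro finite_moments_intros X_moments)
qed (cases "k = l"; simp add: power_entry.simps(1)[abs_def])

text \<open>By Property B each value in \<open>S\<close> is taken at no more than \<open>C\<close>
  vertices, and only there does the cardinality stay the same. The other vertices, at most
  \<open>n\<close> of them, gain a factor \<open>1/n\<close> each and together contribute the
  summand 1.\<close>

lemma inverse_power_card_sum:
  obtains C :: real where "\<And>n k S. k < n \<Longrightarrow> finite S \<Longrightarrow>
    (\<Sum>j<n. 1 / real n ^ card (insert (L n (Suc k, Suc j)) S)) \<le> (real (card S) * C + 1) / real n ^ card S"
proof -
  obtain C where C: "\<And>n t k. k \<in> {1..n} \<Longrightarrow> card {l \<in> {1..n}. L n (k, l) = t} \<le> C"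
    using B unfolding property_B_def by blast
  have "(\<Sum>j<n. 1 / real n ^ card (insert (L n (Suc k, Suc j)) S)) \<le> (card S * real C + 1) / real n ^ card S"
    if "k < n" "finite S" for n k S
  proof -
    define J where "J t = {j. j < n \<and> L n (Suc k, Suc j) = t}" for t
    have J: "card (J t) \<le> C" for t
    proof -
      have "card (J t) = card (Suc ` J t)" by (simp add: card_image)
      also have "\<dots> \<le> card {l \<in> {1..n}. L n (Suc k, l) = t}"
        by (intro card_mono) (auto simp: J_def)
      also have "\<dots> \<le> C" using that by (intro C) auto
      finally show ?thesis .
    qed
    have n: "real n > 0" using that by simp
    have "(\<Sum>j<n. 1 / real n ^ card (insert (L n (Suc k, Suc j)) S)) \<le>
       (\<Sum>j<n. (if j \<in> \<Union> (J ` S) then 1 / real n ^ card S else 0) + 1 / real n ^ Suc (card S))"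
      using that n by (intro sum_mono) (auto simp: J_def insert_absorb)
    also have "\<dots> = (\<Sum>j<n. if j \<in> \<Union> (J ` S) then 1 / real n ^ card S else 0) + 1 / real n ^ card S"
      using n by (simp add: sum.distrib)
    also have "(\<Sum>j<n. if j \<in> \<Union> (J ` S) then 1 / real n ^ card S else 0) =
        card ({..<n} \<inter> \<Union> (J ` S)) / real n ^ card S"
      by (subst sum.inter_restrict[symmetric]) auto
    also have "\<dots> \<le> card S * real C / real n ^ card S"
    proof (rule divide_right_mono)
      have "card ({..<n} \<inter> \<Union> (J ` S)) \<le> card (\<Union> (J ` S))"
        using that by (intro card_mono) (auto simp: J_def)
      also have "\<dots> \<le> (\<Sum>t\<in>S. card (J t))" by (rule card_UN_le) fact
      also have "\<dots> \<le> card S * C" using sum_mono[of S "\<lambda>t. card (J t)" "\<lambda>_. C"] J by simp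
      finally show "real (card ({..<n} \<inter> \<Union> (J ` S))) \<le> card S * real C"
        unfolding of_nat_mult[symmetric] of_nat_le_iff .
    qed simp
    finally show ?thesis by (simp add: add_divide_distrib)
  qed
  then show thesis using that by blast
qed

text \<open>
  The list \<open>ts\<close> holds the link values along the part of a walk that has already been summed out;
  a step to a vertex with a new link value has \<open>n\<close> choices, any other step boundedly many.
\<close>

lemma power_entry_bound:
  "\<exists>K\<ge>0. \<forall>n ts k. length ts = N \<longrightarrow> k < n \<longrightarrow>
     (\<Sum>l<n. norm (LINT \<omega>|M. (\<Prod>t\<leftarrow>ts. X t \<omega>) * power_entry n m k l \<omega>)) \<le>
     K * sqrt n ^ (m + N) / real n ^ card (set ts)"
proof (induction m arbitrary: N)
  case 0
  obtain C where C: "\<And>ts. length ts = N \<Longrightarrow> norm (LINT \<omega>|M. (\<Prod>t\<leftarrow>ts. X t \<omega>)) \<le> C"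
    using mixed_moment_bound by blast
  show ?case
  proof (intro exI[of _ "max 0 C"] conjI allI impI)
    fix n ts k assume ts: "length (ts :: 't list) = N" and k: "k < (n :: nat)"
    have "(\<Sum>l<n. norm (LINT \<omega>|M. (\<Prod>t\<leftarrow>ts. X t \<omega>) * power_entry n 0 k l \<omega>)) =
       (\<Sum>l<n. if l = k then norm (LINT \<omega>|M. (\<Prod>t\<leftarrow>ts. X t \<omega>)) else 0)"
      by (intro sum.cong) auto
    also have "\<dots> = norm (LINT \<omega>|M. (\<Prod>t\<leftarrow>ts. X t \<omega>))" using k by simp
    \<comment> \<open>Either some value occurs only once and the integral is zero, or there are at
      most \<open>N/2\<close> values and the quotient is at least 1.\<close>
    also have "\<dots> \<le> max 0 C * (sqrt n ^ N / real n ^ card (set ts))"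
    proof (cases "length ts < 2 * card (set ts)")
      case False
      have "real n ^ card (set ts) = sqrt n ^ (2 * card (set ts))" by (simp add: power_mult)
      also have "\<dots> \<le> sqrt n ^ N" using False ts k by (intro power_increasing) auto
      finally have "1 \<le> sqrt n ^ N / real n ^ card (set ts)" using k by simp
      then have "max 0 C * 1 \<le> max 0 C * (sqrt n ^ N / real n ^ card (set ts))"
        by (intro mult_left_mono) auto
      then show ?thesis using C[OF ts] by linarith
    qed (simp add: mixed_moment_zero)
    finally show "(\<Sum>l<n. norm (LINT \<omega>|M. (\<Prod>t\<leftarrow>ts. X t \<omega>) * power_entry n 0 k l \<omega>)) \<le>
      max 0 C * sqrt n ^ (0 + N) / real n ^ card (set ts)" by simp
  qed simp
next
  case (Suc m)
  obtain K where K: "K \<ge> 0" "\<And>n ts k. length ts = Suc N \<Longrightarrow> k < n \<Longrightarrow>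
     (\<Sum>l<n. norm (LINT \<omega>|M. (\<Prod>t\<leftarrow>ts. X t \<omega>) * power_entry n m k l \<omega>)) \<le>
     K * sqrt n ^ (m + Suc N) / real n ^ card (set ts)"
    using Suc[of "Suc N"] by blast
  obtain C :: real where C: "\<And>n k S. k < n \<Longrightarrow> finite S \<Longrightarrow>
    (\<Sum>j<n. 1 / real n ^ card (insert (L n (Suc k, Suc j)) S)) \<le> (real (card S) * C + 1) / real n ^ card S"
    using inverse_power_card_sum by blast
  show ?case
  proof (intro exI[of _ "K * (N * \<bar>C\<bar> + 1)"] conjI allI impI)
    fix n ts k assume ts: "length (ts :: 't list) = N" and k: "k < (n :: nat)"
    let ?P = "\<lambda>ts \<omega>. \<Prod>t\<leftarrow>ts. X t \<omega>"
    let ?t = "\<lambda>j. L n (Suc k, Suc j)"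
    have "norm (LINT \<omega>|M. ?P ts \<omega> * power_entry n (Suc m) k l \<omega>) \<le>
       (\<Sum>j<n. norm (LINT \<omega>|M. ?P (?t j # ts) \<omega> * power_entry n m j l \<omega>))" for l
    proof -
      have "(LINT \<omega>|M. ?P ts \<omega> * power_entry n (Suc m) k l \<omega>) =
         (LINT \<omega>|M. (\<Sum>j<n. ?P (?t j # ts) \<omega> * power_entry n m j l \<omega>))"
        by (simp add: sum_distrib_left mult_ac)
      also have "\<dots> = (\<Sum>j<n. (LINT \<omega>|M. ?P (?t j # ts) \<omega> * power_entry n m j l \<omega>))"
        by (intro Bochner_Integration.integral_sum finite_moments_integrable finite_moments_mult
            finite_moments_prod_list X_moments power_entry_moments)
      finally have eq: "(LINT \<omega>|M. ?P ts \<omega> * power_entry n (Suc m) k l \<omega>) =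
         (\<Sum>j<n. (LINT \<omega>|M. ?P (?t j # ts) \<omega> * power_entry n m j l \<omega>))" .
      show ?thesis unfolding eq by (rule norm_sum)
    qed
    then have "(\<Sum>l<n. norm (LINT \<omega>|M. ?P ts \<omega> * power_entry n (Suc m) k l \<omega>)) \<le>
        (\<Sum>l<n. \<Sum>j<n. norm (LINT \<omega>|M. ?P (?t j # ts) \<omega> * power_entry n m j l \<omega>))"
      by (rule sum_mono)
    \<comment> \<open>With the end point summed first, the induction hypothesis bounds the rest of
      the walk by a quantity that depends on \<open>j\<close> only through the set of link
      values.\<close>
    also have "\<dots> = (\<Sum>j<n. \<Sum>l<n. norm (LINT \<omega>|M. ?P (?t j # ts) \<omega> * power_entry n m j l \<omega>))"
      by (rule sum.swap)
    also have "\<dots> \<le> (\<Sum>j<n. K * sqrt n ^ (m + Suc N) / real n ^ card (set (?t j # ts)))"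
      using ts by (intro sum_mono K) auto
    also have "\<dots> = K * sqrt n ^ (m + Suc N) * (\<Sum>j<n. 1 / real n ^ card (insert (?t j) (set ts)))"
      by (simp add: sum_distrib_left)
    also have "\<dots> \<le> K * sqrt n ^ (m + Suc N) * ((card (set ts) * C + 1) / real n ^ card (set ts))"
      using K(1) k by (intro mult_left_mono C) auto
    also have "\<dots> \<le> K * sqrt n ^ (m + Suc N) * ((N * \<bar>C\<bar> + 1) / real n ^ card (set ts))"
    proof (intro mult_left_mono divide_right_mono add_right_mono)
      have "card (set ts) * C \<le> card (set ts) * \<bar>C\<bar>" by (intro mult_left_mono) auto
      also have "\<dots> \<le> N * \<bar>C\<bar>" using card_length[of ts] ts by (intro mult_right_mono) auto
      finally show "card (set ts) * C \<le> N * \<bar>C\<bar>" .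
    qed (use K(1) in auto)
    finally show "(\<Sum>l<n. norm (LINT \<omega>|M. ?P ts \<omega> * power_entry n (Suc m) k l \<omega>)) \<le>
       K * (N * \<bar>C\<bar> + 1) * sqrt n ^ (Suc m + N) / real n ^ card (set ts)"
      by (simp add: mult_ac)
  qed (use K(1) in auto)
qed

end

section \<open>Eigenvalues of real symmetric matrices\<close>

lemma trace_mult_commute:
  fixes P Q :: "complex mat"
  assumes "P \<in> carrier_mat n n" "Q \<in> carrier_mat n n"
  shows "(\<Sum>i<n. (P * Q) $$ (i, i)) = (\<Sum>i<n. (Q * P) $$ (i, i))"
proof -
  have "(\<Sum>i<n. (P * Q) $$ (i, i)) = (\<Sum>i<n. \<Sum>j<n. P $$ (i, j) * Q $$ (j, i))"
    using assms by (auto simp: scalar_prod_def lessThan_atLeast0 intro!: sum.cong)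
  also have "\<dots> = (\<Sum>j<n. \<Sum>i<n. Q $$ (j, i) * P $$ (i, j))"
    by (subst sum.swap) (simp add: mult.commute)
  also have "\<dots> = (\<Sum>i<n. (Q * P) $$ (i, i))"
    using assms by (auto simp: scalar_prod_def lessThan_atLeast0 intro!: sum.cong)
  finally show ?thesis .
qed

lemma upper_triangular_pow:
  fixes B :: "complex mat"
  assumes B: "B \<in> carrier_mat n n" "upper_triangular B"
  shows "upper_triangular (B ^\<^sub>m k) \<and> (\<forall>i<n. (B ^\<^sub>m k) $$ (i, i) = (B $$ (i, i)) ^ k)"
proof (induction k)
  case 0
  then show ?case using B by auto
next
  case (Suc k)
  let ?C = "B ^\<^sub>m k"
  have C: "?C \<in> carrier_mat n n" using B by simp
  have entry: "(?C * B) $$ (i, j) = (\<Sum>l<n. ?C $$ (i, l) * B $$ (l, j))" if "i < n" "j < n" for i j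
    using B C that by (auto simp: scalar_prod_def lessThan_atLeast0 intro!: sum.cong)
  have zC: "?C $$ (i, l) = 0" if "l < i" "i < n" for i l
    using Suc C that by (auto dest: upper_triangularD)
  have zB: "B $$ (i, l) = 0" if "l < i" "i < n" for i l
    using B that by (auto dest: upper_triangularD)
  have "(?C * B) $$ (i, j) = 0" if "j < i" "i < n" for i j
    unfolding entry[OF that(2) less_trans[OF that]]
  proof (intro sum.neutral ballI)
    fix l assume "l \<in> {..<n}"
    then show "?C $$ (i, l) * B $$ (l, j) = 0"
      using zC[of l i] zB[of j l] that by (cases "l < i") auto
  qed
  then have "upper_triangular (?C * B)"
    using B C by (intro upper_triangularI) auto
  moreover have "(?C * B) $$ (i, i) = (B $$ (i, i)) ^ Suc k" if "i < n" for i
  proof -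
    have "(?C * B) $$ (i, i) = (\<Sum>l<n. if l = i then ?C $$ (i, i) * B $$ (i, i) else 0)"
      unfolding entry[OF that that]
    proof (intro sum.cong refl)
      fix l assume "l \<in> {..<n}"
      then show "?C $$ (i, l) * B $$ (l, i) = (if l = i then ?C $$ (i, i) * B $$ (i, i) else 0)"
        using zC[of l i] zB[of i l] that by (cases l i rule: linorder_cases) auto
    qed
    then show ?thesis using Suc that by simp
  qed
  ultimately show ?case by simp
qed

text \<open>Schur triangularisation: \<open>C ^ k\<close> is similar to the \<open>k\<close>-th
  power of a triangular matrix with diagonal \<open>as\<close>, and the trace is invariant under
  similarity.\<close>

lemma trace_pow_eq_sum_eigenvalues:
  fixes C :: "complex mat"
  assumes C: "C \<in> carrier_mat n n" and as: "char_poly C = (\<Prod>a\<leftarrow>as. [:- a, 1:])"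
  shows "(\<Sum>i<n. (C ^\<^sub>m k) $$ (i, i)) = (\<Sum>a\<leftarrow>as. a ^ k)"
proof -
  obtain B P Q where "schur_decomposition C as = (B, P, Q)" by (metis prod_cases3)
  from schur_decomposition[OF C as this]
  have sim: "similar_mat_wit C B P Q" and B: "upper_triangular B" "diag_mat B = as" by auto
  note D = similar_mat_witD2[OF C sim]
  note Dk = similar_mat_witD2[OF pow_carrier_mat[OF C, of k] similar_mat_wit_pow[OF sim, of k]]
  have "(\<Sum>i<n. (C ^\<^sub>m k) $$ (i, i)) = (\<Sum>i<n. (P * (B ^\<^sub>m k * Q)) $$ (i, i))"
    by (subst Dk(3), subst assoc_mult_mat[OF Dk(6,5,7)], rule refl)
  also have "\<dots> = (\<Sum>i<n. ((B ^\<^sub>m k * Q) * P) $$ (i, i))"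
    using Dk by (intro trace_mult_commute) auto
  also have "(B ^\<^sub>m k * Q) * P = B ^\<^sub>m k"
    using assoc_mult_mat[OF Dk(5,7,6)] Dk(2) right_mult_one_mat[OF Dk(5)] by simp
  also have "(\<Sum>i<n. (B ^\<^sub>m k) $$ (i, i)) = (\<Sum>i<n. (B $$ (i, i)) ^ k)"
    using upper_triangular_pow[OF D(5) B(1)] by auto
  also have "\<dots> = (\<Sum>a\<leftarrow>as. a ^ k)"
    using D(5) unfolding B(2)[symmetric] diag_mat_def
    by (simp add: sum_list_distinct_conv_sum_set o_def atLeast0LessThan)
  finally show ?thesis .
qed

text \<open>For an eigenvector \<open>v\<close>, the quadratic form of \<open>X\<close> at
  \<open>v\<close> equals \<open>a\<close> times the squared norm of \<open>v\<close>, and it is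
  real by symmetry.\<close>

lemma symmetric_eigenvalue_real:
  fixes X :: "real mat"
  assumes X: "X \<in> carrier_mat n n" and sym: "\<And>i j. i < n \<Longrightarrow> j < n \<Longrightarrow> X $$ (i, j) = X $$ (j, i)"
    and ev: "eigenvalue (complex_mat X) a"
  shows "a \<in> \<real>"
proof -
  obtain v where v: "v \<in> carrier_vec n" "v \<noteq> 0\<^sub>v n" "complex_mat X *\<^sub>v v = a \<cdot>\<^sub>v v"
    using ev X by (auto simp: eigenvalue_def eigenvector_def)
  define q where "q = (\<Sum>i<n. \<Sum>j<n. cnj (v $ i) * (X $$ (i, j) * v $ j))"
  define s where "s = (\<Sum>i<n. (cmod (v $ i))\<^sup>2)"
  have row: "(\<Sum>j<n. X $$ (i, j) * v $ j) = a * v $ i" if "i < n" for i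
  proof -
    have "(complex_mat X *\<^sub>v v) $ i = (\<Sum>j<n. X $$ (i, j) * v $ j)"
      using X v(1) that by (auto simp: scalar_prod_def lessThan_atLeast0 intro!: sum.cong)
    then show ?thesis using v that by simp
  qed
  have "q = (\<Sum>i<n. cnj (v $ i) * (a * v $ i))"
    unfolding q_def by (simp add: sum_distrib_left[symmetric] row)
  also have "\<dots> = (\<Sum>i<n. a * complex_of_real ((cmod (v $ i))\<^sup>2))"
    by (intro sum.cong refl) (simp add: complex_norm_square mult_ac del: of_real_power)
  also have "\<dots> = a * complex_of_real s"
    by (simp add: s_def sum_distrib_left)
  finally have q: "q = a * complex_of_real s" .
  have "cnj q = (\<Sum>i<n. \<Sum>j<n. v $ i * (X $$ (i, j) * cnj (v $ j)))"
    by (simp add: q_def)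
  also have "\<dots> = (\<Sum>j<n. \<Sum>i<n. v $ i * (X $$ (i, j) * cnj (v $ j)))"
    by (rule sum.swap)
  also have "\<dots> = q"
    unfolding q_def by (intro sum.cong refl) (simp add: sym mult_ac)
  finally have "cnj q = q" .
  then have "cnj a * complex_of_real s = a * complex_of_real s" by (simp add: q)
  moreover have "s \<noteq> 0"
  proof
    assume "s = 0"
    then have "\<forall>i<n. v $ i = 0" by (simp add: s_def sum_nonneg_eq_0_iff)
    then have "v = 0\<^sub>v n" using v(1) by (intro eq_vecI) auto
    then show False using v(2) by simp
  qed
  ultimately have "cnj a = a" by simp
  then show ?thesis by (simp add: Reals_cnj_iff)
qed

text \<open>Connects two descriptions of the spectrum: the roots counted by
  \<open>spectral_measure\<close> and the traces of powers. The complex characteristic polynomial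
  splits with real roots, and the factorisation descends because the embedding of the reals is
  injective on coefficients.\<close>

lemma symmetric_spectrum:
  fixes X :: "real mat"
  assumes X: "X \<in> carrier_mat n n" and sym: "\<And>i j. i < n \<Longrightarrow> j < n \<Longrightarrow> X $$ (i, j) = X $$ (j, i)"
  obtains bs where "length bs = n" "proots (char_poly X) = mset bs"
    "\<And>k. (\<Sum>i<n. (complex_mat X ^\<^sub>m k) $$ (i, i)) = complex_of_real (\<Sum>b\<leftarrow>bs. b ^ k)"
proof -
  have C: "complex_mat X \<in> carrier_mat n n" using X by simp
  obtain as where as: "char_poly (complex_mat X) = (\<Prod>a\<leftarrow>as. [:- a, 1:])" "length as = n"
    using char_poly_factorized[OF C] by blast
  have "a \<in> \<real>" if "a \<in> set as" for a
  proof -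
    have "poly (char_poly (complex_mat X)) a = 0"
      using that unfolding as(1) by (auto simp: poly_prod_list prod_list_zero_iff)
    then show ?thesis
      using symmetric_eigenvalue_real[OF X sym] eigenvalue_root_char_poly[OF C] by blast
  qed
  define bs where "bs = map Re as"
  have as_bs: "as = map complex_of_real bs"
    unfolding bs_def map_map
    by (rule map_idI[symmetric]) (simp add: \<open>\<And>a. a \<in> set as \<Longrightarrow> a \<in> \<real>\<close>)
  interpret of_real_poly: map_poly_comm_ring_hom complex_of_real ..
  have "map_poly complex_of_real (\<Prod>b\<leftarrow>bs. [:- b, 1:]) = (\<Prod>b\<leftarrow>bs. [:- complex_of_real b, 1:])" for bs
    by (induction bs) (simp_all add: of_real_poly.hom_mult map_poly_pCons del: mult_pCons_left)
  then have "map_poly complex_of_real (char_poly X) = map_poly complex_of_real (\<Prod>b\<leftarrow>bs. [:- b, 1:])"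
    using as(1) by (simp add: of_real_hom.char_poly_hom[OF X] as_bs o_def)
  then have "char_poly X = (\<Prod>b\<leftarrow>bs. [:- b, 1:])"
  proof (intro poly_eqI)
    fix i
    assume "map_poly complex_of_real (char_poly X) = map_poly complex_of_real (\<Prod>b\<leftarrow>bs. [:- b, 1:])"
    from arg_cong[OF this, of "\<lambda>p. coeff p i"]
    show "coeff (char_poly X) i = coeff (\<Prod>b\<leftarrow>bs. [:- b, 1:]) i"
      by (simp only: coeff_map_poly of_real_0 of_real_eq_iff)
  qed
  moreover have "proots (\<Prod>b\<leftarrow>bs. [:- b, 1:]) = mset bs" for bs :: "real list"
  proof (induction bs)
    case (Cons b bs)
    have "(\<Prod>b\<leftarrow>bs. [:- b, 1:]) \<noteq> 0" by (auto simp: prod_list_zero_iff)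
    then show ?case using Cons by (simp add: proots_mult del: mult_pCons_left)
  qed simp
  ultimately have "proots (char_poly X) = mset bs" by simp
  moreover have "(\<Sum>i<n. (complex_mat X ^\<^sub>m k) $$ (i, i)) = complex_of_real (\<Sum>b\<leftarrow>bs. b ^ k)" for k
  proof -
    have "(\<Sum>b\<leftarrow>bs. complex_of_real b ^ k) = complex_of_real (\<Sum>b\<leftarrow>bs. b ^ k)" for bs
      by (induction bs) auto
    then show ?thesis
      unfolding trace_pow_eq_sum_eigenvalues[OF C as(1)] by (simp add: as_bs o_def)
  qed
  moreover have "length bs = n" using as(2) by (simp add: bs_def)
  ultimately show thesis using that[of bs] by blast
qed

lemma sum_list_count:
  fixes f :: "'a \<Rightarrow> real"
  assumes "finite S" "set xs \<subseteq> S"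
  shows "(\<Sum>x\<leftarrow>xs. f x) = (\<Sum>t\<in>S. real (count_list xs t) * f t)"
  using assms(2)
proof (induction xs)
  case (Cons y xs)
  have "(\<Sum>t\<in>S. real (count_list (y # xs) t) * f t) =
      (\<Sum>t\<in>S. (if t = y then f t else 0) + real (count_list xs t) * f t)"
    by (intro sum.cong) (auto simp: algebra_simps)
  also have "\<dots> = f y + (\<Sum>t\<in>S. real (count_list xs t) * f t)"
    using Cons.prems assms(1) by (simp add: sum.distrib)
  finally show ?case using Cons by simp
qed simp

lemma integral_spectral_measure:
  fixes f :: "real \<Rightarrow> real"
  assumes "proots (char_poly X) = mset bs" "bs \<noteq> []" "f \<in> borel_measurable borel"
  shows "(LINT y|spectral_measure X. f y) = (\<Sum>b\<leftarrow>bs. f b) / length bs"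
proof -
  have "(LINT y|spectral_measure X. f y) = measure_pmf.expectation (pmf_of_multiset (mset bs)) f"
    unfolding spectral_measure_def assms(1) using assms(3) by (subst integral_distr) auto
  also have "\<dots> = (\<Sum>b\<in>set bs. pmf (pmf_of_multiset (mset bs)) b * f b)"
    using assms(2) by (subst integral_measure_pmf[of "set bs"]) auto
  also have "\<dots> = (\<Sum>b\<in>set bs. count_list bs b * f b) / length bs"
    using assms(2) by (simp add: sum_divide_distrib count_mset)
  also have "\<dots> = (\<Sum>b\<leftarrow>bs. f b) / length bs"
    using sum_list_count[of "set bs" bs f] by simp
  finally show ?thesis .
qed

lemma real_distribution_spectral_measure: "real_distribution (spectral_measure X)"
  unfolding spectral_measure_def by (intro prob_space.real_distribution_distr measure_pmf.prob_space_axioms) auto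

section \<open>Convergence of all moments to a constant\<close>

context prob_space
begin

text \<open>Convergence to a constant in every L^p. Exponents start at 1, as the exponent 0 would
  give the integral 1.\<close>

definition moment_conv :: "(nat \<Rightarrow> 'a \<Rightarrow> complex) \<Rightarrow> complex \<Rightarrow> bool" where
  "moment_conv Y c \<longleftrightarrow> (\<forall>n. finite_moments M (Y n)) \<and>
     (\<forall>p. (\<lambda>n. LINT \<omega>|M. norm (Y n \<omega> - c) ^ Suc p) \<longlonglongrightarrow> 0)"

lemma finite_moments_diff_const: "finite_moments M f \<Longrightarrow> finite_moments M (\<lambda>\<omega>. f \<omega> - c)"
  using finite_moments_add[of f "\<lambda>_. - c"] by simp

lemma moment_conv_const: "moment_conv (\<lambda>_ _. c) c"
  by (simp add: moment_conv_def)

text \<open>Expand \<open>Y Z - c d\<close> as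
  \<open>(Y - c) (Z - d) + (Y - c) d + c (Z - d)\<close>. Estimating the first term doubles the
  exponent, which is why all exponents are controlled at once.\<close>

lemma moment_conv_mult:
  assumes Y: "moment_conv Y c" and Z: "moment_conv Z d"
  shows "moment_conv (\<lambda>n \<omega>. Y n \<omega> * Z n \<omega>) (c * d)"
  unfolding moment_conv_def
proof (intro conjI allI)
  have fm: "finite_moments M (Y n)" "finite_moments M (Z n)" for n
    using Y Z by (auto simp: moment_conv_def)
  show "finite_moments M (\<lambda>\<omega>. Y n \<omega> * Z n \<omega>)" for n
    by (intro finite_moments_mult fm)
  fix p
  let ?q = "Suc p"
  let ?a = "\<lambda>q n \<omega>. norm (Y n \<omega> - c) ^ q" and ?b = "\<lambda>q n \<omega>. norm (Z n \<omega> - d) ^ q"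
  let ?R = "\<lambda>n \<omega>. 2 ^ ?q * (?a (2 * ?q) n \<omega> + ?b (2 * ?q) n \<omega> +
       2 ^ ?q * (?a ?q n \<omega> * norm d ^ ?q + norm c ^ ?q * ?b ?q n \<omega>))"
  have int: "integrable M (?a q n)" "integrable M (?b q n)" for q n
    by (intro finite_moments_integrable_norm finite_moments_diff_const fm)+
  have lim: "(\<lambda>n. LINT \<omega>|M. ?a (Suc q) n \<omega>) \<longlonglongrightarrow> 0" "(\<lambda>n. LINT \<omega>|M. ?b (Suc q) n \<omega>) \<longlonglongrightarrow> 0" for q
    using Y Z unfolding moment_conv_def by blast+
  have R: "(LINT \<omega>|M. ?R n \<omega>) = 2 ^ ?q * ((LINT \<omega>|M. ?a (2 * ?q) n \<omega>) + (LINT \<omega>|M. ?b (2 * ?q) n \<omega>) +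
       2 ^ ?q * ((LINT \<omega>|M. ?a ?q n \<omega>) * norm d ^ ?q + norm c ^ ?q * (LINT \<omega>|M. ?b ?q n \<omega>)))" for n
  proof -
    have "(LINT \<omega>|M. \<alpha> * (f \<omega> + g \<omega> + \<beta> * (h \<omega> * \<gamma> + \<delta> * k \<omega>))) =
        \<alpha> * ((LINT \<omega>|M. f \<omega>) + (LINT \<omega>|M. g \<omega>) + \<beta> * ((LINT \<omega>|M. h \<omega>) * \<gamma> + \<delta> * (LINT \<omega>|M. k \<omega>)))"
      if "integrable M f" "integrable M g" "integrable M h" "integrable M k"
      for \<alpha> \<beta> \<gamma> \<delta> :: real and f g h k :: "'a \<Rightarrow> real"
      using that by simp
    from this[OF int int] show ?thesis .
  qed
  have le: "norm (Y n \<omega> * Z n \<omega> - c * d) ^ ?q \<le> ?R n \<omega>" for n \<omega>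
  proof -
    let ?u = "Y n \<omega> - c" and ?v = "Z n \<omega> - d"
    have "Y n \<omega> * Z n \<omega> - c * d = ?u * ?v + (?u * d + c * ?v)"
      by (simp add: algebra_simps)
    then have "norm (Y n \<omega> * Z n \<omega> - c * d) ^ ?q \<le>
        2 ^ ?q * (norm (?u * ?v) ^ ?q + norm (?u * d + c * ?v) ^ ?q)"
      by (simp only: norm_add_power_le)
    also have "\<dots> \<le> 2 ^ ?q * ((norm ?u ^ (2 * ?q) + norm ?v ^ (2 * ?q)) +
        2 ^ ?q * (norm (?u * d) ^ ?q + norm (c * ?v) ^ ?q))"
      by (intro mult_left_mono add_mono norm_mult_power_le norm_add_power_le) simp
    finally show ?thesis by (simp only: norm_mult power_mult_distrib)
  qed
  \<comment> \<open>The exponent \<open>2 * Suc p\<close> is written as a successor to match the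
    positive exponents in \<open>moment_conv\<close>.\<close>
  have "(\<lambda>n. 2 ^ ?q * ((LINT \<omega>|M. ?a (Suc (2 * p + 1)) n \<omega>) + (LINT \<omega>|M. ?b (Suc (2 * p + 1)) n \<omega>) +
       2 ^ ?q * ((LINT \<omega>|M. ?a ?q n \<omega>) * norm d ^ ?q + norm c ^ ?q * (LINT \<omega>|M. ?b ?q n \<omega>))))
     \<longlonglongrightarrow> 2 ^ ?q * (0 + 0 + 2 ^ ?q * (0 * norm d ^ ?q + norm c ^ ?q * 0))"
    by (intro tendsto_intros lim)
  then have Rlim: "(\<lambda>n. LINT \<omega>|M. ?R n \<omega>) \<longlonglongrightarrow> 0"
    unfolding R by simp
  show "(\<lambda>n. LINT \<omega>|M. norm (Y n \<omega> * Z n \<omega> - c * d) ^ ?q) \<longlonglongrightarrow> 0"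
  proof (rule tendsto_sandwich[OF _ _ tendsto_const Rlim])
    show "\<forall>\<^sub>F n in sequentially. 0 \<le> (LINT \<omega>|M. norm (Y n \<omega> * Z n \<omega> - c * d) ^ ?q)"
      by (intro always_eventually allI integral_nonneg_AE AE_I2) simp
    show "\<forall>\<^sub>F n in sequentially. (LINT \<omega>|M. norm (Y n \<omega> * Z n \<omega> - c * d) ^ ?q) \<le> (LINT \<omega>|M. ?R n \<omega>)"
    proof (intro always_eventually allI integral_mono le)
      show "integrable M (\<lambda>\<omega>. norm (Y n \<omega> * Z n \<omega> - c * d) ^ ?q)" for n
        by (intro finite_moments_integrable_norm finite_moments_diff_const finite_moments_mult fm)
      show "integrable M (?R n)" for n
        by (intro integrable_mult_right integrable_mult_left Bochner_Integration.integrable_add int)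
    qed
  qed
qed

lemma moment_conv_prod_list:
  assumes "\<And>x. x \<in> set xs \<Longrightarrow> moment_conv (Y x) (c x)"
  shows "moment_conv (\<lambda>n \<omega>. \<Prod>x\<leftarrow>xs. Y x n \<omega>) (\<Prod>x\<leftarrow>xs. c x)"
  using assms by (induction xs) (auto intro: moment_conv_mult moment_conv_const)

lemma moment_conv_integral:
  assumes "moment_conv Y c"
  shows "(\<lambda>n. LINT \<omega>|M. Y n \<omega>) \<longlonglongrightarrow> c"
proof (rule Lim_null[THEN iffD2], rule Lim_null_comparison)
  show "(\<lambda>n. LINT \<omega>|M. norm (Y n \<omega> - c) ^ Suc 0) \<longlonglongrightarrow> 0"
    using assms unfolding moment_conv_def by blast
  have fm: "finite_moments M (Y n)" for n using assms by (auto simp: moment_conv_def)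
  have "(LINT \<omega>|M. Y n \<omega>) - c = (LINT \<omega>|M. Y n \<omega> - c)" for n
    using finite_moments_integrable[OF fm[of n]] by (simp add: prob_space)
  then show "\<forall>\<^sub>F n in sequentially. norm ((LINT \<omega>|M. Y n \<omega>) - c) \<le> (LINT \<omega>|M. norm (Y n \<omega> - c) ^ Suc 0)"
    by (simp add: integral_norm_bound)
qed

text \<open>An exchange of limits: \<open>Z r\<close> approximates \<open>Y\<close> uniformly in
  \<open>n\<close>. The limits \<open>c r\<close> form a Cauchy sequence because
  \<open>Z r n\<close> and \<open>Z s n\<close> are both close to the same \<open>Y n\<close>, and
  the limit of this sequence is the constant for \<open>Y\<close>.\<close>

lemma moment_conv_approx:
  assumes Y: "\<And>n. finite_moments M (Y n)"
    and Z: "\<And>r. moment_conv (Z r) (c r)"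
    and YZ: "\<And>p. \<exists>K. \<forall>r n. (LINT \<omega>|M. norm (Y n \<omega> - Z r n \<omega>) ^ Suc p) \<le> K * inverse (Suc r)"
  shows "\<exists>m. moment_conv Y m"
proof -
  have fmZ: "finite_moments M (Z r n)" for r n using Z by (auto simp: moment_conv_def)
  have fmYZ: "finite_moments M (\<lambda>\<omega>. Y n \<omega> - Z r n \<omega>)" for r n
    using finite_moments_add[OF Y finite_moments_mult[OF finite_moments_const fmZ], of n "-1" r n] by simp
  have limZ: "(\<lambda>n. LINT \<omega>|M. norm (Z r n \<omega> - c r) ^ Suc p) \<longlonglongrightarrow> 0" for r p
    using Z unfolding moment_conv_def by blast
  obtain K where K: "\<And>r n. (LINT \<omega>|M. norm (Y n \<omega> - Z r n \<omega>) ^ Suc 0) \<le> K * inverse (Suc r)"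
    using YZ[of 0] by blast
  have cauchy: "norm (c r - c s) \<le> K * inverse (Suc r) + K * inverse (Suc s)" for r s
  proof -
    have "norm (c r - c s) \<le> (LINT \<omega>|M. norm (Z r n \<omega> - c r) ^ Suc 0) + K * inverse (Suc r) +
        (K * inverse (Suc s) + (LINT \<omega>|M. norm (Z s n \<omega> - c s) ^ Suc 0))" for n
    proof -
      have i: "integrable M (\<lambda>\<omega>. norm (Z r n \<omega> - c r))" "integrable M (\<lambda>\<omega>. norm (Y n \<omega> - Z r n \<omega>))" for r
        using finite_moments_integrable_norm[OF finite_moments_diff_const[OF fmZ], of r n "c r" 1]
          finite_moments_integrable_norm[OF fmYZ, of n r 1] by simp_all
      have "norm (c r - c s) = (LINT \<omega>|M. norm (c r - c s))" by (simp add: prob_space)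
      also have "\<dots> \<le> (LINT \<omega>|M. norm (Z r n \<omega> - c r) + norm (Y n \<omega> - Z r n \<omega>) +
          (norm (Y n \<omega> - Z s n \<omega>) + norm (Z s n \<omega> - c s)))"
      proof (rule integral_mono)
        fix \<omega>
        have "c r - c s = - (Z r n \<omega> - c r) - (Y n \<omega> - Z r n \<omega>) + ((Y n \<omega> - Z s n \<omega>) + (Z s n \<omega> - c s))"
          by simp
        also have "norm \<dots> \<le> norm (Z r n \<omega> - c r) + norm (Y n \<omega> - Z r n \<omega>) +
          (norm (Y n \<omega> - Z s n \<omega>) + norm (Z s n \<omega> - c s))"
          using norm_triangle_ineq[of "- (Z r n \<omega> - c r) - (Y n \<omega> - Z r n \<omega>)" "(Y n \<omega> - Z s n \<omega>) + (Z s n \<omega> - c s)"]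
            norm_triangle_ineq4[of "- (Z r n \<omega> - c r)" "Y n \<omega> - Z r n \<omega>"]
            norm_triangle_ineq[of "Y n \<omega> - Z s n \<omega>" "Z s n \<omega> - c s"]
          unfolding norm_minus_cancel by linarith
        finally show "norm (c r - c s) \<le> norm (Z r n \<omega> - c r) + norm (Y n \<omega> - Z r n \<omega>) +
          (norm (Y n \<omega> - Z s n \<omega>) + norm (Z s n \<omega> - c s))" .
      qed (use i in auto)
      also have "\<dots> = (LINT \<omega>|M. norm (Z r n \<omega> - c r)) + (LINT \<omega>|M. norm (Y n \<omega> - Z r n \<omega>)) +
          ((LINT \<omega>|M. norm (Y n \<omega> - Z s n \<omega>)) + (LINT \<omega>|M. norm (Z s n \<omega> - c s)))"
        using i by simp
      finally show ?thesis using K[of n r] K[of n s] by simp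
    qed
    note le = this
    \<comment> \<open>The quantity to be bounded does not depend on \<open>n\<close>, so the two
      errors that do may be sent to zero.\<close>
    have "(\<lambda>n. (LINT \<omega>|M. norm (Z r n \<omega> - c r) ^ Suc 0) + K * inverse (Suc r) +
        (K * inverse (Suc s) + (LINT \<omega>|M. norm (Z s n \<omega> - c s) ^ Suc 0)))
        \<longlonglongrightarrow> 0 + K * inverse (Suc r) + (K * inverse (Suc s) + 0)"
      by (intro tendsto_intros limZ)
    from LIMSEQ_le_const[OF this] le show ?thesis by auto
  qed
  have K0: "(\<lambda>r. k * inverse (real (Suc r))) \<longlonglongrightarrow> 0" for k
    using tendsto_mult_left[OF LIMSEQ_inverse_real_of_nat, of k] by simp
  have "Cauchy c"
  proof (rule metric_CauchyI)
    fix e :: real assume "e > 0"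
    then have "\<forall>\<^sub>F r in sequentially. K * inverse (real (Suc r)) < e / 2"
      by (intro order_tendstoD(2)[OF K0]) simp
    then obtain N where N: "\<And>r. r \<ge> N \<Longrightarrow> K * inverse (real (Suc r)) < e / 2"
      by (auto simp: eventually_sequentially)
    have "dist (c r) (c s) < e" if "r \<ge> N" "s \<ge> N" for r s
      using cauchy[of r s] N[OF that(1)] N[OF that(2)] by (simp only: dist_norm)
    then show "\<exists>N. \<forall>r\<ge>N. \<forall>s\<ge>N. dist (c r) (c s) < e" by blast
  qed
  then obtain m where m: "c \<longlonglongrightarrow> m" using Cauchy_convergent convergent_def by blast
  have "(\<lambda>n. LINT \<omega>|M. norm (Y n \<omega> - m) ^ Suc p) \<longlonglongrightarrow> 0" for p
  proof -
    let ?q = "Suc p"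
    obtain K' where K': "\<And>r n. (LINT \<omega>|M. norm (Y n \<omega> - Z r n \<omega>) ^ ?q) \<le> K' * inverse (Suc r)"
      using YZ[of p] by blast
    have "(\<lambda>r. 2 ^ ?q * (K' * inverse (real (Suc r)) + 2 ^ ?q * norm (c r - m) ^ ?q))
       \<longlonglongrightarrow> 2 ^ ?q * (0 + 2 ^ ?q * norm (m - m) ^ ?q)"
      by (intro tendsto_intros K0 m)
    then have small: "(\<lambda>r. 2 ^ ?q * (K' * inverse (real (Suc r)) + 2 ^ ?q * norm (c r - m) ^ ?q)) \<longlonglongrightarrow> 0"
      by simp
    have le: "(LINT \<omega>|M. norm (Y n \<omega> - m) ^ ?q) \<le>
       2 ^ ?q * (K' * inverse (Suc r) + 2 ^ ?q * norm (c r - m) ^ ?q) +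
       2 ^ ?q * (2 ^ ?q * (LINT \<omega>|M. norm (Z r n \<omega> - c r) ^ ?q))" for n r
    proof -
      note i = finite_moments_integrable_norm[OF finite_moments_diff_const[OF fmZ], of r n "c r" ?q]
        finite_moments_integrable_norm[OF fmYZ, of n r ?q]
      have "(LINT \<omega>|M. norm (Y n \<omega> - m) ^ ?q) \<le> (LINT \<omega>|M. 2 ^ ?q * (norm (Y n \<omega> - Z r n \<omega>) ^ ?q +
          2 ^ ?q * (norm (Z r n \<omega> - c r) ^ ?q + norm (c r - m) ^ ?q)))"
      proof (rule integral_mono)
        show "integrable M (\<lambda>\<omega>. norm (Y n \<omega> - m) ^ ?q)"
          by (intro finite_moments_integrable_norm finite_moments_diff_const Y)
        show "integrable M (\<lambda>\<omega>. 2 ^ ?q * (norm (Y n \<omega> - Z r n \<omega>) ^ ?q +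
          2 ^ ?q * (norm (Z r n \<omega> - c r) ^ ?q + norm (c r - m) ^ ?q)))"
          by (intro integrable_mult_right Bochner_Integration.integrable_add i integrable_const)
        fix \<omega>
        have "norm (Y n \<omega> - m) ^ ?q = norm ((Y n \<omega> - Z r n \<omega>) + ((Z r n \<omega> - c r) + (c r - m))) ^ ?q"
          by simp
        also have "\<dots> \<le> 2 ^ ?q * (norm (Y n \<omega> - Z r n \<omega>) ^ ?q + norm ((Z r n \<omega> - c r) + (c r - m)) ^ ?q)"
          by (rule norm_add_power_le)
        also have "\<dots> \<le> 2 ^ ?q * (norm (Y n \<omega> - Z r n \<omega>) ^ ?q +
          2 ^ ?q * (norm (Z r n \<omega> - c r) ^ ?q + norm (c r - m) ^ ?q))"
          by (intro mult_left_mono add_left_mono norm_add_power_le) simp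
        finally show "norm (Y n \<omega> - m) ^ ?q \<le> 2 ^ ?q * (norm (Y n \<omega> - Z r n \<omega>) ^ ?q +
          2 ^ ?q * (norm (Z r n \<omega> - c r) ^ ?q + norm (c r - m) ^ ?q))" .
      qed
      also have "\<dots> = 2 ^ ?q * ((LINT \<omega>|M. norm (Y n \<omega> - Z r n \<omega>) ^ ?q) +
          2 ^ ?q * ((LINT \<omega>|M. norm (Z r n \<omega> - c r) ^ ?q) + norm (c r - m) ^ ?q))"
        using i by (simp add: prob_space del: power_Suc)
      also have "\<dots> \<le> 2 ^ ?q * (K' * inverse (Suc r) +
          2 ^ ?q * ((LINT \<omega>|M. norm (Z r n \<omega> - c r) ^ ?q) + norm (c r - m) ^ ?q))"
        by (intro mult_left_mono add_right_mono K') simp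
      finally show ?thesis by (simp only: distrib_left add_ac)
    qed
    show ?thesis
    proof (rule LIMSEQ_I)
      \<comment> \<open>First \<open>r\<close> is fixed by the uniform approximation, then
        \<open>n\<close> by the convergence of \<open>Z r\<close>.\<close>
      fix e :: real assume e: "e > 0"
      then have "\<forall>\<^sub>F r in sequentially. 2 ^ ?q * (K' * inverse (real (Suc r)) + 2 ^ ?q * norm (c r - m) ^ ?q) < e / 2"
        by (intro order_tendstoD(2)[OF small]) simp
      then obtain r where r: "2 ^ ?q * (K' * inverse (real (Suc r)) + 2 ^ ?q * norm (c r - m) ^ ?q) < e / 2"
        unfolding eventually_sequentially by blast
      have lim: "(\<lambda>n. 2 ^ ?q * (2 ^ ?q * (LINT \<omega>|M. norm (Z r n \<omega> - c r) ^ ?q))) \<longlonglongrightarrow> 2 ^ ?q * (2 ^ ?q * 0)"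
        by (intro tendsto_intros limZ)
      have "\<forall>\<^sub>F n in sequentially. 2 ^ ?q * (2 ^ ?q * (LINT \<omega>|M. norm (Z r n \<omega> - c r) ^ ?q)) < e / 2"
        using e by (intro order_tendstoD(2)[OF lim]) simp
      then obtain N where N: "\<And>n. n \<ge> N \<Longrightarrow> 2 ^ ?q * (2 ^ ?q * (LINT \<omega>|M. norm (Z r n \<omega> - c r) ^ ?q)) < e / 2"
        unfolding eventually_sequentially by blast
      have "norm ((LINT \<omega>|M. norm (Y n \<omega> - m) ^ ?q) - 0) < e" if "n \<ge> N" for n
      proof -
        have "0 \<le> (LINT \<omega>|M. norm (Y n \<omega> - m) ^ ?q)" by (intro integral_nonneg_AE AE_I2) simp
        moreover have "(LINT \<omega>|M. norm (Y n \<omega> - m) ^ ?q) < e"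
          using le[of n r] r N[OF that] by linarith
        ultimately show ?thesis by (simp only: real_norm_def diff_0_right abs_of_nonneg)
      qed
      then show "\<exists>N. \<forall>n\<ge>N. norm ((LINT \<omega>|M. norm (Y n \<omega> - m) ^ ?q) - 0) < e" by blast
    qed
  qed
  then show ?thesis using Y unfolding moment_conv_def by blast
qed

end

section \<open>Trace moments under a limiting spectral distribution\<close>

lemma jensen_power_average:
  fixes a :: "'a \<Rightarrow> real"
  assumes "\<And>b. b \<in> set bs \<Longrightarrow> 0 \<le> a b"
  shows "((\<Sum>b\<leftarrow>bs. a b) / length bs) ^ Suc p \<le> (\<Sum>b\<leftarrow>bs. a b ^ Suc p) / length bs"
proof (cases "bs = []")
  case False
  have conv: "convex_on {0::real..} (\<lambda>x. x ^ Suc p)"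
  proof (cases "even (Suc p)")
    case True
    then show ?thesis using convex_power_even convex_on_subset by blast
  next
    case False
    then show ?thesis by (rule convex_power_odd)
  qed
  have "(\<Sum>i<length bs. (1 / length bs) *\<^sub>R a (bs ! i)) ^ Suc p \<le>
      (\<Sum>i<length bs. (1 / length bs) * a (bs ! i) ^ Suc p)"
    by (rule convex_on_sum[OF _ _ conv]) (use False assms in \<open>auto simp: nth_mem\<close>)
  moreover have idx: "(\<Sum>i<length bs. (1 / length bs) * f (bs ! i)) = (\<Sum>b\<leftarrow>bs. f b) / length bs" for f :: "'a \<Rightarrow> real"
    by (simp add: sum_list_sum_nth atLeast0LessThan sum_divide_distrib)
  ultimately show ?thesis
    using idx[of a] idx[of "\<lambda>b. a b ^ Suc p"] by (simp only: real_scaleR_def)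
qed simp

lemma abs_power_le_even: "\<bar>b\<bar> ^ m \<le> 1 + (b::real) ^ (2 * m)"
proof -
  have "0 \<le> \<bar>b\<bar> ^ m" by simp
  then have "\<bar>b\<bar> ^ m \<le> 1 + (\<bar>b\<bar> ^ m)\<^sup>2"
    using sum_squares_bound[of "\<bar>b\<bar> ^ m" 1] unfolding power_one mult_1_right by linarith
  then show ?thesis by (simp add: power_mult[symmetric] mult.commute power_even_abs)
qed

text \<open>Admissible as a test function in weak convergence, and within
  \<open>|y|^(k + 2) / (r + 1)\<close> of the plain power. The Gaussian factor is chosen over a
  cut-off because it makes the function a power series in \<open>y\<close>.\<close>

definition damped_power :: "nat \<Rightarrow> nat \<Rightarrow> real \<Rightarrow> real" where
  "damped_power r k y = y ^ k * exp (- (y\<^sup>2 * inverse (Suc r)))"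

lemma damped_power_sums:
  "(\<lambda>j. (- inverse (Suc r)) ^ j / fact j * y ^ (k + 2 * j)) sums damped_power r k y"
proof -
  have exp: "(\<lambda>j. (- (y\<^sup>2 * inverse (Suc r))) ^ j /\<^sub>R fact j) sums exp (- (y\<^sup>2 * inverse (Suc r)))"
    by (rule exp_converges)
  have "y ^ k * ((- (y\<^sup>2 * i)) ^ j /\<^sub>R fact j) = (- i) ^ j / fact j * y ^ (k + 2 * j)" for i j
  proof -
    have "- (y\<^sup>2 * i) = (- i) * y\<^sup>2" by simp
    then show ?thesis
      unfolding power_add power_mult
      by (simp only: power_mult_distrib real_scaleR_def divide_inverse mult_ac)
  qed
  from sums_mult[OF exp, of "y ^ k"] this show ?thesis
    unfolding damped_power_def by (simp only:)
qed

lemma damped_power_diff: "\<bar>y ^ k - damped_power r k y\<bar> \<le> inverse (Suc r) * \<bar>y\<bar> ^ (k + 2)"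
proof -
  let ?s = "y\<^sup>2 * inverse (real (Suc r))"
  have "0 \<le> ?s" by simp
  then have "0 \<le> 1 - exp (- ?s)" "1 - exp (- ?s) \<le> ?s"
    using exp_ge_add_one_self[of "- ?s"] by (simp_all add: exp_le_one_iff)
  then have "\<bar>y\<bar> ^ k * \<bar>1 - exp (- ?s)\<bar> \<le> \<bar>y\<bar> ^ k * ?s"
    by (intro mult_left_mono) auto
  moreover have "y ^ k - damped_power r k y = y ^ k * (1 - exp (- ?s))"
    by (simp add: damped_power_def right_diff_distrib)
  then have "\<bar>y ^ k - damped_power r k y\<bar> = \<bar>y\<bar> ^ k * \<bar>1 - exp (- ?s)\<bar>"
    by (simp only: abs_mult power_abs)
  moreover have "\<bar>y\<bar> ^ (k + 2) = \<bar>y\<bar> ^ k * y\<^sup>2"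
    by (simp only: power_add power2_abs)
  ultimately show ?thesis by (simp only: mult_ac)
qed

text \<open>Put \<open>s = y^2 / (r + 1)\<close>. A single term of the exponential series gives
  \<open>s^k exp (- s) \<le> k!\<close>, hence a bound for even powers, and
  \<open>|y|^k \<le> 1 + y^(2 k)\<close> reduces the claim to these.\<close>

lemma damped_power_bounded: "\<exists>B. \<forall>y. \<bar>damped_power r k y\<bar> \<le> B"
proof (intro exI allI)
  fix y :: real
  let ?s = "y\<^sup>2 * inverse (real (Suc r))"
  have s: "0 \<le> ?s" by simp
  have pow_le_exp: "x ^ k / fact k \<le> exp x" if "0 \<le> x" for x :: real
  proof -
    have "(\<Sum>j\<in>{k}. x ^ j /\<^sub>R fact j) \<le> suminf (\<lambda>j. x ^ j /\<^sub>R fact j)"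
      using that by (intro sum_le_suminf summable_exp_generic) auto
    then show ?thesis by (simp add: exp_def divide_inverse_commute)
  qed
  have "?s ^ k * exp (- ?s) \<le> fact k"
    using pow_le_exp[OF s] by (simp add: exp_minus field_simps)
  moreover have "y ^ (2 * k) = real (Suc r) ^ k * ?s ^ k"
  proof -
    have "real (Suc r) * ?s = y\<^sup>2" by (simp add: field_simps)
    then show ?thesis by (simp only: power_mult power_mult_distrib[symmetric])
  qed
  ultimately have "y ^ (2 * k) * exp (- ?s) \<le> real (Suc r) ^ k * fact k"
    unfolding mult.assoc by (simp only: mult.assoc mult_left_mono zero_le_power of_nat_0_le_iff)
  moreover have "\<bar>damped_power r k y\<bar> \<le> (1 + y ^ (2 * k)) * exp (- ?s)"
    unfolding damped_power_def abs_mult power_abs abs_exp_cancel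
    by (intro mult_right_mono abs_power_le_even) simp
  moreover have "exp (- ?s) \<le> 1" using s by simp
  ultimately show "\<bar>damped_power r k y\<bar> \<le> 1 + real (Suc r) ^ k * fact k"
    unfolding distrib_right mult_1_left by linarith
qed

lemma isCont_damped_power: "isCont (damped_power r k) y"
  unfolding damped_power_def[abs_def] by (intro continuous_intros)

lemma pow_mat_Suc_left:
  assumes "A \<in> carrier_mat n n"
  shows "A ^\<^sub>m Suc k = A * A ^\<^sub>m k"
proof (induction k)
  case (Suc k)
  have "A ^\<^sub>m Suc (Suc k) = (A * A ^\<^sub>m k) * A" using Suc by simp
  also have "\<dots> = A * A ^\<^sub>m Suc k"
    using assms by (simp add: assoc_mult_mat[OF assms pow_carrier_mat[OF assms] assms])
  finally show ?case .
qed (use assms in auto)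

section \<open>Spectral averages of the scaled patterned matrix\<close>

locale patterned_lsd = patterned M x L for M :: "'w measure" and x :: "'t \<Rightarrow> 'w \<Rightarrow> real" and L +
  fixes \<nu> :: "real measure"
  assumes symmetric: "symmetric_link L"
    and lsd: "is_LSD M (scaled_patterned_matrix L x) \<nu>"
begin

abbreviation "S n \<omega> \<equiv> scaled_patterned_matrix L x n \<omega>"

lemma S_carrier: "S n \<omega> \<in> carrier_mat n n"
  by (simp add: patterned_matrix_def)

lemma S_entry: "i < n \<Longrightarrow> j < n \<Longrightarrow> S n \<omega> $$ (i, j) = 1 / sqrt n * x (L n (Suc i, Suc j)) \<omega>"
  by (simp add: patterned_matrix_def)

lemma S_symmetric: "i < n \<Longrightarrow> j < n \<Longrightarrow> S n \<omega> $$ (i, j) = S n \<omega> $$ (j, i)"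
  using symmetric by (simp add: S_entry symmetric_link_def)

text \<open>Chosen for each \<open>\<omega>\<close> separately, with no control over the dependence
  on \<open>\<omega>\<close>; only symmetric averages of the list are treated as random
  variables.\<close>

definition spec :: "nat \<Rightarrow> 'w \<Rightarrow> real list" where
  "spec n \<omega> = (SOME bs. length bs = n \<and> proots (char_poly (S n \<omega>)) = mset bs \<and>
     (\<forall>k. (\<Sum>i<n. (complex_mat (S n \<omega>) ^\<^sub>m k) $$ (i, i)) = complex_of_real (\<Sum>b\<leftarrow>bs. b ^ k)))"

lemma spec:
  "length (spec n \<omega>) = n" "proots (char_poly (S n \<omega>)) = mset (spec n \<omega>)"
  "(\<Sum>i<n. (complex_mat (S n \<omega>) ^\<^sub>m k) $$ (i, i)) = complex_of_real (\<Sum>b\<leftarrow>spec n \<omega>. b ^ k)"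
proof -
  have "\<exists>bs. length bs = n \<and> proots (char_poly (S n \<omega>)) = mset bs \<and>
     (\<forall>k. (\<Sum>i<n. (complex_mat (S n \<omega>) ^\<^sub>m k) $$ (i, i)) = complex_of_real (\<Sum>b\<leftarrow>bs. b ^ k))"
    by (rule symmetric_spectrum[OF S_carrier S_symmetric]) blast+
  from someI_ex[OF this] show "length (spec n \<omega>) = n" "proots (char_poly (S n \<omega>)) = mset (spec n \<omega>)"
  "(\<Sum>i<n. (complex_mat (S n \<omega>) ^\<^sub>m k) $$ (i, i)) = complex_of_real (\<Sum>b\<leftarrow>spec n \<omega>. b ^ k)"
    unfolding spec_def by blast+
qed

definition avg :: "(real \<Rightarrow> real) \<Rightarrow> nat \<Rightarrow> 'w \<Rightarrow> real" where
  "avg f n \<omega> = (\<Sum>b\<leftarrow>spec n \<omega>. f b) / n"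

lemma S_pow_entry:
  "i < n \<Longrightarrow> j < n \<Longrightarrow> (complex_mat (S n \<omega>) ^\<^sub>m k) $$ (i, j) =
     complex_of_real ((1 / sqrt n) ^ k) * power_entry n k i j \<omega>"
proof (induction k arbitrary: i)
  case 0
  then show ?case using S_carrier[of n \<omega>] by auto
next
  case (Suc k)
  have C: "complex_mat (S n \<omega>) \<in> carrier_mat n n" using S_carrier by simp
  have "(complex_mat (S n \<omega>) ^\<^sub>m Suc k) $$ (i, j) =
     (\<Sum>l<n. complex_mat (S n \<omega>) $$ (i, l) * (complex_mat (S n \<omega>) ^\<^sub>m k) $$ (l, j))"
    unfolding pow_mat_Suc_left[OF C]
    using Suc.prems C pow_carrier_mat[OF C, of k]
    by (auto simp: scalar_prod_def lessThan_atLeast0 intro!: sum.cong simp del: index_map_mat)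
  also have "\<dots> = (\<Sum>l<n. complex_of_real ((1 / sqrt n) ^ Suc k) *
      (X (L n (Suc i, Suc l)) \<omega> * power_entry n k l j \<omega>))"
  proof (intro sum.cong refl)
    fix l assume "l \<in> {..<n}"
    moreover have "complex_mat (S n \<omega>) $$ (i, l) = complex_of_real (1 / sqrt n) * X (L n (Suc i, Suc l)) \<omega>"
      if "l < n"
      using S_carrier[of n \<omega>] Suc.prems that by (simp add: patterned_matrix_def)
    ultimately show "complex_mat (S n \<omega>) $$ (i, l) * (complex_mat (S n \<omega>) ^\<^sub>m k) $$ (l, j) =
      complex_of_real ((1 / sqrt n) ^ Suc k) * (X (L n (Suc i, Suc l)) \<omega> * power_entry n k l j \<omega>)"
      using Suc by (simp add: mult_ac)
  qed
  finally show ?case by (simp add: sum_distrib_left)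
qed

lemma avg_power:
  "complex_of_real (avg (\<lambda>y. y ^ k) n \<omega>) =
    1 / of_nat n * (complex_of_real ((1 / sqrt n) ^ k) * (\<Sum>i<n. power_entry n k i i \<omega>))"
proof -
  have "complex_of_real (avg (\<lambda>y. y ^ k) n \<omega>) = 1 / of_nat n * (\<Sum>i<n. (complex_mat (S n \<omega>) ^\<^sub>m k) $$ (i, i))"
    unfolding spec(3) avg_def by simp
  then show ?thesis by (simp add: S_pow_entry sum_distrib_left)
qed

lemma avg_power_moments: "finite_moments M (\<lambda>\<omega>. complex_of_real (avg (\<lambda>y. y ^ k) n \<omega>))"
  unfolding avg_power by (intro finite_moments_intros power_entry_moments)

lemma avg_power_measurable: "avg (\<lambda>y. y ^ k) n \<in> borel_measurable M"
proof -
  have "(\<lambda>\<omega>. Re (complex_of_real (avg (\<lambda>y. y ^ k) n \<omega>))) \<in> borel_measurable M"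
    using finite_moments_measurable[OF avg_power_moments[of k n]] by measurable
  then show ?thesis by simp
qed

lemma avg_power_integrable: "integrable M (avg (\<lambda>y. y ^ k) n)"
  using integrable_Re[OF finite_moments_integrable[OF avg_power_moments[of k n]]] by simp

text \<open>A diagonal entry is bounded by its whole row, that is, closed walks by all walks from
  \<open>i\<close>; the factor \<open>sqrt n ^ k\<close> from counting walks then cancels the
  scaling.\<close>

lemma avg_power_bound: "\<exists>K. \<forall>n. (LINT \<omega>|M. avg (\<lambda>y. y ^ k) n \<omega>) \<le> K"
proof -
  obtain K where K: "K \<ge> 0" "\<And>n ts i. length ts = 0 \<Longrightarrow> i < n \<Longrightarrow>
     (\<Sum>l<n. norm (LINT \<omega>|M. (\<Prod>t\<leftarrow>ts. X t \<omega>) * power_entry n k i l \<omega>)) \<le>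
     K * sqrt n ^ (k + 0) / real n ^ card (set ts)"
    using power_entry_bound[of 0 k] by blast
  have "(LINT \<omega>|M. avg (\<lambda>y. y ^ k) n \<omega>) \<le> K" for n
  proof (cases "n = 0")
    case False
    have le: "norm (LINT \<omega>|M. power_entry n k i i \<omega>) \<le> K * sqrt n ^ k" if "i < n" for i
    proof -
      have "norm (LINT \<omega>|M. power_entry n k i i \<omega>) \<le> (\<Sum>l<n. norm (LINT \<omega>|M. power_entry n k i l \<omega>))"
        by (rule member_le_sum) (use that in auto)
      also have "\<dots> \<le> K * sqrt n ^ k" using K(2)[of "[]" i n] that by simp
      finally show ?thesis .
    qed
    have "complex_of_real (LINT \<omega>|M. avg (\<lambda>y. y ^ k) n \<omega>) =
        1 / of_nat n * (complex_of_real ((1 / sqrt n) ^ k) * (\<Sum>i<n. (LINT \<omega>|M. power_entry n k i i \<omega>)))"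
      unfolding integral_complex_of_real[symmetric] avg_power
      by (simp add: Bochner_Integration.integral_sum finite_moments_integrable power_entry_moments)
    also have "norm \<dots> = 1 / n * ((1 / sqrt n) ^ k * norm (\<Sum>i<n. (LINT \<omega>|M. power_entry n k i i \<omega>)))"
      by (simp add: norm_mult norm_divide norm_power)
    also have "\<dots> \<le> 1 / n * ((1 / sqrt n) ^ k * (\<Sum>i<n. K * sqrt n ^ k))"
      by (intro mult_left_mono order_trans[OF norm_sum] sum_mono le) auto
    also have "\<dots> = K" using False by (simp add: power_divide)
    finally show ?thesis by simp
  qed (use K(1) in \<open>simp add: avg_def\<close>)
  then show ?thesis by blast
qed

text \<open>The average is a pointwise convergent series of averages of powers, each of them a
  normalised trace and hence measurable.\<close>

lemma avg_damped_measurable: "avg (damped_power r k) n \<in> borel_measurable M"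
proof -
  have "(\<lambda>j. (- inverse (Suc r)) ^ j / fact j * avg (\<lambda>y. y ^ (k + 2 * j)) n \<omega>) sums avg (damped_power r k) n \<omega>" for \<omega>
  proof -
    have "(\<lambda>j. (- inverse (Suc r)) ^ j / fact j * (\<Sum>b\<leftarrow>bs. b ^ (k + 2 * j))) sums (\<Sum>b\<leftarrow>bs. damped_power r k b)" for bs
    proof (induction bs)
      case (Cons b bs)
      from sums_add[OF damped_power_sums Cons] show ?case
        by (simp only: list.map sum_list.Cons distrib_left)
    qed simp
    from sums_divide[OF this[of "spec n \<omega>"], of n] show ?thesis by (simp add: avg_def)
  qed
  then have "avg (damped_power r k) n = (\<lambda>\<omega>. suminf (\<lambda>j. (- inverse (Suc r)) ^ j / fact j * avg (\<lambda>y. y ^ (k + 2 * j)) n \<omega>))"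
    by (intro ext) (simp add: sums_iff)
  then show ?thesis
    using avg_power_measurable by (auto intro!: borel_measurable_suminf borel_measurable_times)
qed

text \<open>Jensen's inequality brings the power inside the eigenvalue average. The absolute powers
  that result are dominated by even ones, so that the bound is again a normalised trace of a
  power.\<close>

lemma avg_damped_diff:
  "\<bar>avg (\<lambda>y. y ^ k) n \<omega> - avg (damped_power r k) n \<omega>\<bar> ^ Suc p \<le>
     inverse (Suc r) * (1 + avg (\<lambda>y. y ^ (2 * ((k + 2) * Suc p))) n \<omega>)"
proof (cases "n = 0")
  case False
  let ?bs = "spec n \<omega>"
  have "\<bar>(\<Sum>b\<leftarrow>bs. b ^ k) - (\<Sum>b\<leftarrow>bs. damped_power r k b)\<bar> \<le> (\<Sum>b\<leftarrow>bs. inverse (Suc r) * \<bar>b\<bar> ^ (k + 2))" for bs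
  proof (induction bs)
    case (Cons b bs)
    then show ?case using damped_power_diff[of b k r] by (simp del: power_add)
  qed simp
  from divide_right_mono[OF this[of ?bs], of n]
  have "\<bar>avg (\<lambda>y. y ^ k) n \<omega> - avg (damped_power r k) n \<omega>\<bar> \<le> inverse (Suc r) * ((\<Sum>b\<leftarrow>?bs. \<bar>b\<bar> ^ (k + 2)) / n)"
    by (simp add: avg_def diff_divide_distrib[symmetric] sum_list_const_mult abs_divide del: of_nat_Suc)
  then have "\<bar>avg (\<lambda>y. y ^ k) n \<omega> - avg (damped_power r k) n \<omega>\<bar> ^ Suc p \<le>
      (inverse (Suc r) * ((\<Sum>b\<leftarrow>?bs. \<bar>b\<bar> ^ (k + 2)) / n)) ^ Suc p"
    by (intro power_mono) auto
  also have "\<dots> = inverse (Suc r) ^ Suc p * ((\<Sum>b\<leftarrow>?bs. \<bar>b\<bar> ^ (k + 2)) / n) ^ Suc p"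
    by (simp only: power_mult_distrib)
  also have "\<dots> \<le> inverse (Suc r) * ((\<Sum>b\<leftarrow>?bs. (\<bar>b\<bar> ^ (k + 2)) ^ Suc p) / n)"
  proof (intro mult_mono)
    show "inverse (real (Suc r)) ^ Suc p \<le> inverse (Suc r)"
      using power_decreasing[of 1 "Suc p" "inverse (real (Suc r))"] by (simp add: inverse_le_1_iff del: power_Suc)
    show "((\<Sum>b\<leftarrow>?bs. \<bar>b\<bar> ^ (k + 2)) / n) ^ Suc p \<le> (\<Sum>b\<leftarrow>?bs. (\<bar>b\<bar> ^ (k + 2)) ^ Suc p) / n"
      using jensen_power_average[of ?bs "\<lambda>b. \<bar>b\<bar> ^ (k + 2)" p] by (simp only: spec(1) zero_le_power abs_ge_zero)
    show "0 \<le> ((\<Sum>b\<leftarrow>?bs. \<bar>b\<bar> ^ (k + 2)) / n) ^ Suc p"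
      by (intro zero_le_power divide_nonneg_nonneg sum_list_nonneg) auto
  qed simp
  also have "\<dots> \<le> inverse (Suc r) * ((\<Sum>b\<leftarrow>?bs. 1 + b ^ (2 * ((k + 2) * Suc p))) / n)"
    unfolding power_mult[of _ "k + 2", symmetric]
    by (intro mult_left_mono divide_right_mono sum_list_mono abs_power_le_even) simp_all
  also have "(\<Sum>b\<leftarrow>?bs. 1 + b ^ (2 * ((k + 2) * Suc p))) = n + (\<Sum>b\<leftarrow>?bs. b ^ (2 * ((k + 2) * Suc p)))"
    by (simp only: sum_list_addf sum_list_triv spec(1) mult_1_right)
  also have "\<dots> / n = 1 + avg (\<lambda>y. y ^ (2 * ((k + 2) * Suc p))) n \<omega>"
    using False by (simp only: avg_def add_divide_distrib divide_self_if of_nat_eq_0_iff if_False)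
  finally show ?thesis .
qed (simp add: avg_def)

text \<open>Averages of damped powers are bounded and converge almost surely to a constant, because
  \<open>\<nu>\<close> is non-random; dominated convergence makes this convergence in every L^p.
  Letting the damping vanish transfers it to powers, with the bounded trace moments as uniform error
  control.\<close>

lemma avg_power_conv: "\<exists>m. moment_conv (\<lambda>n \<omega>. complex_of_real (avg (\<lambda>y. y ^ k) n \<omega>)) m"
proof (rule moment_conv_approx)
  let ?G = "\<lambda>r n \<omega>. avg (damped_power r k) n \<omega>"
  show "finite_moments M (\<lambda>\<omega>. complex_of_real (avg (\<lambda>y. y ^ k) n \<omega>))" for n
    by (rule avg_power_moments)
  show "\<exists>K. \<forall>r n. (LINT \<omega>|M. norm (complex_of_real (avg (\<lambda>y. y ^ k) n \<omega>) - complex_of_real (?G r n \<omega>)) ^ Suc p)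
     \<le> K * inverse (Suc r)" for p
  proof -
    obtain K where K: "\<And>n. (LINT \<omega>|M. avg (\<lambda>y. y ^ (2 * ((k + 2) * Suc p))) n \<omega>) \<le> K"
      using avg_power_bound by blast
    have "(LINT \<omega>|M. norm (complex_of_real (avg (\<lambda>y. y ^ k) n \<omega>) - complex_of_real (?G r n \<omega>)) ^ Suc p)
      \<le> (1 + K) * inverse (Suc r)" for r n
    proof -
      have "(LINT \<omega>|M. norm (complex_of_real (avg (\<lambda>y. y ^ k) n \<omega>) - complex_of_real (?G r n \<omega>)) ^ Suc p) \<le>
         (LINT \<omega>|M. inverse (Suc r) * (1 + avg (\<lambda>y. y ^ (2 * ((k + 2) * Suc p))) n \<omega>))"
      proof (rule integral_mono')
        show "integrable M (\<lambda>\<omega>. inverse (Suc r) * (1 + avg (\<lambda>y. y ^ (2 * ((k + 2) * Suc p))) n \<omega>))"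
          by (intro integrable_mult_right Bochner_Integration.integrable_add integrable_const avg_power_integrable)
        show le: "norm (complex_of_real (avg (\<lambda>y. y ^ k) n \<omega>) - complex_of_real (?G r n \<omega>)) ^ Suc p \<le>
          inverse (Suc r) * (1 + avg (\<lambda>y. y ^ (2 * ((k + 2) * Suc p))) n \<omega>)" for \<omega>
          unfolding of_real_diff[symmetric] norm_of_real by (rule avg_damped_diff)
        show "0 \<le> inverse (Suc r) * (1 + avg (\<lambda>y. y ^ (2 * ((k + 2) * Suc p))) n \<omega>)" for \<omega>
          by (rule order_trans[OF _ le]) (intro zero_le_power norm_ge_zero)
      qed
      also have "\<dots> = inverse (Suc r) * (1 + (LINT \<omega>|M. avg (\<lambda>y. y ^ (2 * ((k + 2) * Suc p))) n \<omega>))"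
        using avg_power_integrable[of "2 * ((k + 2) * Suc p)" n] by (simp add: prob_space del: mult_Suc_right of_nat_Suc)
      also have "\<dots> \<le> inverse (Suc r) * (1 + K)"
        by (intro mult_left_mono add_left_mono K) simp
      finally show ?thesis by (simp only: mult.commute)
    qed
    then show ?thesis by blast
  qed
  fix r
  obtain B where B: "\<And>y. \<bar>damped_power r k y\<bar> \<le> B" using damped_power_bounded by blast
  have B0: "0 \<le> B" using B[of 0] by linarith
  have G_le: "\<bar>?G r n \<omega>\<bar> \<le> B" for n \<omega>
  proof (cases "n = 0")
    case False
    have "\<bar>\<Sum>b\<leftarrow>bs. damped_power r k b\<bar> \<le> length bs * B" for bs
    proof (induction bs)
      case (Cons b bs)
      then show ?case using B[of b] by (simp add: distrib_right)
    qed simp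
    from this[of "spec n \<omega>"] show ?thesis using False by (simp add: avg_def spec(1) abs_divide field_simps)
  qed (use B0 in \<open>simp add: avg_def\<close>)
  let ?c = "LINT y|\<nu>. damped_power r k y"
  have ae: "AE \<omega> in M. (\<lambda>n. ?G r n \<omega>) \<longlonglongrightarrow> ?c"
  proof -
    have "AE \<omega> in M. weak_conv_m (\<lambda>n. spectral_measure (S n \<omega>)) \<nu>"
      using lsd by (simp add: is_LSD_def)
    then show ?thesis
    proof eventually_elim
      case (elim \<omega>)
      have "(\<lambda>n. LINT y|spectral_measure (S n \<omega>). damped_power r k y) \<longlonglongrightarrow> ?c"
        using lsd B by (intro weak_conv_imp_integral_bdd_continuous_conv[OF real_distribution_spectral_measure _ elim, where B = B]
            isCont_damped_power) (auto simp: is_LSD_def)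
      \<comment> \<open>At size 0 the spectral measure is junk, hence an identity that holds only
        eventually.\<close>
      moreover have "\<forall>\<^sub>F n in sequentially. (LINT y|spectral_measure (S n \<omega>). damped_power r k y) = ?G r n \<omega>"
        using eventually_gt_at_top[of 0]
      proof eventually_elim
        case (elim n)
        have "spec n \<omega> \<noteq> []" using spec(1)[of n \<omega>] elim by auto
        then have "(LINT y|spectral_measure (S n \<omega>). damped_power r k y) =
            (\<Sum>b\<leftarrow>spec n \<omega>. damped_power r k b) / length (spec n \<omega>)"
          by (intro integral_spectral_measure spec borel_measurable_continuous_onI
              continuous_at_imp_continuous_on ballI isCont_damped_power)
        then show ?case by (simp add: avg_def spec(1))
      qed
      ultimately show ?case by (rule Lim_transform_eventually)
    qed
  qed
  have c_le: "\<bar>?c\<bar> \<le> B"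
  proof -
    interpret \<nu>: real_distribution \<nu> using lsd by (simp add: is_LSD_def)
    have "\<bar>?c\<bar> \<le> (LINT y|\<nu>. \<bar>damped_power r k y\<bar>)" by (rule integral_abs_bound)
    also have "\<dots> \<le> (LINT y|\<nu>. B)"
      using B B0 by (intro integral_mono') auto
    also have "\<dots> = B" using \<nu>.prob_space by simp
    finally show ?thesis .
  qed
  note [measurable] = avg_damped_measurable
  show "moment_conv (\<lambda>n \<omega>. complex_of_real (?G r n \<omega>)) (complex_of_real ?c)"
    unfolding moment_conv_def
  proof (intro conjI allI)
    show "finite_moments M (\<lambda>\<omega>. complex_of_real (?G r n \<omega>))" for n
    proof (rule finite_moments_of_real)
      show "integrable M (\<lambda>\<omega>. \<bar>?G r n \<omega>\<bar> ^ m)" for m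
        by (rule integrable_const_bound[where B = "B ^ m"]) (auto intro!: AE_I2 power_mono G_le)
    qed measurable
    fix p
    have "(\<lambda>n. LINT \<omega>|M. \<bar>?G r n \<omega> - ?c\<bar> ^ Suc p) \<longlonglongrightarrow> (LINT \<omega>|M. 0)"
    proof (rule integral_dominated_convergence[where w = "\<lambda>_. (2 * B) ^ Suc p"])
      show "AE \<omega> in M. (\<lambda>n. \<bar>?G r n \<omega> - ?c\<bar> ^ Suc p) \<longlonglongrightarrow> 0"
        using ae
      proof eventually_elim
        case (elim \<omega>)
        have "(\<lambda>n. \<bar>?G r n \<omega> - ?c\<bar> ^ Suc p) \<longlonglongrightarrow> \<bar>?c - ?c\<bar> ^ Suc p"
          by (intro tendsto_intros elim)
        then show ?case by simp
      qed
      show "AE \<omega> in M. norm (\<bar>?G r n \<omega> - ?c\<bar> ^ Suc p) \<le> (2 * B) ^ Suc p" for n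
      proof (rule AE_I2)
        fix \<omega>
        have "\<bar>?G r n \<omega> - ?c\<bar> \<le> 2 * B" using G_le[of n \<omega>] c_le by linarith
        then have "\<bar>?G r n \<omega> - ?c\<bar> ^ Suc p \<le> (2 * B) ^ Suc p" by (intro power_mono) auto
        then show "norm (\<bar>?G r n \<omega> - ?c\<bar> ^ Suc p) \<le> (2 * B) ^ Suc p" by (simp only: real_norm_def power_abs abs_idempotent)
      qed
    qed (auto simp del: power_Suc)
    then show "(\<lambda>n. LINT \<omega>|M. norm (complex_of_real (?G r n \<omega>) - complex_of_real ?c) ^ Suc p) \<longlonglongrightarrow> 0"
      unfolding of_real_diff[symmetric] norm_of_real by simp
  qed
qed

end

section \<open>The joint limit\<close>

text \<open>Together with the leading W, each split or reconnection consumes two letters, so the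
  number of letters W serves as the induction measure.\<close>

lemma count_splits:
  "(u, v) \<in> set (splits y) \<Longrightarrow> count_list u True + count_list v True + 1 = count_list y True"
  by (induction y arbitrary: u v) (auto split: if_splits)

abbreviation count_W :: "bool list list \<Rightarrow> nat" where
  "count_W ws \<equiv> (\<Sum>w\<leftarrow>ws. count_list w True)"

lemma count_reconnections:
  "vs \<in> set (reconnections y ws) \<Longrightarrow> count_W vs + 1 = count_list y True + count_W ws"
proof (induction ws arbitrary: vs)
  case (Cons w ws)
  then consider u v where "(u, v) \<in> set (splits w)" "vs = (y @ v @ u) # ws"
    | zs where "zs \<in> set (reconnections y ws)" "vs = w # zs"
    by auto
  then show ?case
  proof cases
    case 1
    then show ?thesis using count_splits[of u v w] by simp
  next
    case 2
    then show ?thesis using Cons.IH[of zs] by simp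
  qed
qed simp

lemma length_reconnections: "vs \<in> set (reconnections y ws) \<Longrightarrow> length vs = length ws"
  by (induction ws arbitrary: vs) auto

lemma measurable_prod_list_components:
  assumes "set ps \<subseteq> I"
  shows "(\<lambda>m. \<Prod>p\<leftarrow>ps. m p :: complex) \<in> borel_measurable (\<Pi>\<^sub>M p\<in>I. borel)"
  using assms
proof (induction ps)
  case (Cons p ps)
  then show ?case by (auto intro!: borel_measurable_times measurable_component_singleton)
qed simp

lemma tendsto_sum_list:
  fixes f :: "'a \<Rightarrow> nat \<Rightarrow> complex"
  assumes "\<And>x. x \<in> set xs \<Longrightarrow> f x \<longlonglongrightarrow> c x"
  shows "(\<lambda>n. \<Sum>x\<leftarrow>xs. f x n) \<longlonglongrightarrow> (\<Sum>x\<leftarrow>xs. c x)"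
  using assms by (induction xs) (auto intro: tendsto_add)

locale gue_patterned = patterned_lsd M x L \<nu> for M :: "'w measure" and x :: "'t \<Rightarrow> 'w \<Rightarrow> real" and L \<nu> +
  fixes W :: "nat \<Rightarrow> 'w \<Rightarrow> complex mat"
  assumes gue: "GUE M n (W n)"
    and indep_W: "independent_matrices M n (W n) (\<lambda>\<omega>. complex_mat (patterned_matrix L x n \<omega>))"
begin

abbreviation "A n \<omega> \<equiv> complex_mat (S n \<omega>)"

lemma A_entry:
  "p \<in> {..<n} \<times> {..<n} \<Longrightarrow>
     A n \<omega> $$ p = complex_of_real (1 / sqrt n) * complex_mat (patterned_matrix L x n \<omega>) $$ p"
  by (auto simp: patterned_matrix_def)

lemma patterned_entry_moments:
  assumes "p \<in> {..<n} \<times> {..<n}"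
  shows "finite_moments M (\<lambda>\<omega>. complex_mat (patterned_matrix L x n \<omega>) $$ p)"
proof -
  obtain i j where "p = (i, j)" "i < n" "j < n" using assms by auto
  then have "(\<lambda>\<omega>. complex_mat (patterned_matrix L x n \<omega>) $$ p) = X (L n (Suc i, Suc j))"
    by (auto simp: patterned_matrix_def)
  then show ?thesis using X_moments by simp
qed

lemma pair: "gue_pair M n (W n) (A n)"
proof -
  interpret gue_matrix M n "W n" by unfold_locales (rule gue)
  let ?Y = "\<lambda>\<omega>. complex_mat (patterned_matrix L x n \<omega>)"
  let ?I = "{..<n} \<times> {..<n}"
  show ?thesis
  proof unfold_locales
    show "A n \<omega> \<in> carrier_mat n n" for \<omega>
      using S_carrier by simp
    show "finite_moments M (\<lambda>\<omega>. A n \<omega> $$ p)" if "p \<in> ?I" for p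
      unfolding A_entry[OF that]
      by (intro finite_moments_mult finite_moments_const patterned_entry_moments that)
    fix ps qs :: "(nat \<times> nat) list" assume ps: "set ps \<subseteq> ?I" and qs: "set qs \<subseteq> ?I"
    let ?f = "\<lambda>ps m. \<Prod>p\<leftarrow>ps. m p :: complex"
    have ind: "indep_var borel (?f ps \<circ> mat_entries n (W n)) borel (?f qs \<circ> mat_entries n ?Y)"
      using indep_W[of n] unfolding independent_matrices_def
      by (rule indep_var_compose) (intro measurable_prod_list_components ps qs)+
    have prod: "?f ps (mat_entries n Z \<omega>) = (\<Prod>p\<leftarrow>ps. Z \<omega> $$ p)" if "set ps \<subseteq> ?I" for ps Z \<omega>
      using that by (induction ps) (auto simp: mat_entries_def)
    have "integrable M (\<lambda>\<omega>. \<Prod>p\<leftarrow>ps. W n \<omega> $$ p)" "integrable M (\<lambda>\<omega>. \<Prod>q\<leftarrow>qs. ?Y \<omega> $$ q)"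
      using ps qs by (intro finite_moments_integrable finite_moments_prod_list moments
        entry_in_space patterned_entry_moments; auto)+
    then have "(LINT \<omega>|M. (\<Prod>p\<leftarrow>ps. W n \<omega> $$ p) * (\<Prod>q\<leftarrow>qs. ?Y \<omega> $$ q)) =
        (LINT \<omega>|M. (\<Prod>p\<leftarrow>ps. W n \<omega> $$ p)) * (LINT \<omega>|M. (\<Prod>q\<leftarrow>qs. ?Y \<omega> $$ q))"
      using indep_var_lebesgue_integral[OF ind] by (simp only: o_def prod[OF ps] prod[OF qs])
    \<comment> \<open>Independence is assumed for the unscaled matrix; the scaling comes out of a
      monomial as a constant.\<close>
    moreover have "(\<Prod>q\<leftarrow>qs. A n \<omega> $$ q) = complex_of_real (1 / sqrt n) ^ length qs * (\<Prod>q\<leftarrow>qs. ?Y \<omega> $$ q)" for \<omega>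
      using qs
    proof (induction qs)
      case (Cons q qs)
      then show ?case using A_entry[of q n \<omega>] by (simp only: list.map prod_list.Cons) simp
    qed simp
    ultimately show "(LINT \<omega>|M. (\<Prod>p\<leftarrow>ps. W n \<omega> $$ p) * (\<Prod>q\<leftarrow>qs. A n \<omega> $$ q)) =
        (LINT \<omega>|M. (\<Prod>p\<leftarrow>ps. W n \<omega> $$ p)) * (LINT \<omega>|M. (\<Prod>q\<leftarrow>qs. A n \<omega> $$ q))"
      by (simp only: mult.left_commute[of _ "complex_of_real (1 / sqrt n) ^ length qs"] integral_mult_right_zero)
  qed
qed

sublocale gue_pair M n "W n" "A n" for n
  by (rule pair)

section \<open>Convergence and factorisation of mixed moments\<close>

definition trace_moment :: "nat \<Rightarrow> bool list list \<Rightarrow> complex" where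
  "trace_moment n ws = (1 / of_nat n) ^ length ws * (LINT \<omega>|M. trc_prod n ws \<omega>)"

text \<open>\<open>lim\<close> carries information only once convergence is known, which
  \<open>trace_moment_tendsto\<close> establishes for all words.\<close>

definition limit_moment :: "bool list \<Rightarrow> complex" where
  "limit_moment w = lim (\<lambda>n. trace_moment n [w])"

lemma trace_moment_loop:
  "trace_moment n ((True # y) # ws) =
     (\<Sum>(u, v)\<leftarrow>splits y. trace_moment n (u # v # ws)) +
     (1 / of_nat n) ^ 2 * (\<Sum>vs\<leftarrow>reconnections y ws. trace_moment n vs)"
proof -
  let ?c = "1 / of_nat n :: complex"
  let ?S1 = "\<Sum>(u, v)\<leftarrow>splits y. (LINT \<omega>|M. trc_prod n (u # v # ws) \<omega>)"
  let ?S2 = "\<Sum>vs\<leftarrow>reconnections y ws. (LINT \<omega>|M. trc_prod n vs \<omega>)"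
  have S1: "(\<Sum>(u, v)\<leftarrow>splits y. trace_moment n (u # v # ws)) = ?c ^ Suc (Suc (length ws)) * ?S1"
    by (simp only: trace_moment_def split_def sum_list_const_mult list.size(4) add_Suc_right add_0_right
        One_nat_def)
  have "(\<Sum>vs\<leftarrow>reconnections y ws. trace_moment n vs) =
    (\<Sum>vs\<leftarrow>reconnections y ws. ?c ^ length ws * (LINT \<omega>|M. trc_prod n vs \<omega>))"
    by (intro arg_cong[where f = sum_list] map_cong) (simp_all add: trace_moment_def length_reconnections)
  then have S2: "(\<Sum>vs\<leftarrow>reconnections y ws. trace_moment n vs) = ?c ^ length ws * ?S2"
    by (simp only: sum_list_const_mult)
  have "c ^ Suc l * (c * (a + b)) = c ^ Suc (Suc l) * a + c ^ 2 * (c ^ l * b)" for c a b :: complex and l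
    by (simp add: power2_eq_square algebra_simps)
  then show ?thesis
    unfolding S1 S2 unfolding trace_moment_def loop_equation
    by (simp only: list.size(4) add_Suc_right add_0_right One_nat_def)
qed

text \<open>Brings any chosen letter of any chosen trace to the very front, where the loop equation
  acts.\<close>

lemma trace_moment_rotate:
  "trace_moment n (ws1 @ (u @ v) # ws2) = trace_moment n ((v @ u) # ws1 @ ws2)"
proof -
  have "trc_prod n (ws1 @ (u @ v) # ws2) \<omega> = trc_prod n ((v @ u) # ws1 @ ws2) \<omega>" for \<omega>
    using trc_append_commute[of n u v \<omega>] by (simp add: trc_prod_def mult_ac)
  then show ?thesis by (simp add: trace_moment_def del: trc_prod_simps)
qed

lemma word_entry_replicate:
  "i < n \<Longrightarrow> j < n \<Longrightarrow> word_entry n (replicate k False) i j \<omega> =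
     complex_of_real ((1 / sqrt n) ^ k) * power_entry n k i j \<omega>"
proof (induction k arbitrary: i)
  case (Suc k)
  have "word_entry n (replicate (Suc k) False) i j \<omega> =
      (\<Sum>l<n. complex_of_real ((1 / sqrt n) ^ Suc k) * (X (L n (Suc i, Suc l)) \<omega> * power_entry n k l j \<omega>))"
    unfolding replicate_Suc word_entry.simps if_False
  proof (intro sum.cong refl)
    fix l assume l: "l \<in> {..<n}"
    then have "A n \<omega> $$ (i, l) = complex_of_real (1 / sqrt n) * X (L n (Suc i, Suc l)) \<omega>"
      using Suc.prems by (simp add: patterned_matrix_def)
    then show "A n \<omega> $$ (i, l) * word_entry n (replicate k False) l j \<omega> =
      complex_of_real ((1 / sqrt n) ^ Suc k) * (X (L n (Suc i, Suc l)) \<omega> * power_entry n k l j \<omega>)"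
      using Suc.IH[of l] Suc.prems l by (simp add: mult_ac)
  qed
  then show ?case by (simp add: sum_distrib_left del: replicate_Suc)
qed simp

lemma trc_replicate:
  "1 / of_nat n * trc n (replicate k False) \<omega> = complex_of_real (avg (\<lambda>y. y ^ k) n \<omega>)"
  unfolding avg_power by (simp add: trc_def word_entry_replicate sum_distrib_left)

text \<open>Words without W are powers of A, so their normalised traces are spectral averages; these
  converge in every L^p, hence so do their products. Applied to a single word, the same convergence
  identifies \<open>limit_moment\<close>.\<close>

lemma trace_moment_no_W:
  assumes "count_W ws = 0"
  shows "(\<lambda>n. trace_moment n ws) \<longlonglongrightarrow> (\<Prod>w\<leftarrow>ws. limit_moment w)"
proof -
  define m where "m k = (SOME m. moment_conv (\<lambda>n \<omega>. complex_of_real (avg (\<lambda>y. y ^ k) n \<omega>)) m)" for k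
  have m: "moment_conv (\<lambda>n \<omega>. complex_of_real (avg (\<lambda>y. y ^ k) n \<omega>)) (m k)" for k
    unfolding m_def by (rule someI_ex) (rule avg_power_conv)
  have conv: "(\<lambda>n. trace_moment n ws) \<longlonglongrightarrow> (\<Prod>w\<leftarrow>ws. m (length w))" if "count_W ws = 0" for ws
  proof -
    have rep: "w = replicate (length w) False" if "w \<in> set ws" for w
    proof -
      have "count_list w True = 0" using \<open>count_W ws = 0\<close> that by simp
      then have "True \<notin> set w" by (simp add: count_list_0_iff)
      then show ?thesis by (metis (full_types) replicate_length_same)
    qed
    have "trace_moment n ws = (LINT \<omega>|M. (\<Prod>w\<leftarrow>ws. complex_of_real (avg (\<lambda>y. y ^ length w) n \<omega>)))" for n
    proof -
      have "(1 / of_nat n) ^ length ws * trc_prod n ws \<omega> =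
         (\<Prod>w\<leftarrow>ws. complex_of_real (avg (\<lambda>y. y ^ length w) n \<omega>))" for \<omega>
      proof -
        have "set vs \<subseteq> set ws \<Longrightarrow> (1 / of_nat n) ^ length vs * trc_prod n vs \<omega> =
         (\<Prod>w\<leftarrow>vs. complex_of_real (avg (\<lambda>y. y ^ length w) n \<omega>))" for vs
        proof (induction vs)
          case (Cons v vs)
          have "(1 / of_nat n) ^ length (v # vs) * trc_prod n (v # vs) \<omega> =
             (1 / of_nat n * trc n v \<omega>) * ((1 / of_nat n) ^ length vs * trc_prod n vs \<omega>)"
            by simp
          also have "1 / of_nat n * trc n v \<omega> = complex_of_real (avg (\<lambda>y. y ^ length v) n \<omega>)"
            using trc_replicate[of n "length v" \<omega>] rep[of v] Cons.prems by simp
          finally show ?case using Cons by simp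
        qed simp
        then show ?thesis by blast
      qed
      then show ?thesis
        unfolding trace_moment_def integral_mult_right_zero[symmetric] by (simp only:)
    qed
    moreover have "(\<lambda>n. LINT \<omega>|M. (\<Prod>w\<leftarrow>ws. complex_of_real (avg (\<lambda>y. y ^ length w) n \<omega>)))
        \<longlonglongrightarrow> (\<Prod>w\<leftarrow>ws. m (length w))"
      by (intro moment_conv_integral moment_conv_prod_list m)
    ultimately show ?thesis by (simp only:)
  qed
  have "limit_moment w = m (length w)" if "w \<in> set ws" for w
    using conv[of "[w]"] that assms unfolding limit_moment_def by (auto intro!: limI)
  then have "(\<Prod>w\<leftarrow>ws. limit_moment w) = (\<Prod>w\<leftarrow>ws. m (length w))"
    by (intro arg_cong[where f = prod_list] map_cong) auto
  then show ?thesis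
    using conv[OF assms] by simp
qed

text \<open>Splits and reconnections both contain fewer letters W, so the hypothesis covers them.
  The reconnections converge as well and are killed by the factor \<open>n^-2\<close>.\<close>

lemma trace_moment_step:
  assumes IH: "\<And>vs. count_W vs < count_W ((True # y) # ws) \<Longrightarrow>
      (\<lambda>n. trace_moment n vs) \<longlonglongrightarrow> (\<Prod>v\<leftarrow>vs. limit_moment v)"
  shows "(\<lambda>n. trace_moment n ((True # y) # ws)) \<longlonglongrightarrow>
      (\<Sum>(u, v)\<leftarrow>splits y. limit_moment u * limit_moment v) * (\<Prod>w\<leftarrow>ws. limit_moment w)"
proof -
  have "(\<lambda>n. \<Sum>(u, v)\<leftarrow>splits y. trace_moment n (u # v # ws)) \<longlonglongrightarrow>
      (\<Sum>(u, v)\<leftarrow>splits y. (\<Prod>w\<leftarrow>u # v # ws. limit_moment w))"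
    unfolding split_def
  proof (rule tendsto_sum_list)
    fix p assume "p \<in> set (splits y)"
    then show "(\<lambda>n. trace_moment n (fst p # snd p # ws)) \<longlonglongrightarrow> (\<Prod>w\<leftarrow>fst p # snd p # ws. limit_moment w)"
      using count_splits[of "fst p" "snd p" y] by (intro IH) auto
  qed
  moreover have "(\<lambda>n. (1 / of_nat n) ^ 2 * (\<Sum>vs\<leftarrow>reconnections y ws. trace_moment n vs)) \<longlonglongrightarrow>
      0 ^ 2 * (\<Sum>vs\<leftarrow>reconnections y ws. (\<Prod>v\<leftarrow>vs. limit_moment v))"
  proof (intro tendsto_mult tendsto_power tendsto_sum_list lim_1_over_n)
    fix vs assume "vs \<in> set (reconnections y ws)"
    then show "(\<lambda>n. trace_moment n vs) \<longlonglongrightarrow> (\<Prod>v\<leftarrow>vs. limit_moment v)"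
      using count_reconnections[of vs y ws] by (intro IH) simp
  qed
  ultimately have "(\<lambda>n. trace_moment n ((True # y) # ws)) \<longlonglongrightarrow>
      (\<Sum>(u, v)\<leftarrow>splits y. (\<Prod>w\<leftarrow>u # v # ws. limit_moment w)) +
      0 ^ 2 * (\<Sum>vs\<leftarrow>reconnections y ws. (\<Prod>v\<leftarrow>vs. limit_moment v))"
    unfolding trace_moment_loop by (rule tendsto_add)
  then show ?thesis
    by (simp add: split_def mult.assoc[symmetric] sum_list_mult_const)
qed

text \<open>Convergence and asymptotic factorisation are proved together, since the loop equation
  for one trace involves the limit of products of two.\<close>

theorem trace_moment_tendsto:
  "(\<lambda>n. trace_moment n ws) \<longlonglongrightarrow> (\<Prod>w\<leftarrow>ws. limit_moment w)"
proof (induction "count_W ws" arbitrary: ws rule: less_induct)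
  case less
  show ?case
  proof (cases "count_W ws = 0")
    case True
    then show ?thesis by (rule trace_moment_no_W)
  next
    case False
    then obtain w where "w \<in> set ws" "count_list w True \<noteq> 0" by auto
    then obtain ws1 ws2 where ws: "ws = ws1 @ w # ws2" by (auto dest: split_list)
    have "True \<in> set w" using \<open>count_list w True \<noteq> 0\<close> by (simp add: count_list_0_iff)
    then obtain u v where w: "w = u @ True # v" by (auto dest: split_list)
    let ?w' = "True # v @ u" and ?c = "\<Sum>(a, b)\<leftarrow>splits (v @ u). limit_moment a * limit_moment b"
    have "count_W (?w' # zs) = count_W (w # zs)" for zs by (simp add: w)
    then have cnt: "count_W (?w' # ws1 @ ws2) = count_W ws" "count_W [?w'] \<le> count_W ws"
      by (simp_all add: ws)
    have eq: "trace_moment n ws = trace_moment n (?w' # ws1 @ ws2)" "trace_moment n [w] = trace_moment n [?w']" for n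
      using trace_moment_rotate[of n ws1 u "True # v" ws2] trace_moment_rotate[of n "[]" u "True # v" "[]"]
      by (simp_all add: ws w)
    have step: "(\<lambda>n. trace_moment n ws) \<longlonglongrightarrow> ?c * (\<Prod>w\<leftarrow>ws1 @ ws2. limit_moment w)"
      unfolding eq using less cnt by (intro trace_moment_step) auto
    \<comment> \<open>The same step for \<open>w\<close> alone, which has no more letters W than
      \<open>ws\<close>, shows that the factor split off is \<open>limit_moment w\<close>.\<close>
    have "(\<lambda>n. trace_moment n [w]) \<longlonglongrightarrow> ?c * (\<Prod>w\<leftarrow>[]. limit_moment w)"
      unfolding eq using less cnt by (intro trace_moment_step) auto
    then have "limit_moment w = ?c"
      unfolding limit_moment_def by (auto intro: limI)
    then show ?thesis using step by (simp add: ws mult_ac)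
  qed
qed

lemma limit_moment_tendsto: "(\<lambda>n. trace_moment n [w]) \<longlonglongrightarrow> limit_moment w"
  using trace_moment_tendsto[of "[w]"] by simp

lemma limit_moment_loop:
  "limit_moment (True # y) = (\<Sum>(u, v)\<leftarrow>splits y. limit_moment u * limit_moment v)"
  using LIMSEQ_unique[OF limit_moment_tendsto[of "True # y"] trace_moment_step[of y "[]", OF trace_moment_tendsto]]
  by simp

lemma limit_moment_rotate: "limit_moment (u @ v) = limit_moment (v @ u)"
  using trace_moment_rotate[of _ "[]" u v "[]"] by (simp add: limit_moment_def)

lemma limit_moment_Nil: "limit_moment [] = 1"
proof -
  have e: "1 = trace_moment n [[]]" if "n > 0" for n
    using that by (simp add: trace_moment_def trc_def prob_space)
  then have "\<forall>\<^sub>F n in sequentially. 1 = trace_moment n [[]]"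
    unfolding eventually_sequentially by (intro exI[of _ 1] allI impI e) simp
  then have "(\<lambda>n. trace_moment n [[]]) \<longlonglongrightarrow> 1"
    by (rule Lim_transform_eventually[OF tendsto_const])
  then show ?thesis using LIMSEQ_unique limit_moment_tendsto by blast
qed

lemma phi2_matrix_word: "phi2 M n (matrix_word n (case_bool (W n) (A n)) w) = trace_moment n [w]"
proof -
  have "(LINT \<omega>|M. mat_trace (matrix_word n (case_bool (W n) (A n)) w \<omega>)) = (LINT \<omega>|M. trc n w \<omega>)"
    by (rule Bochner_Integration.integral_cong) (simp_all add: mat_trace_matrix_word)
  then show ?thesis by (simp add: phi2_def trace_moment_def)
qed

lemma integrable_matrix_word:
  "integrable M (\<lambda>\<omega>. mat_trace (matrix_word n (case_bool (W n) (A n)) w \<omega>))"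
proof -
  have "integrable M (\<lambda>\<omega>. mat_trace (matrix_word n (case_bool (W n) (A n)) w \<omega>)) \<longleftrightarrow> integrable M (trc n w)"
    by (rule Bochner_Integration.integrable_cong) (simp_all add: mat_trace_matrix_word)
  then show ?thesis using finite_moments_integrable[OF trc_finite_moments] by simp
qed

end

section \<open>The free algebra on two generators\<close>

text \<open>With concatenation as addition of exponents, the convolution product of
  \<open>Poly_Mapping\<close> is the product of non-commutative polynomials.\<close>

instantiation list :: (type) monoid_add
begin
definition zero_list :: "'a list" where "zero_list = []"
definition plus_list :: "'a list \<Rightarrow> 'a list \<Rightarrow> 'a list" where "plus_list = (@)"
instance by standard (simp_all add: zero_list_def plus_list_def)
end

type_synonym ncpoly = "bool list \<Rightarrow>\<^sub>0 complex"

abbreviation (input) keys :: "ncpoly \<Rightarrow> bool list set" where "keys \<equiv> Poly_Mapping.keys"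
abbreviation (input) lookup :: "ncpoly \<Rightarrow> bool list \<Rightarrow> complex" where "lookup \<equiv> Poly_Mapping.lookup"
abbreviation cst :: "complex \<Rightarrow> ncpoly" where "cst c \<equiv> Poly_Mapping.single [] c"
abbreviation ncmono :: "bool list \<Rightarrow> ncpoly" where "ncmono w \<equiv> Poly_Mapping.single w 1"

lemma mult_single_list:
  "Poly_Mapping.single u a * Poly_Mapping.single v b = Poly_Mapping.single (u @ v) (a * b :: complex)"
  by (simp add: mult_single plus_list_def)

lemma cst_one: "cst 1 = 1"
  by (simp only: zero_list_def[symmetric] single_one)

lemma mono_Nil: "ncmono [] = 1"
  by (rule cst_one)

lemma ncpoly_sum: "p = (\<Sum>w\<in>keys p. cst (lookup p w) * ncmono w)" for p :: ncpoly
proof (rule poly_mapping_eqI)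
  fix v
  have "lookup (\<Sum>w\<in>W. cst (lookup p w) * ncmono w) v = (\<Sum>w\<in>W. if w = v then lookup p w else 0)" for W
    by (induction W rule: infinite_finite_induct)
      (auto simp: lookup_add mult_single_list lookup_single when_def)
  then show "lookup p v = lookup (\<Sum>w\<in>keys p. cst (lookup p w) * ncmono w) v"
    by (simp add: sum.delta in_keys_iff)
qed

lemma cst_commute: "cst c * p = p * cst c"
proof -
  have "cst c * (cst a * ncmono w) = cst a * ncmono w * cst c" for a w
    by (simp add: mult_single_list mult.commute)
  then show ?thesis
    by (subst (1 2) ncpoly_sum[of p]) (simp add: sum_distrib_left sum_distrib_right)
qed

section \<open>Linear functionals on non-commutative polynomials\<close>

locale linear_functional =
  fixes f :: "ncpoly \<Rightarrow> complex"
  assumes add: "f (p + q) = f p + f q" and scale: "f (cst c * p) = c * f p"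
begin

lemma zero: "f 0 = 0"
  using add[of 0 0] by simp

lemma diff: "f (p - q) = f p - f q"
  using add[of "p - q" q] by simp

lemma sum: "f (\<Sum>i\<in>I. g i) = (\<Sum>i\<in>I. f (g i))"
  by (induction I rule: infinite_finite_induct) (auto simp: zero add)

lemma eq_sum: "f p = (\<Sum>w\<in>keys p. lookup p w * f (ncmono w))"
  by (subst ncpoly_sum) (simp only: sum scale)

end

lemma linear_functional_ext:
  assumes "linear_functional f" "linear_functional g" "\<And>w. w \<in> keys p \<Longrightarrow> f (ncmono w) = g (ncmono w)"
  shows "f p = g p"
  unfolding linear_functional.eq_sum[OF assms(1), of p] linear_functional.eq_sum[OF assms(2), of p]
  by (intro sum.cong) (auto simp: assms(3))

definition lin :: "(bool list \<Rightarrow> complex) \<Rightarrow> ncpoly \<Rightarrow> complex" where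
  "lin h p = (\<Sum>w\<in>keys p. lookup p w * h w)"

lemma lin_superset:
  assumes "finite W" "keys p \<subseteq> W"
  shows "lin h p = (\<Sum>w\<in>W. lookup p w * h w)"
  unfolding lin_def using assms by (intro sum.mono_neutral_left) (auto simp: in_keys_iff)

lemma lin_single: "lin h (Poly_Mapping.single w c) = c * h w"
  by (subst lin_superset[of "{w}"]) (auto simp: lookup_single)

lemma lin_add: "lin h (p + q) = lin h p + lin h q"
proof -
  have "lin h (p + q) = (\<Sum>w\<in>keys p \<union> keys q. lookup (p + q) w * h w)"
    by (intro lin_superset) (use keys_add[of p q] in auto)
  also have "\<dots> = lin h p + lin h q"
    by (subst (1 2) lin_superset[of "keys p \<union> keys q"])
      (auto simp: lookup_add distrib_right sum.distrib)
  finally show ?thesis .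
qed

lemma lin_linear: "linear_functional (lin h)"
proof
  have sum: "lin h (\<Sum>w\<in>W. g w) = (\<Sum>w\<in>W. lin h (g w))" for W and g :: "bool list \<Rightarrow> ncpoly"
    by (induction W rule: infinite_finite_induct) (auto simp: lin_def[of h 0] lin_add)
  show "lin h (cst c * p) = c * lin h p" for c p
    by (subst (1 2) ncpoly_sum[of p])
      (simp add: sum_distrib_left sum mult.assoc[symmetric] mult_single_list lin_single)
qed (rule lin_add)

lemma splits_append:
  "splits (u @ v) = map (\<lambda>(a, b). (a, b @ v)) (splits u) @ map (\<lambda>(a, b). (u @ a, b)) (splits v)"
  by (induction u) (auto simp: split_def)

text \<open>These are \<open>U_k(s/2)\<close>, the orthogonal polynomials of the semicircle law of
  variance 1, which is the law that the loop equation gives to s.\<close>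

fun cheb :: "nat \<Rightarrow> ncpoly" where
  "cheb 0 = 1"
| "cheb (Suc 0) = ncmono [True]"
| "cheb (Suc (Suc k)) = ncmono [True] * cheb (Suc k) - cheb k"

lemma cheb_Suc: "cheb (Suc k) = ncmono [True] * cheb k - (if k = 0 then 0 else cheb (k - 1))"
  by (cases k) auto

lemma True_mult_cheb: "ncmono [True] * cheb k = cheb (Suc k) + (if k = 0 then 0 else cheb (k - 1))"
  by (simp add: cheb_Suc)

definition words_in :: "bool \<Rightarrow> ncpoly set" where
  "words_in b = {p. \<forall>w\<in>keys p. set w \<subseteq> {b}}"

lemma words_in_add: "p \<in> words_in b \<Longrightarrow> q \<in> words_in b \<Longrightarrow> p + q \<in> words_in b"
  using keys_add[of p q] unfolding words_in_def by blast

lemma words_in_mult: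
  assumes "p \<in> words_in b" "q \<in> words_in b"
  shows "p * q \<in> words_in b"
  unfolding words_in_def
proof (intro CollectI ballI)
  fix w assume "w \<in> keys (p * q)"
  from subsetD[OF keys_mult this]
  obtain u v where "u \<in> keys p" "v \<in> keys q" "w = u @ v"
    unfolding plus_list_def by blast
  moreover from this have "set u \<subseteq> {b}" "set v \<subseteq> {b}"
    using assms unfolding words_in_def by blast+
  ultimately show "set w \<subseteq> {b}" by simp
qed

lemma words_in_single: "set w \<subseteq> {b} \<Longrightarrow> Poly_Mapping.single w c \<in> words_in b"
  by (auto simp: words_in_def)

lemma words_in_one: "1 \<in> words_in b"
  using words_in_single[of "[]" b 1] by (simp add: mono_Nil)

lemma words_in_diff_cst: "p \<in> words_in b \<Longrightarrow> p - cst c \<in> words_in b"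
  using words_in_add[OF _ words_in_single[of "[]" b "- c"], of p] by (simp add: single_uminus)

section \<open>Freeness from the loop equation\<close>

type_synonym factor = "nat + ncpoly"

text \<open>\<open>Inl k\<close> stands for the Chebyshev polynomial of index \<open>k + 1\<close>, which is centered.\<close>

fun factor_val :: "factor \<Rightarrow> ncpoly" where
  "factor_val (Inl k) = cheb (Suc k)"
| "factor_val (Inr q) = q"

fun factor_deg :: "factor \<Rightarrow> nat" where
  "factor_deg (Inl k) = Suc k"
| "factor_deg (Inr q) = 0"

abbreviation factors_prod :: "factor list \<Rightarrow> ncpoly" where
  "factors_prod zs \<equiv> (\<Prod>z\<leftarrow>zs. factor_val z)"

abbreviation factors_deg :: "factor list \<Rightarrow> nat" where
  "factors_deg zs \<equiv> (\<Sum>z\<leftarrow>zs. factor_deg z)"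

text \<open>A list rather than a factor: index 0 yields the empty list, so that
  \<open>cheb 0 = 1\<close>, which is not centered, disappears from products.\<close>

definition cheb_factor :: "nat \<Rightarrow> factor list" where
  "cheb_factor k = (if k = 0 then [] else [Inl (k - 1)])"

lemma cheb_factor:
  "factors_prod (cheb_factor k) = cheb k" "factors_deg (cheb_factor k) = k"
  "map isl (cheb_factor k) = (if k = 0 then [] else [True])" "z \<in> set (cheb_factor k) \<Longrightarrow> isl z"
  by (auto simp: cheb_factor_def split: if_splits)

abbreviation alternating :: "bool list \<Rightarrow> bool" where
  "alternating \<equiv> successively (\<noteq>)"

text \<open>An end is dropped when its Chebyshev index is 0. As \<open>bs\<close> is not empty, the
  two outer letters never become neighbours.\<close>

lemma alternating_trim:
  assumes "alternating (True # bs @ [True])" "bs \<noteq> []"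
  shows "alternating ((if k = 0 then [] else [True]) @ bs @ (if i = 0 then [] else [True]))"
  using assms by (auto simp: successively_append_iff successively_Cons hd_append)

section \<open>Tracial functionals that satisfy the loop equation\<close>

locale loop_functional =
  fixes \<phi>0 :: "bool list \<Rightarrow> complex"
  assumes loop: "\<phi>0 (True # y) = (\<Sum>(u, v)\<leftarrow>splits y. \<phi>0 u * \<phi>0 v)"
    and rotate: "\<phi>0 (u @ v) = \<phi>0 (v @ u)"
    and unit: "\<phi>0 [] = 1"
begin

abbreviation \<Phi> :: "ncpoly \<Rightarrow> complex" where "\<Phi> \<equiv> lin \<phi>0"

sublocale \<Phi>: linear_functional \<Phi>
  by (rule lin_linear)

lemma \<Phi>_one: "\<Phi> 1 = 1"
  using lin_single[of \<phi>0 "[]" 1] unit by (simp add: mono_Nil)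

lemma \<Phi>_sandwich: "linear_functional (\<lambda>p. \<Phi> (g * p * h))"
proof
  show "\<Phi> (g * (p + q) * h) = \<Phi> (g * p * h) + \<Phi> (g * q * h)" for p q
    by (simp add: distrib_left distrib_right \<Phi>.add)
  show "\<Phi> (g * (cst c * p) * h) = c * \<Phi> (g * p * h)" for c p
    unfolding mult.assoc[symmetric] cst_commute[of c g, symmetric]
    by (simp add: mult.assoc \<Phi>.scale)
qed

lemma \<Phi>_commute: "\<Phi> (p * q) = \<Phi> (q * p)"
proof -
  have lr: "linear_functional (\<lambda>p. \<Phi> (p * q))" "linear_functional (\<lambda>p. \<Phi> (q * p))" for q
    using \<Phi>_sandwich[of 1 q] \<Phi>_sandwich[of q 1] by simp_all
  have ncmono: "\<Phi> (ncmono u * q) = \<Phi> (q * ncmono u)" for u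
    by (rule linear_functional_ext[OF lr(2) lr(1)])
      (use rotate in \<open>simp add: mult_single_list lin_single\<close>)
  show ?thesis by (rule linear_functional_ext[OF lr ncmono])
qed

text \<open>\<open>\<E> f g h\<close> is \<open>(\<Phi> \<otimes> \<Phi>) ((g \<otimes> 1) \<cdot> \<partial> f \<cdot> (1 \<otimes> h))\<close> for the free difference quotient \<open>\<partial>\<close>
  with respect to the first generator.\<close>

definition \<E> :: "ncpoly \<Rightarrow> ncpoly \<Rightarrow> ncpoly \<Rightarrow> complex" where
  "\<E> f g h = lin (\<lambda>w. \<Sum>(u, v)\<leftarrow>splits w. \<Phi> (g * ncmono u) * \<Phi> (ncmono v * h)) f"

lemma \<E>_eq: "\<E> f g h = (\<Sum>w\<in>keys f. lookup f w *
    (\<Sum>(u, v)\<leftarrow>splits w. \<Phi> (g * ncmono u) * \<Phi> (ncmono v * h)))"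
  unfolding \<E>_def by (rule lin_def)

lemma \<E>_linear: "linear_functional (\<lambda>f. \<E> f g h)"
  unfolding \<E>_def by (rule lin_linear)

lemma \<E>_mono: "\<E> (ncmono w) g h = (\<Sum>(u, v)\<leftarrow>splits w. \<Phi> (g * ncmono u) * \<Phi> (ncmono v * h))"
  by (simp add: \<E>_def lin_single)

lemma \<E>_linear_left: "linear_functional (\<lambda>g. \<E> f (k * g) h)"
proof
  show "\<E> f (k * (p + q)) h = \<E> f (k * p) h + \<E> f (k * q) h" for p q
    by (simp add: \<E>_eq distrib_left distrib_right \<Phi>.add split_def sum_list_addf sum.distrib)
  show "\<E> f (k * (cst c * p)) h = c * \<E> f (k * p) h" for c p
  proof -
    have "k * (cst c * p) = cst c * (k * p)" by (simp only: mult.assoc[symmetric] cst_commute[of c k])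
    then show ?thesis
      by (simp add: \<E>_eq mult.assoc \<Phi>.scale split_def sum_list_const_mult sum_distrib_left
          mult.left_commute)
  qed
qed

lemma \<E>_linear_right: "linear_functional (\<lambda>h. \<E> f g (h * k))"
proof
  show "\<E> f g ((p + q) * k) = \<E> f g (p * k) + \<E> f g (q * k)" for p q
    by (simp add: \<E>_eq distrib_left distrib_right \<Phi>.add split_def sum_list_addf sum.distrib)
  show "\<E> f g (cst c * p * k) = c * \<E> f g (p * k)" for c p
  proof -
    have "q * (cst c * p * k) = cst c * (q * (p * k))" for q by (simp only: mult.assoc[symmetric] cst_commute[of c q])
    then show ?thesis
      by (simp add: \<E>_eq \<Phi>.scale split_def sum_list_const_mult sum_distrib_left mult.left_commute)
  qed
qed

lemma linear_functional_plus:
  "linear_functional f \<Longrightarrow> linear_functional g \<Longrightarrow> linear_functional (\<lambda>p. f p + g p)"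
  by (simp add: linear_functional_def distrib_left)

text \<open>The Leibniz rule \<open>\<partial>(p q) = \<partial>p (1 \<otimes> q) + (p \<otimes> 1)
  \<partial>q\<close>; the outer arguments absorb the factor that is not differentiated.\<close>

lemma \<E>_mult: "\<E> (p * q) g h = \<E> p g (q * h) + \<E> q (g * p) h"
proof -
  have l1: "linear_functional (\<lambda>p. \<E> (p * q) g h)" for q
  proof
    show "\<E> ((p + p') * q) g h = \<E> (p * q) g h + \<E> (p' * q) g h" for p p'
      using linear_functional.add[OF \<E>_linear] by (simp add: distrib_right)
    show "\<E> (cst c * p * q) g h = c * \<E> (p * q) g h" for c p
      using linear_functional.scale[OF \<E>_linear] by (simp add: mult.assoc)
  qed
  have l2: "linear_functional (\<lambda>q. \<E> (p * q) g h)" for p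
  proof
    show "\<E> (p * (q + q')) g h = \<E> (p * q) g h + \<E> (p * q') g h" for q q'
      using linear_functional.add[OF \<E>_linear] by (simp add: distrib_left)
    show "\<E> (p * (cst c * q)) g h = c * \<E> (p * q) g h" for c q
      using linear_functional.scale[OF \<E>_linear[of g h], of c "p * q"]
      by (simp add: mult.assoc[symmetric] cst_commute[of c p])
  qed
  have ncmono: "\<E> (ncmono u * q) g h = \<E> (ncmono u) g (q * h) + \<E> q (g * ncmono u) h" for u
  proof (rule linear_functional_ext[OF l2 linear_functional_plus[OF \<E>_linear_right \<E>_linear]])
    fix v
    show "\<E> (ncmono u * ncmono v) g h = \<E> (ncmono u) g (ncmono v * h) + \<E> (ncmono v) (g * ncmono u) h"
      by (simp add: mult_single_list \<E>_mono splits_append split_def o_def mult.assoc[symmetric])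
        (simp add: mult.assoc mult_single_list)
  qed
  show ?thesis
    by (rule linear_functional_ext[OF l1 linear_functional_plus[OF \<E>_linear \<E>_linear_left] ncmono])
qed

text \<open>The loop equation extended from words by linearity: the first generator is its own
  conjugate variable for the free difference quotient.\<close>

lemma \<Phi>_True_mult: "\<Phi> (ncmono [True] * f) = \<E> f 1 1"
proof (rule linear_functional_ext[OF _ \<E>_linear])
  show "linear_functional (\<lambda>f. \<Phi> (ncmono [True] * f))"
    using \<Phi>_sandwich[of "ncmono [True]" 1] by simp
  show "\<Phi> (ncmono [True] * ncmono w) = \<E> (ncmono w) 1 1" for w
    using loop by (simp add: mult_single_list lin_single \<E>_mono)
qed

lemma \<E>_one: "\<E> 1 g h = 0"
  using \<E>_mono[of "[]" g h] by (simp add: mono_Nil)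

lemma \<E>_True: "\<E> (ncmono [True]) g h = \<Phi> g * \<Phi> h"
  by (simp add: \<E>_mono mono_Nil)

lemma \<E>_words_in_False:
  assumes "q \<in> words_in False"
  shows "\<E> q g h = 0"
proof -
  have "set w \<subseteq> {False} \<Longrightarrow> splits w = []" for w
    by (induction w) auto
  then show ?thesis
    using assms unfolding \<E>_def lin_def words_in_def by (intro sum.neutral) auto
qed

text \<open>This is \<open>\<partial>U_k = \<Sum> U_i \<otimes> U_(k-1-i)\<close>, the reason for
  choosing this basis: both legs are basis elements again, and of smaller index.\<close>

lemma \<E>_cheb: "\<E> (cheb k) g h = (\<Sum>i<k. \<Phi> (g * cheb i) * \<Phi> (cheb (k - 1 - i) * h))"
proof (induction k arbitrary: g rule: less_induct)
  case (less k)
  show ?case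
  proof (cases k)
    case 0
    then show ?thesis by (simp add: \<E>_one)
  next
    case (Suc l)
    let ?a = "\<lambda>i. \<Phi> (g * cheb i)" and ?b = "\<lambda>i. \<Phi> (cheb i * h)"
    have "\<E> (ncmono [True] * cheb l) g h = \<Phi> g * ?b l + \<E> (cheb l) (g * ncmono [True]) h"
      by (simp add: \<E>_mult \<E>_True)
    \<comment> \<open>The extra generator in the left slot is absorbed by the three-term recursion;
      the part with lowered index is the difference quotient of \<open>cheb (l - 1)\<close>, which
      the recursion for \<open>cheb k\<close> subtracts.\<close>
    also have "\<E> (cheb l) (g * ncmono [True]) h =
        (\<Sum>i<l. (?a (Suc i) + (if i = 0 then 0 else ?a (i - 1))) * ?b (l - 1 - i))"
      using less.IH[of l "g * ncmono [True]"] Suc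
      by (simp add: mult.assoc True_mult_cheb distrib_left \<Phi>.add \<Phi>.zero if_distrib cong: if_cong)
    also have "\<dots> = (\<Sum>i<l. ?a (Suc i) * ?b (l - 1 - i)) + (\<Sum>i<l. (if i = 0 then 0 else ?a (i - 1)) * ?b (l - 1 - i))"
      by (simp add: distrib_right sum.distrib)
    also have "(\<Sum>i<l. (if i = 0 then 0 else ?a (i - 1)) * ?b (l - 1 - i)) =
        (if l = 0 then 0 else \<E> (cheb (l - 1)) g h)"
    proof (cases l)
      case (Suc j)
      have "\<E> (cheb j) g h = (\<Sum>i<j. ?a i * ?b (j - 1 - i))"
        using less.IH[of j g] Suc \<open>k = Suc l\<close> by simp
      then show ?thesis using Suc by (simp add: sum.lessThan_Suc_shift del: sum.lessThan_Suc)
    qed simp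
    finally have "\<E> (ncmono [True] * cheb l) g h - (if l = 0 then 0 else \<E> (cheb (l - 1)) g h) =
        \<Phi> g * ?b l + (\<Sum>i<l. ?a (Suc i) * ?b (l - 1 - i))" by simp
    moreover have "\<E> (cheb k) g h = \<E> (ncmono [True] * cheb l) g h - (if l = 0 then 0 else \<E> (cheb (l - 1)) g h)"
      using linear_functional.diff[OF \<E>_linear[of g h]] linear_functional.zero[OF \<E>_linear[of g h]]
      by (simp add: Suc cheb_Suc)
    ultimately show ?thesis
      by (simp add: Suc sum.lessThan_Suc_shift del: sum.lessThan_Suc)
  qed
qed

section \<open>Vanishing of alternating products\<close>

definition valid_factors :: "factor list \<Rightarrow> bool" where
  "valid_factors zs \<longleftrightarrow> alternating (map isl zs) \<and>
     (\<forall>q. Inr q \<in> set zs \<longrightarrow> q \<in> words_in False \<and> \<Phi> q = 0)"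

lemma valid_factorsD:
  "valid_factors (ys @ zs) \<Longrightarrow> valid_factors ys \<and> valid_factors zs"
  by (auto simp: valid_factors_def successively_append_iff)

lemma valid_cheb_factor: "valid_factors (cheb_factor k)"
  by (auto simp: valid_factors_def cheb_factor_def)

text \<open>When \<open>\<partial>\<close> meets a Chebyshev factor of the tail, the left leg is
  \<open>cheb k\<close>, then \<open>pre\<close>, then \<open>cheb i\<close>, with both end indices
  lowered by at least one: an alternating product of smaller degree, zero by hypothesis.
  \<open>pre\<close> collects the factors already passed by the Leibniz rule.\<close>

lemma \<E>_tail_zero:
  assumes IH: "\<And>zs. factors_deg zs < N \<Longrightarrow> valid_factors zs \<Longrightarrow> zs \<noteq> [] \<Longrightarrow> \<Phi> (factors_prod zs) = 0"
    and "valid_factors (Inl k # pre @ rest)" "factors_deg (Inl k # pre @ rest) \<le> N"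
  shows "\<E> (factors_prod rest) (cheb k * factors_prod pre) 1 = 0"
  using assms(2,3)
proof (induction rest arbitrary: pre)
  case Nil
  show ?case by (simp add: \<E>_one)
next
  case (Cons z rest)
  have "\<E> (factors_prod rest) (cheb k * factors_prod pre * factor_val z) 1 = 0"
    using Cons.IH[of "pre @ [z]"] Cons.prems by (simp add: mult.assoc)
  moreover have "\<E> (factor_val z) (cheb k * factors_prod pre) (factors_prod rest * 1) = 0"
  proof (cases z)
    case (Inr q)
    then show ?thesis
      using Cons.prems by (auto simp: valid_factors_def intro: \<E>_words_in_False)
  next
    case (Inl l)
    have "\<Phi> (cheb k * factors_prod pre * cheb i) = 0" if "i < Suc l" for i
    proof -
      have "pre \<noteq> []" using Cons.prems Inl by (auto simp: valid_factors_def)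
      let ?zs = "cheb_factor k @ pre @ cheb_factor i"
      have "alternating (map isl (Inl k # pre @ [Inl l]))"
        using valid_factorsD[of "Inl k # pre @ [z]" rest] Cons.prems(1) Inl
        by (simp add: valid_factors_def)
      then have "alternating (map isl ?zs)"
        using alternating_trim[of "map isl pre" k i] \<open>pre \<noteq> []\<close> by (simp add: cheb_factor(3))
      moreover have "q \<in> words_in False \<and> \<Phi> q = 0" if "Inr q \<in> set ?zs" for q
        using that Cons.prems(1) by (auto simp: valid_factors_def dest: cheb_factor(4))
      ultimately have "valid_factors ?zs" by (auto simp: valid_factors_def)
      moreover have "factors_deg ?zs < N"
        using Cons.prems(2) that by (simp add: cheb_factor(2) Inl)
      ultimately have "\<Phi> (factors_prod ?zs) = 0"
        using IH[of ?zs] \<open>pre \<noteq> []\<close> by simp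
      then show ?thesis by (simp add: cheb_factor(1) mult.assoc)
    qed
    then show ?thesis by (simp add: Inl \<E>_cheb del: sum.lessThan_Suc)
  qed
  ultimately show ?case by (simp add: \<E>_mult)
qed

text \<open>Write the first factor as \<open>s cheb k - cheb (k - 1)\<close> and apply the loop
  equation to the first part. Terms that differentiate the tail vanish by
  \<open>\<E>_tail_zero\<close>. Among those that differentiate \<open>cheb k\<close> only index 0
  survives, since the others carry a centered \<open>cheb i\<close>, and it cancels the second
  part.\<close>

lemma \<Phi>_factors_Inl:
  assumes IH: "\<And>zs. factors_deg zs < N \<Longrightarrow> valid_factors zs \<Longrightarrow> zs \<noteq> [] \<Longrightarrow> \<Phi> (factors_prod zs) = 0"
    and v: "valid_factors (Inl k # zs)" "factors_deg (Inl k # zs) \<le> N"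
  shows "\<Phi> (factors_prod (Inl k # zs)) = 0"
proof -
  let ?Z = "factors_prod zs"
  have cheb0: "\<Phi> (cheb i) = 0" if "0 < i" "i < k" for i
  proof -
    have "\<Phi> (factors_prod (cheb_factor i)) = 0"
      using that v(2) by (intro IH valid_cheb_factor) (simp_all add: cheb_factor(2), simp add: cheb_factor_def)
    then show ?thesis by (simp add: cheb_factor(1))
  qed
  have "\<Phi> (ncmono [True] * (cheb k * ?Z)) = \<E> (cheb k) 1 (?Z * 1) + \<E> ?Z (1 * cheb k) 1"
    by (simp add: \<Phi>_True_mult \<E>_mult)
  also have "\<E> ?Z (1 * cheb k) 1 = 0"
    using \<E>_tail_zero[OF IH, where k = k and pre = "[]" and rest = zs] v by simp
  also have "\<E> (cheb k) 1 (?Z * 1) = (\<Sum>i<k. if i = 0 then \<Phi> (cheb (k - 1) * ?Z) else 0)"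
    unfolding \<E>_cheb by (intro sum.cong) (auto simp: \<Phi>_one cheb0)
  also have "\<dots> = (if k = 0 then 0 else \<Phi> (cheb (k - 1) * ?Z))" by simp
  finally show ?thesis
    by (simp add: cheb_Suc left_diff_distrib \<Phi>.diff \<Phi>.zero mult.assoc)
qed

text \<open>Traciality disposes of a leading polynomial \<open>q\<close> in the second generator: it
  moves to the end, where it either continues the alternation or meets another such polynomial. In
  the latter case their product is recentered, leaving two alternating lists that begin with a
  Chebyshev factor.\<close>

lemma \<Phi>_factors: "valid_factors zs \<Longrightarrow> zs \<noteq> [] \<Longrightarrow> \<Phi> (factors_prod zs) = 0"
proof (induction "factors_deg zs" arbitrary: zs rule: less_induct)
  case less
  \<comment> \<open>Equality of degrees must be allowed: polynomials in the second generator have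
    degree 0, so moving or merging them does not lower it.\<close>
  have Inl_first: "\<Phi> (factors_prod (Inl k # ys)) = 0"
    if "valid_factors (Inl k # ys)" "factors_deg (Inl k # ys) \<le> factors_deg zs" for k ys
    using less.hyps that by (rule \<Phi>_factors_Inl)
  show ?case
  proof (cases zs)
    case (Cons z ys)
    show ?thesis
    proof (cases z)
      case (Inl k)
      then show ?thesis using Inl_first[of k ys] less.prems Cons by simp
    next
      case (Inr q)
      have q: "q \<in> words_in False" "\<Phi> q = 0" using less.prems Cons Inr by (auto simp: valid_factors_def)
      show ?thesis
      proof (cases ys)
        case Nil
        then show ?thesis using Cons Inr q by simp
      next
        case (Cons y ys')
        have "isl y" using less.prems \<open>zs = z # ys\<close> Cons Inr by (auto simp: valid_factors_def)
        then obtain k where y: "y = Inl k" by (auto simp: isl_def)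
        have "ys \<noteq> []" using Cons by simp
        have vy: "valid_factors ys"
          using valid_factorsD[of "[z]" ys] less.prems \<open>zs = z # ys\<close> by simp
        have deg: "factors_deg ys = factors_deg zs" by (simp add: \<open>zs = z # ys\<close> Inr)
        have eq: "\<Phi> (factors_prod zs) = \<Phi> (factors_prod ys * q)"
          using \<Phi>_commute by (simp add: \<open>zs = z # ys\<close> Inr)
        show ?thesis
        proof (cases "isl (last ys)")
          case True
          have "valid_factors (ys @ [Inr q])"
            using vy True q \<open>ys \<noteq> []\<close> by (auto simp: valid_factors_def successively_append_iff last_map)
          then show ?thesis
            using Inl_first[of k "ys' @ [Inr q]"] deg eq Cons y by (simp add: mult.assoc)
        next
          case False
          then obtain q' where last: "last ys = Inr q'" by (cases "last ys") auto
          define zs' where "zs' = butlast ys"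
          have ys: "ys = zs' @ [Inr q']" unfolding zs'_def last[symmetric] using \<open>ys \<noteq> []\<close> by simp
          obtain zs'' where zs'': "zs' = Inl k # zs''"
            using ys Cons y by (cases zs') auto
          have q': "q' \<in> words_in False" using vy ys by (auto simp: valid_factors_def)
          define c where "c = \<Phi> (q' * q)"
          define q'' where "q'' = q' * q - cst c"
          have q'': "q'' \<in> words_in False" "\<Phi> q'' = 0"
            using q q' \<Phi>.scale[of c 1]
            by (simp_all add: q''_def words_in_mult words_in_diff_cst \<Phi>.diff c_def \<Phi>_one)
          have "valid_factors (zs' @ [Inr q''])" "valid_factors zs'"
            using vy ys q'' by (auto simp: valid_factors_def successively_append_iff)
          moreover have "factors_deg zs' = factors_deg zs"
            using deg by (simp add: ys)
          ultimately have "\<Phi> (factors_prod (zs' @ [Inr q''])) = 0" "\<Phi> (factors_prod zs') = 0"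
            using Inl_first[of k "zs'' @ [Inr q'']"] Inl_first[of k zs''] by (simp_all add: zs'')
          moreover have "factors_prod ys * q = factors_prod (zs' @ [Inr q'']) + cst c * factors_prod zs'"
            by (simp add: ys q''_def right_diff_distrib mult.assoc cst_commute)
          ultimately show ?thesis unfolding eq by (simp add: \<Phi>.add \<Phi>.scale)
        qed
      qed
    qed
  qed (use less.prems in simp)
qed

text \<open>Chebyshev polynomials span the polynomials in s. The claim is strengthened to
  \<open>s^n cheb k\<close>, so that the three-term recursion absorbs one s at a time.\<close>

lemma cheb_span:
  assumes f: "linear_functional f" "\<And>k. f (cheb k) = 0" and p: "p \<in> words_in True"
  shows "f p = 0"
proof -
  interpret linear_functional f by fact
  have rep: "w = replicate (length w) True" if "set w \<subseteq> {True}" for w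
    using that by (induction w) auto
  have "f (ncmono (replicate n True) * cheb k) = 0" for n k
  proof (induction n arbitrary: k)
    case 0
    then show ?case by (simp add: mono_Nil f(2))
  next
    case (Suc n)
    have "ncmono (replicate (Suc n) True) = ncmono (replicate n True) * ncmono [True]"
      by (simp add: mult_single_list replicate_append_same)
    then have "ncmono (replicate (Suc n) True) * cheb k =
        ncmono (replicate n True) * (cheb (Suc k) + (if k = 0 then 0 else cheb (k - 1)))"
      by (simp add: mult.assoc True_mult_cheb)
    then show ?case using Suc[of "Suc k"] Suc[of "k - 1"] by (simp add: distrib_left add zero del: replicate_Suc)
  qed
  from this[of _ 0] have "f (ncmono (replicate n True)) = 0" for n by simp
  then have "f (ncmono w) = 0" if "set w \<subseteq> {True}" for w
    by (subst rep[OF that])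
  then show ?thesis
    using p unfolding eq_sum[of p] words_in_def by (intro sum.neutral) auto
qed

text \<open>Factors move from \<open>pre\<close> to \<open>suf\<close> one at a time, from the
  right; those in s are replaced by Chebyshev polynomials. The empty \<open>pre\<close> is the case
  already treated.\<close>

theorem \<Phi>_alternating_mixed:
  assumes "alternating (map fst pre @ map isl suf)" "pre \<noteq> [] \<or> suf \<noteq> []"
    "\<And>b p. (b, p) \<in> set pre \<Longrightarrow> p \<in> words_in b \<and> \<Phi> p = 0"
    "\<And>q. Inr q \<in> set suf \<Longrightarrow> q \<in> words_in False \<and> \<Phi> q = 0"
  shows "\<Phi> ((\<Prod>(b, p)\<leftarrow>pre. p) * factors_prod suf) = 0"
  using assms
proof (induction pre arbitrary: suf rule: rev_induct)
  case Nil
  then show ?case using \<Phi>_factors[of suf] by (auto simp: valid_factors_def)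
next
  case (snoc bp pre)
  obtain b p where bp: "bp = (b, p)" by force
  have p: "p \<in> words_in b" "\<Phi> p = 0" using snoc.prems(3)[of b p] bp by auto
  let ?P = "\<Prod>(b, p)\<leftarrow>pre. p"
  show ?case
  proof (cases b)
    case False
    have "\<Phi> (?P * factors_prod (Inr p # suf)) = 0"
      using snoc.prems p False bp by (intro snoc.IH) auto
    then show ?thesis by (simp add: bp mult.assoc)
  next
    case True
    let ?F = "\<lambda>p. \<Phi> (?P * p * factors_prod suf)"
    have cheb0: "\<Phi> (cheb (Suc k)) = 0" for k
      using \<Phi>_factors[of "[Inl k]"] by (simp add: valid_factors_def)
    have F0: "?F (cheb (Suc k)) = 0" for k
    proof -
      have "\<Phi> (?P * factors_prod (Inl k # suf)) = 0"
        using snoc.prems True bp by (intro snoc.IH) auto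
      then show ?thesis by (simp add: mult.assoc)
    qed
    \<comment> \<open>The subtraction makes the functional vanish at \<open>cheb 0 = 1\<close> too,
      where nothing is known about \<open>?F\<close>. For centered \<open>p\<close> the correction
      is zero.\<close>
    have l: "linear_functional (\<lambda>p. ?F p - \<Phi> p * ?F 1)"
    proof
      interpret F: linear_functional ?F by (rule \<Phi>_sandwich)
      show "?F (p + q) - \<Phi> (p + q) * ?F 1 = ?F p - \<Phi> p * ?F 1 + (?F q - \<Phi> q * ?F 1)" for p q
        by (simp only: F.add \<Phi>.add) (simp add: algebra_simps)
      show "?F (cst c * p) - \<Phi> (cst c * p) * ?F 1 = c * (?F p - \<Phi> p * ?F 1)" for c p
        by (simp only: F.scale \<Phi>.scale) (simp add: algebra_simps)
    qed
    have c: "?F (cheb k) - \<Phi> (cheb k) * ?F 1 = 0" for k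
      by (cases k) (simp_all add: \<Phi>_one cheb0 F0 del: cheb.simps(2,3))
    have "p \<in> words_in True" using p(1) True by simp
    from cheb_span[OF l c this] have "?F p - \<Phi> p * ?F 1 = 0" .
    then show ?thesis using p(2) by (simp add: bp mult.assoc)
  qed
qed

lemma \<Phi>_alternating:
  assumes "alternating (map fst ps)" "ps \<noteq> []" "\<And>b p. (b, p) \<in> set ps \<Longrightarrow> p \<in> words_in b \<and> \<Phi> p = 0"
  shows "\<Phi> (\<Prod>(b, p)\<leftarrow>ps. p) = 0"
  using \<Phi>_alternating_mixed[of ps "[]"] assms by simp

end

section \<open>The limiting non-commutative probability space\<close>

text \<open>Polynomials are represented by their coefficient functions, in the type required of the
  limit algebra; the operations are transported through \<open>Abs_poly_mapping\<close> and are
  meaningful on the carrier only.\<close>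

definition free_algebra :: "(complex, bool list \<Rightarrow> complex) module" where
  "free_algebra = \<lparr>carrier = range lookup,
     mult = (\<lambda>f g. lookup (Abs_poly_mapping f * Abs_poly_mapping g)),
     one = lookup 1, zero = lookup 0,
     add = (\<lambda>f g. lookup (Abs_poly_mapping f + Abs_poly_mapping g)),
     Module.module.smult = (\<lambda>c f. lookup (cst c * Abs_poly_mapping f))\<rparr>"

lemma free_algebra_simps [simp]:
  "carrier free_algebra = range lookup"
  "lookup p \<otimes>\<^bsub>free_algebra\<^esub> lookup q = lookup (p * q)"
  "\<one>\<^bsub>free_algebra\<^esub> = lookup 1"
  "\<zero>\<^bsub>free_algebra\<^esub> = lookup 0"
  "lookup p \<oplus>\<^bsub>free_algebra\<^esub> lookup q = lookup (p + q)"
  "c \<odot>\<^bsub>free_algebra\<^esub> lookup p = lookup (cst c * p)"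
  by (simp_all add: free_algebra_def)

lemma cst_add: "cst (a + b) = cst a + cst b"
  by (simp add: single_add)

lemma cst_mult: "cst (a * b) = cst a * cst b"
  by (simp add: mult_single_list)

lemma free_algebra_abelian_group: "abelian_group free_algebra"
proof (rule abelian_groupI)
  show "\<exists>y\<in>carrier free_algebra. y \<oplus>\<^bsub>free_algebra\<^esub> x = \<zero>\<^bsub>free_algebra\<^esub>"
    if "x \<in> carrier free_algebra" for x
  proof -
    obtain p where "x = lookup p" using \<open>x \<in> carrier free_algebra\<close> by auto
    then have "lookup (- p) \<oplus>\<^bsub>free_algebra\<^esub> x = \<zero>\<^bsub>free_algebra\<^esub>" by simp
    then show ?thesis by (intro bexI[of _ "lookup (- p)"]) auto
  qed
qed (auto simp: add_ac)

lemma free_algebra_ring: "ring free_algebra"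
  by (intro ringI free_algebra_abelian_group monoidI) (auto simp: mult.assoc distrib_left distrib_right)

lemma free_algebra_module: "module class_ring free_algebra"
proof (rule moduleI)
  show "cring (class_ring :: complex ring)" by (rule class_cring.cring_axioms)
qed (auto simp: free_algebra_abelian_group cst_add cst_mult cst_one distrib_left distrib_right mult.assoc)

lemma free_algebra_complex_algebra: "complex_algebra free_algebra"
proof (intro complex_algebra.intro complex_algebra_axioms.intro free_algebra_module free_algebra_ring)
  fix a b c assume "a \<in> carrier free_algebra" "b \<in> carrier free_algebra"
  then obtain p q where ab: "a = lookup p" "b = lookup q" by auto
  have "p * (cst c * q) = cst c * (p * q)"
    by (simp only: mult.assoc[symmetric] cst_commute[of c p])
  then show "a \<otimes>\<^bsub>free_algebra\<^esub> (c \<odot>\<^bsub>free_algebra\<^esub> b) = c \<odot>\<^bsub>free_algebra\<^esub> (a \<otimes>\<^bsub>free_algebra\<^esub> b)"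
    by (simp add: ab)
  show "c \<odot>\<^bsub>free_algebra\<^esub> a \<otimes>\<^bsub>free_algebra\<^esub> b = c \<odot>\<^bsub>free_algebra\<^esub> (a \<otimes>\<^bsub>free_algebra\<^esub> b)"
    by (simp add: ab mult.assoc)
qed

lemma free_algebra_uminus:
  "\<ominus>\<^bsub>free_algebra\<^esub> lookup p = lookup (cst (- 1) * p)"
proof -
  interpret ring free_algebra by (rule free_algebra_ring)
  have "cst (- 1) * p + p = (cst (- 1) + cst 1) * p" by (simp add: distrib_right cst_one)
  also have "\<dots> = 0" by (simp flip: single_add)
  finally show ?thesis
    by (intro minus_equality) auto
qed

lemma unital_subalgebra_image:
  assumes "1 \<in> S" "\<And>p q. p \<in> S \<Longrightarrow> q \<in> S \<Longrightarrow> p + q \<in> S" "\<And>p q. p \<in> S \<Longrightarrow> q \<in> S \<Longrightarrow> p * q \<in> S"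
    "\<And>c p. p \<in> S \<Longrightarrow> cst c * p \<in> S"
  shows "unital_subalgebra free_algebra (lookup ` S)"
  unfolding unital_subalgebra_def
proof
  show "subring (lookup ` S) free_algebra"
    by (rule ring.subringI[OF free_algebra_ring]) (use assms in \<open>auto simp: free_algebra_uminus\<close>)
  have "0 \<in> S" using assms(4)[OF assms(1), of 0] by simp
  then show "Module.submodule (lookup ` S) class_ring free_algebra"
    by (intro module.submoduleI[OF free_algebra_module]) (use assms in \<open>auto simp: free_algebra_uminus\<close>)
qed

lemma unital_subalgebra_Inter:
  fixes A :: "(complex, 'a) module"
  assumes A: "complex_algebra A" and "\<B> \<noteq> {}" "\<And>B. B \<in> \<B> \<Longrightarrow> unital_subalgebra A B"
  shows "unital_subalgebra A (\<Inter>\<B>)"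
  unfolding unital_subalgebra_def
proof
  have mod: "module (class_ring :: complex ring) A" and ring: "ring A"
    using A by (auto simp: complex_algebra_def)
  have r: "subring B A" and m: "Module.submodule B (class_ring :: complex ring) A" if "B \<in> \<B>" for B
    using assms(3)[OF that] by (auto simp: unital_subalgebra_def)
  obtain B0 where "B0 \<in> \<B>" using assms(2) by blast
  have sub: "\<Inter>\<B> \<subseteq> carrier A"
    using subringE(1)[OF r[OF \<open>B0 \<in> \<B>\<close>]] \<open>B0 \<in> \<B>\<close> by blast
  show "subring (\<Inter>\<B>) A"
  proof (rule ring.subringI[OF ring sub])
    show "\<one>\<^bsub>A\<^esub> \<in> \<Inter>\<B>" using subringE(3)[OF r] by blast
    show "\<ominus>\<^bsub>A\<^esub> y \<in> \<Inter>\<B>" if "y \<in> \<Inter>\<B>" for y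
      using subringE(5)[OF r] that by blast
    show "y \<otimes>\<^bsub>A\<^esub> z \<in> \<Inter>\<B>" if "y \<in> \<Inter>\<B>" "z \<in> \<Inter>\<B>" for y z
      using subringE(6)[OF r] that by blast
    show "y \<oplus>\<^bsub>A\<^esub> z \<in> \<Inter>\<B>" if "y \<in> \<Inter>\<B>" "z \<in> \<Inter>\<B>" for y z
      using subringE(7)[OF r] that by blast
  qed
  show "Module.submodule (\<Inter>\<B>) (class_ring :: complex ring) A"
  proof (rule module.submoduleI[OF mod sub])
    show "c \<odot>\<^bsub>A\<^esub> y \<in> \<Inter>\<B>" if "c \<in> carrier (class_ring :: complex ring)" "y \<in> \<Inter>\<B>" for c y
      using module.submoduleE(4)[OF mod m] that by blast
    show "\<zero>\<^bsub>A\<^esub> \<in> \<Inter>\<B>" using subringE(2)[OF r] by blast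
    show "\<ominus>\<^bsub>A\<^esub> y \<in> \<Inter>\<B>" if "y \<in> \<Inter>\<B>" for y
      using subringE(5)[OF r] that by blast
    show "y \<oplus>\<^bsub>A\<^esub> z \<in> \<Inter>\<B>" if "y \<in> \<Inter>\<B>" "z \<in> \<Inter>\<B>" for y z
      using subringE(7)[OF r] that by blast
  qed
qed

lemma unital_subalgebra_carrier: "unital_subalgebra free_algebra (carrier free_algebra)"
  using unital_subalgebra_image[of UNIV] by simp

lemma unital_subalgebra_generated:
  assumes "S \<subseteq> carrier free_algebra"
  shows "unital_subalgebra free_algebra (generated_subalgebra free_algebra S)"
  unfolding generated_subalgebra_def
  by (rule unital_subalgebra_Inter[OF free_algebra_complex_algebra])
    (use unital_subalgebra_carrier assms in auto)

text \<open>Puts elements of the generated subalgebra into polynomial form, to which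
  \<open>\<Phi>_alternating\<close> applies.\<close>

lemma generated_subalgebra_letter:
  "generated_subalgebra free_algebra {lookup (ncmono [b])} \<subseteq> lookup ` words_in b"
proof -
  have "unital_subalgebra free_algebra (lookup ` words_in b)"
    by (intro unital_subalgebra_image words_in_one words_in_add words_in_mult words_in_single) auto
  moreover have "ncmono [b] \<in> words_in b" by (intro words_in_single) auto
  ultimately show ?thesis unfolding generated_subalgebra_def by (intro Inter_lower) auto
qed

lemma alg_prod_lookup:
  "alg_prod free_algebra (map lookup ps) = lookup (prod_list ps)"
  by (induction ps) (auto simp: alg_prod_def)

lemma prod_list_mono: "(\<Prod>b\<leftarrow>w. ncmono [b]) = ncmono w"
  by (induction w) (auto simp: mono_Nil mult_single_list)

section \<open>The limit state and the freeness of the generators\<close>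

context loop_functional
begin

definition state :: "(bool list \<Rightarrow> complex) \<Rightarrow> complex" where
  "state f = \<Phi> (Abs_poly_mapping f)"

lemma state_lookup [simp]: "state (lookup p) = \<Phi> p"
  by (simp add: state_def)

lemma nc_prob_space_state: "nc_prob_space free_algebra state"
proof (intro nc_prob_space.intro nc_prob_space_axioms.intro free_algebra_complex_algebra)
  show "state (a \<oplus>\<^bsub>free_algebra\<^esub> b) = state a + state b"
    if "a \<in> carrier free_algebra" "b \<in> carrier free_algebra" for a b
    using that by (auto simp: \<Phi>.add)
  show "state (c \<odot>\<^bsub>free_algebra\<^esub> a) = c * state a" if "a \<in> carrier free_algebra" for a c
    using that by (auto simp: \<Phi>.scale)
qed (simp add: \<Phi>_one)

lemma state_word:
  "state (alg_prod free_algebra (map (\<lambda>b. lookup (ncmono [b])) w)) = \<phi>0 w"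
  using alg_prod_lookup[of "map (\<lambda>b. ncmono [b]) w"]
  by (simp add: o_def prod_list_mono lin_single)

lemma free_generators:
  "free_subalgebras free_algebra state UNIV
     (\<lambda>b. generated_subalgebra free_algebra {lookup (ncmono [b])})"
  unfolding free_subalgebras_def
proof (intro conjI ballI allI impI)
  show "unital_subalgebra free_algebra (generated_subalgebra free_algebra {lookup (ncmono [b])})" for b
    by (intro unital_subalgebra_generated) simp
  fix as and bs :: "bool list"
  assume ne: "as \<noteq> []" and len: "length bs = length as"
    and mem: "\<forall>j<length as. as ! j \<in> generated_subalgebra free_algebra {lookup (ncmono [bs ! j])} \<and>
        state (as ! j) = 0"
    and alt: "\<forall>j. Suc j < length as \<longrightarrow> bs ! j \<noteq> bs ! Suc j"
  define qs where "qs = zip bs (map Abs_poly_mapping as)"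
  have fst: "map fst qs = bs" and snd: "map snd qs = map Abs_poly_mapping as"
    using len by (simp_all add: qs_def)
  have q: "p \<in> words_in b \<and> \<Phi> p = 0" if bp: "(b, p) \<in> set qs" for b p
  proof -
    obtain j where j: "j < length as" "b = bs ! j" "p = Abs_poly_mapping (as ! j)"
      using bp len by (auto simp: qs_def set_zip)
    have "as ! j \<in> lookup ` words_in b"
      using mem j generated_subalgebra_letter[of b] by blast
    then obtain p' where "as ! j = lookup p'" "p' \<in> words_in b" by blast
    moreover have "state (as ! j) = 0" using mem j by blast
    ultimately show ?thesis using j by simp
  qed
  have "lookup (Abs_poly_mapping a) = a" if a: "a \<in> set as" for a
  proof -
    obtain j where "j < length as" "a = as ! j" using a by (auto simp: in_set_conv_nth)
    then have "a \<in> lookup ` words_in (bs ! j)"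
      using mem generated_subalgebra_letter[of "bs ! j"] by blast
    then show ?thesis by auto
  qed
  then have "as = map lookup (map snd qs)"
    unfolding snd map_map by (intro map_idI[symmetric]) simp
  then have "state (alg_prod free_algebra as) = \<Phi> (prod_list (map snd qs))"
    using alg_prod_lookup[of "map snd qs"] by simp
  also have "\<dots> = \<Phi> (\<Prod>(b, p)\<leftarrow>qs. p)"
    by (simp add: split_def cong: map_cong)
  also have "\<dots> = 0"
  proof (rule \<Phi>_alternating)
    show "alternating (map fst qs)"
      unfolding fst successively_conv_nth using alt len by simp
    show "qs \<noteq> []" using fst ne len by auto
  qed (rule q)
  finally show "state (alg_prod free_algebra as) = 0" .
qed

end

theorem mainTheorem5:
  fixes M :: "'w measure"
    and W :: "nat \<Rightarrow> 'w \<Rightarrow> complex mat"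
    and L :: "nat \<Rightarrow> nat \<times> nat \<Rightarrow> int ^ 'd"
    and x :: "int ^ 'd \<Rightarrow> 'w \<Rightarrow> real"
  assumes "prob_space M"
    and "CARD('d) = 1 \<or> CARD('d) = 2"
    and "\<And>n. GUE M n (W n)"
    and "symmetric_link L"
    and "property_B L"
    and "prob_space.indep_vars M (\<lambda>_. borel) x UNIV"
    and "\<And>m. \<exists>C. \<forall>t. integrable M (\<lambda>\<omega>. \<bar>x t \<omega>\<bar> ^ m) \<and> (LINT \<omega>|M. \<bar>x t \<omega>\<bar> ^ m) \<le> C"
    and "\<And>t. prob_space.expectation M (x t) = 0"
    and "\<And>t. prob_space.variance M (x t) = 1"
    and "\<And>n. independent_matrices M n (W n) (\<lambda>\<omega>. complex_mat (patterned_matrix L x n \<omega>))"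
    and "\<exists>\<nu>. is_LSD M (scaled_patterned_matrix L x) \<nu>"
  shows "\<exists>(A :: (complex, bool list \<Rightarrow> complex) module) \<phi> s a.
           nc_prob_space A \<phi> \<and> s \<in> carrier A \<and> a \<in> carrier A \<and>
           converges_jointly M
             (\<lambda>n. case_bool (W n) (\<lambda>\<omega>. complex_mat (scaled_patterned_matrix L x n \<omega>)))
             A \<phi> (case_bool s a) \<and>
           free_subalgebras A \<phi> UNIV
             (case_bool (generated_subalgebra A {s}) (generated_subalgebra A {a}))"
proof -
  obtain \<nu> where \<nu>: "is_LSD M (scaled_patterned_matrix L x) \<nu>" using assms(11) by blast
  interpret prob_space M by (rule assms(1))
  interpret gue_patterned M x L \<nu> W
    by (unfold_locales; fact assms \<nu>)
  interpret loop_functional limit_moment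
    by (unfold_locales; fact limit_moment_loop limit_moment_rotate limit_moment_Nil)
  let ?s = "lookup (ncmono [True])" and ?a = "lookup (ncmono [False])"
  have letters: "case_bool ?s ?a = (\<lambda>b. lookup (ncmono [b]))"
    by (auto simp: fun_eq_iff split: bool.split)
  have gens: "case_bool (generated_subalgebra free_algebra {?s}) (generated_subalgebra free_algebra {?a}) =
      (\<lambda>b. generated_subalgebra free_algebra {lookup (ncmono [b])})"
    by (auto simp: fun_eq_iff split: bool.split)
  show ?thesis
  proof (intro exI conjI)
    show "nc_prob_space free_algebra state" by (rule nc_prob_space_state)
    show "?s \<in> carrier free_algebra" "?a \<in> carrier free_algebra" by simp_all
    show "converges_jointly M (\<lambda>n. case_bool (W n) (A n)) free_algebra state (case_bool ?s ?a)"
      unfolding converges_jointly_def letters state_word phi2_matrix_word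
      using integrable_matrix_word limit_moment_tendsto by blast
    show "free_subalgebras free_algebra state UNIV
        (case_bool (generated_subalgebra free_algebra {?s}) (generated_subalgebra free_algebra {?a}))"
      unfolding gens by (rule free_generators)
  qed
qed

end
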